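(* Let $N\ge2$, $p>1$, and let $\Omega\subset\mathbb{R}^N$ be a ball. Let $f\equiv1$, $\beta>0$, and let $g\in C(\partial\Omega)$ be non-constant. For each $m>0$ let $(u,h_u)$ be the unique minimizer of $J$ over $W^{1,p}(\Omega)\times\mathcal{H}_m(\partial\Omega)$ (see context). Then there exists $\overline m>0$ such that, for $m>0$: i) if $m<\overline m$, then $h_u$ vanishes on a subset of $\partial\Omega$ of positive $\mathcal{H}^{N-1}$-measure; ii) if $m>\overline m$, then $h_u>0$ on $\partial\Omega$.
   Context: For $m>0$, $$\mathcal{H}_m(\partial\Omega)=\left\{h\in L^1(\partial\Omega):\ h\ge0,\ \int_{\partial\Omega}h\,d\mathcal{H}^{N-1}=m\right\},$$ and for $(v,h)\in W^{1,p}(\Omega)\times\mathcal{H}_m(\partial\Omega)$, $$J(v,h)=\frac1p\int_\Omega|\nabla v|^p\,dx+\frac{\beta}{p}\int_{\partial\Omega}\frac{|v-g|^p}{(1+\beta^{\frac1{p-1}}h)^{p-1}}\,d\mathcal{H}^{N-1}-\int_\Omega fv\,dx ,$$ with $f\equiv1$. Since $\Omega$ is connected and $\int_\Omega f\,dx\neq0$, there is a unique minimizing pair $(u,h_u)$, and $h_u$ is given by $$h_u(\sigma)=\begin{cases}\dfrac{|u(\sigma)-g(\sigma)|}{c_u\beta^{\frac1{p-1}}}-\dfrac1{\beta^{\frac1{p-1}}}&\text{if }|u(\sigma)-g(\sigma)|>c_u,\\[2mm]0&\text{otherwise,}\end{cases}$$ where $c_u>0$ is the unique constant satisfying $$c_u=\frac{1}{\mathcal{H}^{N-1}(\{|u-g|>c_u\})+m\beta^{\frac1{p-1}}}\int_{\{|u-g|>c_u\}}|u-g|\,d\mathcal{H}^{N-1},\qquad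 \{|u-g|>c_u\}\subset\partial\Omega.$$ The function $u$ is identified with its continuous representative on $\overline\Omega$, so that $h_u$ is defined pointwise on $\partial\Omega$ by this formula. *)

theory Defs
  imports "HOL-Analysis.Analysis"
begin

section \<open>Hausdorff measure\<close>

text \<open>Contribution of one covering set to the \<open>k\<close>-dimensional Hausdorff measure, normalised so
  that \<open>k = n\<close> gives Lebesgue measure in dimension \<open>n\<close>.  The case distinction matters
  only for \<open>k = 0\<close>, where a singleton must count 1 and the empty set 0.\<close>

definition hausdorff_gauge :: "nat \<Rightarrow> 'a::metric_space set \<Rightarrow> ennreal" where
  "hausdorff_gauge k C =
     (if C = {} then 0 else ennreal (unit_ball_vol (real k) * (diameter C / 2) ^ k))"

text \<open>Boundedness is required explicitly because \<open>diameter\<close> is an unspecified real number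
  on unbounded sets.\<close>

definition hausdorff_content :: "nat \<Rightarrow> real \<Rightarrow> 'a::metric_space set \<Rightarrow> ennreal" where
  "hausdorff_content k \<delta> A =
     (INF C \<in> {C :: nat \<Rightarrow> 'a set. A \<subseteq> (\<Union>j. C j) \<and> (\<forall>j. bounded (C j) \<and> diameter (C j) \<le> \<delta>)}.
        \<Sum>j. hausdorff_gauge k (C j))"

definition hausdorff_outer :: "nat \<Rightarrow> 'a::metric_space set \<Rightarrow> ennreal" where
  "hausdorff_outer k A = (SUP \<delta> \<in> {0<..}. hausdorff_content k \<delta> A)"

text \<open>The Hausdorff outer measure is a metric outer measure, hence countably additive on the
  Borel sets; so \<open>measure_of\<close> returns its restriction to the Borel sets.\<close>

definition hausdorff_measure :: "nat \<Rightarrow> 'a::metric_space measure" where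
  "hausdorff_measure k = measure_of UNIV (sets borel) (hausdorff_outer k)"

definition bdry_measure :: "'a::euclidean_space set \<Rightarrow> 'a measure" where
  "bdry_measure \<Omega> = restrict_space (hausdorff_measure (DIM('a) - 1)) (frontier \<Omega>)"


section \<open>Sobolev functions and traces\<close>

text \<open>Elements of $L^p$, $W^{1,p}$ and of the trace space are represented by functions, not by
  classes modulo null sets.\<close>

definition Lp :: "'a measure \<Rightarrow> real \<Rightarrow> ('a \<Rightarrow> 'b::real_normed_vector) set" where
  "Lp M p = {v \<in> borel_measurable M. integrable M (\<lambda>x. norm (v x) powr p)}"

primrec Ck :: "nat \<Rightarrow> ('a::euclidean_space \<Rightarrow> real) \<Rightarrow> bool" where
  "Ck 0 \<phi> \<longleftrightarrow> continuous_on UNIV \<phi>"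
| "Ck (Suc k) \<phi> \<longleftrightarrow> (\<forall>x. \<phi> differentiable (at x)) \<and>
     (\<forall>b\<in>Basis. Ck k (\<lambda>x. frechet_derivative \<phi> (at x) b))"

definition test_functions :: "'a::euclidean_space set \<Rightarrow> ('a \<Rightarrow> real) set" where
  "test_functions \<Omega> =
     {\<phi>. (\<forall>k. Ck k \<phi>) \<and> (\<exists>K. compact K \<and> K \<subseteq> \<Omega> \<and> (\<forall>x. x \<notin> K \<longrightarrow> \<phi> x = 0))}"

definition is_weak_gradient ::
  "'a::euclidean_space set \<Rightarrow> ('a \<Rightarrow> real) \<Rightarrow> ('a \<Rightarrow> 'a) \<Rightarrow> bool" where
  "is_weak_gradient \<Omega> v G \<longleftrightarrow>
     (\<forall>K. compact K \<and> K \<subseteq> \<Omega> \<longrightarrow>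
        integrable (lebesgue_on K) v \<and> integrable (lebesgue_on K) G) \<and>
     (\<forall>\<phi>\<in>test_functions \<Omega>. \<forall>b\<in>Basis.
        (LINT x|lebesgue_on \<Omega>. v x * frechet_derivative \<phi> (at x) b)
          = - (LINT x|lebesgue_on \<Omega>. (G x \<bullet> b) * \<phi> x))"

text \<open>The weak gradient and the trace below are unique up to null sets; the choice operator
  selects a representative, and they are used only under integrals.\<close>

definition weak_gradient :: "'a::euclidean_space set \<Rightarrow> ('a \<Rightarrow> real) \<Rightarrow> 'a \<Rightarrow> 'a" where
  "weak_gradient \<Omega> v = (SOME G. is_weak_gradient \<Omega> v G)"

definition W1p :: "'a::euclidean_space set \<Rightarrow> real \<Rightarrow> ('a \<Rightarrow> real) set" where
  "W1p \<Omega> p = {v \<in> Lp (lebesgue_on \<Omega>) p.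
     \<exists>G. is_weak_gradient \<Omega> v G \<and> G \<in> Lp (lebesgue_on \<Omega>) p}"

text \<open>The trace operator is the continuous extension to $W^{1,p}(\Omega)$ of the restriction
  \<open>w \<mapsto> w|\<partial>\<Omega>\<close>, defined on the dense subspace of those functions in $W^{1,p}(\Omega)$ that are
  continuous on the closure.\<close>

definition is_trace ::
  "'a::euclidean_space set \<Rightarrow> real \<Rightarrow> ('a \<Rightarrow> real) \<Rightarrow> ('a \<Rightarrow> real) \<Rightarrow> bool" where
  "is_trace \<Omega> p v t \<longleftrightarrow> t \<in> Lp (bdry_measure \<Omega>) p \<and>
     (\<exists>w :: nat \<Rightarrow> 'a \<Rightarrow> real.
        (\<forall>k. w k \<in> W1p \<Omega> p \<and> continuous_on (closure \<Omega>) (w k)) \<and>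
        (\<lambda>k. LINT x|lebesgue_on \<Omega>. \<bar>w k x - v x\<bar> powr p) \<longlonglongrightarrow> 0 \<and>
        (\<lambda>k. LINT x|lebesgue_on \<Omega>. norm (weak_gradient \<Omega> (w k) x - weak_gradient \<Omega> v x) powr p)
          \<longlonglongrightarrow> 0 \<and>
        (\<lambda>k. LINT \<sigma>|bdry_measure \<Omega>. \<bar>w k \<sigma> - t \<sigma>\<bar> powr p) \<longlonglongrightarrow> 0)"

definition bdry_trace :: "'a::euclidean_space set \<Rightarrow> real \<Rightarrow> ('a \<Rightarrow> real) \<Rightarrow> 'a \<Rightarrow> real" where
  "bdry_trace \<Omega> p v = (SOME t. is_trace \<Omega> p v t)"


section \<open>The variational problem\<close>

definition Hm :: "'a::euclidean_space set \<Rightarrow> real \<Rightarrow> ('a \<Rightarrow> real) set" where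
  "Hm \<Omega> m = {h. integrable (bdry_measure \<Omega>) h \<and> (AE \<sigma> in bdry_measure \<Omega>. h \<sigma> \<ge> 0) \<and>
     (LINT \<sigma>|bdry_measure \<Omega>. h \<sigma>) = m}"

definition J :: "'a::euclidean_space set \<Rightarrow> real \<Rightarrow> real \<Rightarrow> ('a \<Rightarrow> real) \<Rightarrow> ('a \<Rightarrow> real)
    \<Rightarrow> ('a \<Rightarrow> real) \<Rightarrow> ('a \<Rightarrow> real) \<Rightarrow> real" where
  "J \<Omega> p \<beta> f g v h =
     1 / p * (LINT x|lebesgue_on \<Omega>. norm (weak_gradient \<Omega> v x) powr p)
     + \<beta> / p * (LINT \<sigma>|bdry_measure \<Omega>.
         \<bar>bdry_trace \<Omega> p v \<sigma> - g \<sigma>\<bar> powr p / (1 + \<beta> powr (1 / (p - 1)) * h \<sigma>) powr (p - 1))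
     - (LINT x|lebesgue_on \<Omega>. f x * v x)"

definition is_minimizer :: "'a::euclidean_space set \<Rightarrow> real \<Rightarrow> real \<Rightarrow> ('a \<Rightarrow> real) \<Rightarrow> ('a \<Rightarrow> real)
    \<Rightarrow> real \<Rightarrow> ('a \<Rightarrow> real) \<Rightarrow> ('a \<Rightarrow> real) \<Rightarrow> bool" where
  "is_minimizer \<Omega> p \<beta> f g m v h \<longleftrightarrow> v \<in> W1p \<Omega> p \<and> h \<in> Hm \<Omega> m \<and>
     (\<forall>v'\<in>W1p \<Omega> p. \<forall>h'\<in>Hm \<Omega> m. J \<Omega> p \<beta> f g v h \<le> J \<Omega> p \<beta> f g v' h')"

definition threshold_set ::
  "'a::euclidean_space set \<Rightarrow> ('a \<Rightarrow> real) \<Rightarrow> ('a \<Rightarrow> real) \<Rightarrow> real \<Rightarrow> 'a set" where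
  "threshold_set \<Omega> g u c = {\<sigma> \<in> frontier \<Omega>. \<bar>u \<sigma> - g \<sigma>\<bar> > c}"

definition threshold_const :: "'a::euclidean_space set \<Rightarrow> real \<Rightarrow> real \<Rightarrow> ('a \<Rightarrow> real) \<Rightarrow> real
    \<Rightarrow> ('a \<Rightarrow> real) \<Rightarrow> real" where
  "threshold_const \<Omega> p \<beta> g m u = (THE c. c > 0 \<and>
     c = 1 / (measure (bdry_measure \<Omega>) (threshold_set \<Omega> g u c) + m * \<beta> powr (1 / (p - 1)))
         * (LINT \<sigma>:threshold_set \<Omega> g u c|bdry_measure \<Omega>. \<bar>u \<sigma> - g \<sigma>\<bar>))"

text \<open>The pointwise representative $h_u$ of the optimal density belonging to a minimizer \<open>u\<close>;
  \<open>u\<close> has to be continuous on the closure of \<open>\<Omega>\<close>.\<close>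

definition opt_h :: "'a::euclidean_space set \<Rightarrow> real \<Rightarrow> real \<Rightarrow> ('a \<Rightarrow> real) \<Rightarrow> real
    \<Rightarrow> ('a \<Rightarrow> real) \<Rightarrow> 'a \<Rightarrow> real" where
  "opt_h \<Omega> p \<beta> g m u \<sigma> = (let c = threshold_const \<Omega> p \<beta> g m u in
     if \<bar>u \<sigma> - g \<sigma>\<bar> > c
     then \<bar>u \<sigma> - g \<sigma>\<bar> / (c * \<beta> powr (1 / (p - 1))) - 1 / \<beta> powr (1 / (p - 1))
     else 0)"

end

theory Submission
  imports Defs
begin

text \<open>Write \<open>b = \<beta>^(1/(p-1))\<close> and let \<open>P\<close> be the total boundary measure. The tangent inequality
  \<open>\<bar>x\<bar>^p s^(1-p) \<ge> p c^(p-1) \<bar>x\<bar> - (p-1) c^p s\<close>, applied with \<open>s = 1 + b h\<close>, turns the boundary term of \<open>J\<close>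
  into a linear functional of the trace. For the constant \<open>c\<close> with \<open>\<beta> c^(p-1) P = \<bar>\<Omega>\<bar>\<close> the divergence
  theorem for the field \<open>x - x0\<close> reduces the remaining minimization to Young's inequality for \<open>\<nabla>v\<close> and
  \<open>-(x - x0)/N\<close>, whose equality case forces \<open>v\<close> to be the radial torsion function up to a constant. A
  minimizer is of this form, hence constant on the sphere, as soon as \<open>\<bar>u - g\<bar> \<ge> c\<close> there; computing
  the mass of the density gives the threshold \<open>P (max g - avg g) / (c b)\<close>.

  All integrals over the sphere only use that its Hausdorff measure is finite, positive and invariant
  under rotations, because such a measure is unique up to a factor and the factor cancels. Only
  functions continuous up to the boundary have to be compared, so no trace theorem is needed.\<close>

section \<open>Hausdorff measure on Borel sets\<close>

text \<open>The constant in the tangent inequality is forced. Once |v - g| is replaced by v - g, the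
  linearized functional is affine under adding constants to \<open>v\<close>, so it is bounded below
  only if its boundary coefficient times \<open>P\<close> equals the volume. The tangent inequality
  is an equality exactly where |v - g| = c (1 + b h), and h >= 0 then requires |v - g| >= c: this is
  the obstacle. For the radial competitor with boundary value K, the mass constraint reads K P - int
  g = c (P + b m); if K - max g >= c, every inequality in the chain is an equality for it, and K -
  max g = c is the threshold. For smaller masses no explicit minimizer is at hand. That case is
  argued by contradiction: were the density positive almost everywhere, first variations alone would
  identify the minimizer as the radial one, and the mass would be at least the threshold. The
  surface integral in the divergence theorem is a limit of volume integrals against a radial
  density. Testing with the constant 1 gives the limit N |\<Omega>| of its total mass, so the area
  of the sphere is never computed.\<close>

lemma metric_outer_measure_borel:
  fixes \<nu> :: "'a::metric_space set \<Rightarrow> ennreal"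
  assumes oms: "outer_measure_space UNIV \<nu>"
    and metric: "\<And>A B e. 0 < e \<Longrightarrow> (\<And>x y. x \<in> A \<Longrightarrow> y \<in> B \<Longrightarrow> e \<le> dist x y) \<Longrightarrow> \<nu> A + \<nu> B \<le> \<nu> (A \<union> B)"
  shows "sets borel \<subseteq> lambda_system UNIV UNIV \<nu>"
proof -
  have sa: "sigma_algebra UNIV (UNIV :: 'a set set)"
    using sigma_algebra_Pow[of UNIV] by simp
  interpret sigma_algebra UNIV "UNIV :: 'a set set" by (rule sa)
  have pos: "positive UNIV \<nu>" and inc: "increasing UNIV \<nu>" and csub: "countably_subadditive UNIV \<nu>"
    using oms by (auto simp: outer_measure_space_def)
  have mono: "A \<subseteq> B \<Longrightarrow> \<nu> A \<le> \<nu> B" for A B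
    using increasingD[OF inc, of A B] by simp
  have sub2: "subadditive UNIV \<nu>"
    by (rule countably_subadditive_subadditive[OF pos csub])
  have sub: "\<nu> (A \<union> B) \<le> \<nu> A + \<nu> B" for A B
  proof -
    have "\<nu> (A \<union> B) = \<nu> (A \<union> (B - A))" by simp
    also have "\<dots> \<le> \<nu> A + \<nu> (B - A)"
      by (rule subadditiveD[OF sub2]) auto
    also have "\<dots> \<le> \<nu> A + \<nu> B"
      by (intro add_left_mono mono) auto
    finally show ?thesis .
  qed
  have csub': "\<nu> (\<Union>i. A i) \<le> (\<Sum>i. \<nu> (A i))" for A :: "nat \<Rightarrow> 'a set"
  proof -
    have "\<nu> (\<Union>i. A i) = \<nu> (\<Union>i. disjointed A i)" by (simp add: UN_disjointed_eq)
    also have "\<dots> \<le> (\<Sum>i. \<nu> (disjointed A i))"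
      using csub disjoint_family_disjointed unfolding countably_subadditive_def by blast
    also have "\<dots> \<le> (\<Sum>i. \<nu> (A i))"
      by (intro suminf_le mono disjointed_subset) auto
    finally show ?thesis .
  qed
  have fin: "(\<Sum>j<m. \<nu> (D j)) \<le> \<nu> (\<Union>j<m. D j)"
    if sep: "\<And>i j. i < j \<Longrightarrow> \<exists>e>0. \<forall>x\<in>D i. \<forall>y\<in>D j. e \<le> dist x y" for D :: "nat \<Rightarrow> 'a set" and m
  proof (induction m)
    case (Suc m)
    obtain e where e: "\<And>i. i < m \<Longrightarrow> 0 < e i \<and> (\<forall>x\<in>D i. \<forall>y\<in>D m. e i \<le> dist x y)"
      using sep[of _ m] by metis
    \<comment> \<open>The extra element 1 keeps the set nonempty for \<open>m = 0\<close>;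
      \<open>d\<close> is a separation of \<open>D m\<close> from all earlier sets at once.\<close>
    define d where "d = Min (insert 1 (e ` {..<m}))"
    have d: "0 < d" "\<And>i. i < m \<Longrightarrow> d \<le> e i"
      using e by (auto simp: d_def)
    have "(\<Sum>j<Suc m. \<nu> (D j)) \<le> \<nu> (\<Union>j<m. D j) + \<nu> (D m)"
      using Suc by (auto intro: add_mono)
    also have "\<dots> \<le> \<nu> ((\<Union>j<m. D j) \<union> D m)"
      by (rule metric[OF d(1)]) (use d e in \<open>fastforce\<close>)
    also have "(\<Union>j<m. D j) \<union> D m = (\<Union>j<Suc m. D j)"
      by (auto simp: less_Suc_eq)
    finally show ?case .
  qed simp
  have closed: "F \<in> lambda_system UNIV UNIV \<nu>" if F: "closed F" "F \<noteq> {}" for F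
  proof -
    \<comment> \<open>Caratheodory's argument. Since \<open>F\<close> is closed,
      \<open>E - F\<close> is exhausted by the sets \<open>En n\<close> at distance at least
      \<open>r n\<close> from \<open>F\<close>, to which the metric hypothesis applies. What remains
      is covered by distance layers \<open>D j\<close>, and the point is that the series of their
      values converges, so that its tails vanish.\<close>
    have key: "\<nu> (E \<inter> F) + \<nu> (E - F) \<le> \<nu> E" for E
    proof (cases "\<nu> E < top")
      case True
      define r :: "nat \<Rightarrow> real" where "r n = 1 / (real n + 1)" for n
      have r0: "r n > 0" for n by (simp add: r_def)
      have rdec: "m \<le> n \<Longrightarrow> r n \<le> r m" for m n by (simp add: r_def frac_le)
      have rless: "m < n \<Longrightarrow> r n < r m" for m n by (simp add: r_def frac_less2)
      define En where "En n = {x\<in>E. r n \<le> infdist x F}" for n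
      define D where "D n = {x\<in>E. r (Suc n) \<le> infdist x F \<and> infdist x F < r n}" for n
      have pos_dist: "x \<in> E - F \<Longrightarrow> infdist x F > 0" for x
        using F by (metis Diff_iff in_closed_iff_infdist_zero infdist_nonneg less_eq_real_def)
      have cover: "E - F \<subseteq> En n \<union> (\<Union>j. D (j + n))" for n
      proof
        fix x assume x: "x \<in> E - F"
        show "x \<in> En n \<union> (\<Union>j. D (j + n))"
        proof (cases "r n \<le> infdist x F")
          case False
          define j where "j = (LEAST j. r j \<le> infdist x F)"
          have "\<exists>j. r j \<le> infdist x F"
          proof -
            obtain i where "inverse (real (Suc i)) < infdist x F"
              using reals_Archimedean[OF pos_dist[OF x]] by blast
            then show ?thesis
              by (intro exI[of _ i]) (simp add: r_def inverse_eq_divide add.commute)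
          qed
          then have 1: "r j \<le> infdist x F" unfolding j_def by (rule LeastI_ex)
          have "n < j" using 1 False rdec[of j n] by (meson le_less_trans not_le order_trans)
          then obtain i where i: "j = Suc (i + n)" by (metis add.commute less_imp_Suc_add)
          have "\<not> r (i + n) \<le> infdist x F"
            using not_less_Least[of "i + n" "\<lambda>j. r j \<le> infdist x F"] i unfolding j_def by auto
          then have "x \<in> D (i + n)" using 1 x by (auto simp: D_def i)
          then show ?thesis by blast
        qed (use x in \<open>auto simp: En_def\<close>)
      qed
      have En: "\<nu> (E \<inter> F) + \<nu> (En n) \<le> \<nu> E" for n
      proof -
        have "\<nu> (E \<inter> F) + \<nu> (En n) \<le> \<nu> ((E \<inter> F) \<union> En n)"
        proof (rule metric[OF r0[of n]])
          fix x y assume "x \<in> E \<inter> F" "y \<in> En n"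
          then show "r n \<le> dist x y"
            using infdist_le[of x F y] by (auto simp: En_def dist_commute)
        qed
        also have "\<dots> \<le> \<nu> E" by (intro mono) (auto simp: En_def)
        finally show ?thesis .
      qed
      have sepD: "\<exists>e>0. \<forall>x\<in>D i. \<forall>y\<in>D j. e \<le> dist x y" if "Suc i < j" for i j
      proof (intro exI conjI ballI)
        show "0 < r (Suc i) - r j" using rless[OF that] by simp
        fix x y assume "x \<in> D i" "y \<in> D j"
        then show "r (Suc i) - r j \<le> dist x y"
          using infdist_triangle[of x F y] by (auto simp: D_def dist_commute)
      qed
      \<comment> \<open>Neighbouring layers may touch, but layers whose indices differ by at least 2
        are separated. Hence the even and the odd layers are summed apart, each sum staying below
        \<open>\<nu> E\<close>.\<close>
      have half: "(\<Sum>j. \<nu> (D (2 * j + s))) \<le> \<nu> E" for s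
      proof (rule suminf_le_const[OF summableI])
        fix m
        have "(\<Sum>j<m. \<nu> (D (2 * j + s))) \<le> \<nu> (\<Union>j<m. D (2 * j + s))"
          by (rule fin) (use sepD in auto)
        also have "\<dots> \<le> \<nu> E" by (intro mono) (auto simp: D_def)
        finally show "(\<Sum>j<m. \<nu> (D (2 * j + s))) \<le> \<nu> E" .
      qed
      have part: "(\<Sum>j<m. \<nu> (D j)) \<le> \<nu> E + \<nu> E" for m
      proof -
        have "(\<Sum>j<m. \<nu> (D j)) \<le> (\<Sum>j<2*m. \<nu> (D j))"
          by (intro sum_mono2) auto
        also have "\<dots> = (\<Sum>j<m. \<nu> (D (2*j))) + (\<Sum>j<m. \<nu> (D (2*j+1)))"
          by (induction m) (auto simp: ac_simps)
        also have "\<dots> \<le> (\<Sum>j. \<nu> (D (2*j+0))) + (\<Sum>j. \<nu> (D (2*j+1)))"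
          by (intro add_mono) (auto intro!: sum_le_suminf)
        also have "\<dots> \<le> \<nu> E + \<nu> E" using half[of 0] half[of 1] by (intro add_mono) auto
        finally show ?thesis .
      qed
      have "(\<Sum>j. \<nu> (D j)) \<le> \<nu> E + \<nu> E"
        by (rule suminf_le_const[OF summableI part])
      also have "\<dots> < top" using True by simp
      finally have sfin: "(\<Sum>j. \<nu> (D j)) \<noteq> top" by simp
      have tail: "(\<lambda>n. \<Sum>j. \<nu> (D (j + n))) \<longlonglongrightarrow> 0"
      proof -
        have "\<nu> (D j) < top" for j
          using sfin by (meson ennreal_suminf_lessD top.not_eq_extremum)
        then have "\<nu> (D j) = ennreal (enn2real (\<nu> (D j)))" for j by simp
        moreover define f where "f = (\<lambda>j. enn2real (\<nu> (D j)))"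
        ultimately have f: "\<And>j. \<nu> (D j) = ennreal (f j)" "\<And>j. 0 \<le> f j" by simp_all
        have summ: "summable f"
          using sfin f by (intro summable_suminf_not_top) auto
        have "(\<Sum>j. \<nu> (D (j + n))) = ennreal (\<Sum>j. f (j + n))" for n
          using summ f by (simp add: suminf_ennreal2 summable_iff_shift)
        moreover have "(\<lambda>n. \<Sum>j. f (j + n)) \<longlonglongrightarrow> 0"
          by (rule suminf_exist_split2[OF summ])
        ultimately show ?thesis
          using tendsto_ennrealI[of "\<lambda>n. \<Sum>j. f (j + n)" 0] by simp
      qed
      have "\<nu> (E \<inter> F) + \<nu> (E - F) \<le> \<nu> E + (\<Sum>j. \<nu> (D (j + n)))" for n
      proof -
        have "\<nu> (E - F) \<le> \<nu> (En n \<union> (\<Union>j. D (j + n)))" by (rule mono[OF cover])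
        also have "\<dots> \<le> \<nu> (En n) + \<nu> (\<Union>j. D (j + n))" by (rule sub)
        also have "\<dots> \<le> \<nu> (En n) + (\<Sum>j. \<nu> (D (j + n)))" by (intro add_left_mono csub')
        finally have "\<nu> (E \<inter> F) + \<nu> (E - F) \<le> (\<nu> (E \<inter> F) + \<nu> (En n)) + (\<Sum>j. \<nu> (D (j + n)))"
          by (simp add: add_left_mono add.assoc)
        also have "\<dots> \<le> \<nu> E + (\<Sum>j. \<nu> (D (j + n)))" by (intro add_right_mono En)
        finally show ?thesis .
      qed
      moreover have "(\<lambda>n. \<nu> E + (\<Sum>j. \<nu> (D (j + n)))) \<longlonglongrightarrow> \<nu> E + 0"
        by (intro tendsto_add tail tendsto_const)
      ultimately show ?thesis
        by (intro LIMSEQ_le_const[of _ "\<nu> E"]) auto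
    qed (simp_all add: not_less top_unique)
    have "\<nu> (E \<inter> F) + \<nu> (E - F) = \<nu> E" for E
      using key[of E] sub[of "E \<inter> F" "E - F"] by (simp add: Int_Diff_Un antisym)
    then show ?thesis by (simp add: lambda_system_eq)
  qed
  interpret L: sigma_algebra UNIV "lambda_system UNIV UNIV \<nu>"
    using caratheodory_lemma[OF oms] by (simp add: measure_space_def)
  have "sigma_sets UNIV (Collect closed) \<subseteq> lambda_system UNIV UNIV \<nu>"
  proof (rule L.sigma_sets_subset)
    show "Collect closed \<subseteq> lambda_system UNIV UNIV \<nu>"
      using closed L.empty_sets by auto
  qed
  then show ?thesis by (simp add: borel_eq_closed)
qed

section \<open>Hausdorff content and Hausdorff outer measure\<close>

lemma hausdorff_content_mono: "A \<subseteq> B \<Longrightarrow> hausdorff_content k \<delta> A \<le> hausdorff_content k \<delta> B"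
  unfolding hausdorff_content_def by (intro INF_superset_mono) auto

lemma hausdorff_content_antimono: "\<delta> \<le> \<delta>' \<Longrightarrow> hausdorff_content k \<delta>' A \<le> hausdorff_content k \<delta> A"
  unfolding hausdorff_content_def by (intro INF_superset_mono) (auto intro: order_trans)

lemma hausdorff_content_lessD:
  assumes "hausdorff_content k \<delta> A < e"
  obtains C where "A \<subseteq> (\<Union>j. C j)" "\<And>j. bounded (C j)" "\<And>j. diameter (C j) \<le> \<delta>"
    "(\<Sum>j. hausdorff_gauge k (C j)) < e"
  using assms unfolding hausdorff_content_def INF_less_iff by auto

lemma hausdorff_content_le:
  assumes "A \<subseteq> (\<Union>j. C j)" "\<And>j. bounded (C j)" "\<And>j. diameter (C j) \<le> \<delta>"
  shows "hausdorff_content k \<delta> A \<le> (\<Sum>j. hausdorff_gauge k (C j))"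
  unfolding hausdorff_content_def using assms by (intro INF_lower) auto

lemma hausdorff_content_empty: "0 \<le> \<delta> \<Longrightarrow> hausdorff_content k \<delta> {} = 0"
  using hausdorff_content_le[of "{}" "\<lambda>_. {}" \<delta> k] by (simp add: hausdorff_gauge_def)

text \<open>The usual argument with an excess of e/2^(n+1) for the cover of \<open>A n\<close>; the
  double family of covering sets is turned into one sequence by \<open>prod_decode\<close>.\<close>

lemma hausdorff_content_UN:
  fixes A :: "nat \<Rightarrow> 'a::metric_space set"
  shows
  "hausdorff_content k \<delta> (\<Union>i. A i) \<le> (\<Sum>i::nat. hausdorff_content k \<delta> (A i))"
proof (rule ennreal_le_epsilon)
  let ?O = "hausdorff_content k \<delta>" and ?f = "hausdorff_gauge k"
  fix e :: real assume "0 < e" "(\<Sum>n. ?O (A n)) < top"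
  then have *: "\<And>n. ?O (A n) < ?O (A n) + e * (1/2)^Suc n"
    by (auto simp add: less_top dest!: ennreal_suminf_lessD)
  have "\<exists>C. A n \<subseteq> (\<Union>j. C j) \<and> (\<forall>j. bounded (C j)) \<and> (\<forall>j. diameter (C j) \<le> \<delta>) \<and>
     (\<Sum>j. ?f (C j)) \<le> ?O (A n) + e * (1/2)^Suc n" for n
    using hausdorff_content_lessD[OF *[of n]] by (metis less_imp_le)
  then obtain B
    where sbB: "\<And>n. A n \<subseteq> (\<Union>i::nat. B n i)" and bB: "\<And>n i. bounded (B n i)"
    and dB: "\<And>n i. diameter (B n i) \<le> \<delta>"
    and Ble: "\<And>n. (\<Sum>i. ?f (B n i)) \<le> ?O (A n) + e * (1/2)^(Suc n)"
    by metis
  define C where "C = case_prod B o prod_decode"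
  have A_C: "(\<Union>i. A i) \<subseteq> (\<Union>i. C i)"
    using sbB by (auto simp add: C_def subset_eq) (metis prod.case prod_encode_inverse)
  have "?O (\<Union>i. A i) \<le> (\<Sum>i. ?f (C i))"
    using A_C by (rule hausdorff_content_le) (auto simp: C_def split_beta bB dB)
  also have "\<dots> = (\<Sum>n. \<Sum>i. ?f (B n i))"
    unfolding C_def comp_def using suminf_ennreal_2dimen[of "\<lambda>n. \<Sum>i. ?f (B n i)" "\<lambda>(n,i). ?f (B n i)"]
    by (simp add: split_beta)
  also have "\<dots> \<le> (\<Sum>n. ?O (A n) + e * (1/2) ^ Suc n)"
    by (intro suminf_le suminf_nonneg allI Ble) auto
  also have "... = (\<Sum>n. ?O (A n)) + (\<Sum>n. ennreal e * ennreal ((1/2) ^ Suc n))"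
    using \<open>0 < e\<close> by (subst suminf_add[symmetric])
                     (auto simp del: ennreal_suminf_cmult simp add: ennreal_mult[symmetric])
  also have "\<dots> = (\<Sum>n. ?O (A n)) + e"
    unfolding ennreal_suminf_cmult
    by (subst suminf_ennreal_eq[OF zero_le_power power_half_series]) auto
  finally show "?O (\<Union>i. A i) \<le> (\<Sum>n. ?O (A n)) + e" .
qed

lemma hausdorff_content_le_outer: "0 < \<delta> \<Longrightarrow> hausdorff_content k \<delta> A \<le> hausdorff_outer k A"
  unfolding hausdorff_outer_def by (rule SUP_upper) simp

text \<open>Along this sequence of scales the contents increase, so a sum of two suprema can be
  formed termwise in the proof of the metric property.\<close>

lemma hausdorff_outer_eq_SUP_seq:
  "hausdorff_outer k A = (SUP n. hausdorff_content k (1 / real (Suc n)) A)"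
proof (rule antisym)
  show "hausdorff_outer k A \<le> (SUP n. hausdorff_content k (1 / real (Suc n)) A)"
    unfolding hausdorff_outer_def
  proof (rule SUP_least)
    fix \<delta> :: real assume "\<delta> \<in> {0<..}"
    then obtain n where "1 / real (Suc n) < \<delta>"
      using reals_Archimedean[of \<delta>] by (auto simp: inverse_eq_divide)
    then show "hausdorff_content k \<delta> A \<le> (SUP n. hausdorff_content k (1 / real (Suc n)) A)"
      by (intro SUP_upper2[of n] hausdorff_content_antimono) auto
  qed
qed (auto intro!: SUP_least hausdorff_content_le_outer)

lemma outer_measure_space_hausdorff:
  "outer_measure_space UNIV (hausdorff_outer k :: 'a::metric_space set \<Rightarrow> ennreal)"
  unfolding outer_measure_space_def
proof (intro conjI)
  show "positive UNIV (hausdorff_outer k :: 'a set \<Rightarrow> ennreal)"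
    by (auto simp: positive_def hausdorff_outer_eq_SUP_seq hausdorff_content_empty)
  show "increasing UNIV (hausdorff_outer k :: 'a set \<Rightarrow> ennreal)"
    by (auto simp: increasing_def hausdorff_outer_def intro!: SUP_subset_mono hausdorff_content_mono)
  show "countably_subadditive UNIV (hausdorff_outer k :: 'a set \<Rightarrow> ennreal)"
    unfolding countably_subadditive_def
  proof (intro allI impI)
    fix A :: "nat \<Rightarrow> 'a set"
    show "hausdorff_outer k (\<Union>i. A i) \<le> (\<Sum>i. hausdorff_outer k (A i))"
      unfolding hausdorff_outer_def[of k "\<Union>i. A i"]
    proof (rule SUP_least)
      fix \<delta> :: real assume d: "\<delta> \<in> {0<..}"
      have "hausdorff_content k \<delta> (\<Union>i. A i) \<le> (\<Sum>i. hausdorff_content k \<delta> (A i))"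
        by (rule hausdorff_content_UN)
      also have "\<dots> \<le> (\<Sum>i. hausdorff_outer k (A i))"
        using d by (intro suminf_le hausdorff_content_le_outer) auto
      finally show "hausdorff_content k \<delta> (\<Union>i. A i) \<le> (\<Sum>i. hausdorff_outer k (A i))" .
    qed
  qed
qed

text \<open>A covering set of diameter at most \<open>\<delta>\<close> cannot meet both
  \<open>A\<close> and \<open>B\<close>, so every cover of the union splits into a cover of each.
  Members that miss the set in question are replaced by the empty set, whose gauge is 0.\<close>

lemma hausdorff_content_separated:
  fixes A B :: "'a::metric_space set"
  assumes sep: "\<And>x y. x \<in> A \<Longrightarrow> y \<in> B \<Longrightarrow> \<delta> < dist x y" and "0 \<le> \<delta>"
  shows "hausdorff_content k \<delta> A + hausdorff_content k \<delta> B \<le> hausdorff_content k \<delta> (A \<union> B)"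
  unfolding hausdorff_content_def[of k \<delta> "A \<union> B"]
proof (rule INF_greatest)
  fix C :: "nat \<Rightarrow> 'a set"
  assume "C \<in> {C. A \<union> B \<subseteq> (\<Union>j. C j) \<and> (\<forall>j. bounded (C j) \<and> diameter (C j) \<le> \<delta>)}"
  then have C: "A \<union> B \<subseteq> (\<Union>j. C j)" "\<And>j. bounded (C j)" "\<And>j. diameter (C j) \<le> \<delta>" by auto
  define r where "r X j = (if C j \<inter> X = {} then {} else C j)" for X j
  have r: "hausdorff_content k \<delta> X \<le> (\<Sum>j. hausdorff_gauge k (r X j))" if X: "X \<subseteq> A \<union> B" for X
  proof (rule hausdorff_content_le)
    show "X \<subseteq> (\<Union>j. r X j)"
    proof
      fix x assume x: "x \<in> X"
      then obtain j where "x \<in> C j" using C(1) X by blast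
      with x have "x \<in> r X j" by (auto simp: r_def)
      then show "x \<in> (\<Union>j. r X j)" by blast
    qed
    show "bounded (r X j)" "diameter (r X j) \<le> \<delta>" for j
      using C(2,3)[of j] \<open>0 \<le> \<delta>\<close> by (auto simp: r_def)
  qed
  have disj: "C j \<inter> A = {} \<or> C j \<inter> B = {}" for j
  proof (rule ccontr)
    assume "\<not> ?thesis"
    then obtain x y where "x \<in> C j" "x \<in> A" "y \<in> C j" "y \<in> B" by blast
    then show False
      using sep[of x y] diameter_bounded_bound[OF C(2)[of j], of x y] C(3)[of j] by simp
  qed
  have "hausdorff_content k \<delta> A + hausdorff_content k \<delta> B
      \<le> (\<Sum>j. hausdorff_gauge k (r A j)) + (\<Sum>j. hausdorff_gauge k (r B j))"
    by (intro add_mono r) auto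
  also have "\<dots> = (\<Sum>j. hausdorff_gauge k (r A j) + hausdorff_gauge k (r B j))"
    by (rule suminf_add) auto
  also have "\<dots> \<le> (\<Sum>j. hausdorff_gauge k (C j))"
  proof (intro suminf_le)
    fix j
    have "hausdorff_gauge k ({} :: 'a set) = 0" by (simp add: hausdorff_gauge_def)
    then show "hausdorff_gauge k (r A j) + hausdorff_gauge k (r B j) \<le> hausdorff_gauge k (C j)"
      using disj[of j] by (cases "C j \<inter> A = {}"; cases "C j \<inter> B = {}") (simp_all add: r_def)
  qed auto
  finally show "hausdorff_content k \<delta> A + hausdorff_content k \<delta> B \<le> (\<Sum>j. hausdorff_gauge k (C j))" .
qed

lemma hausdorff_outer_metric:
  fixes A B :: "'a::metric_space set"
  assumes e: "0 < e" and sep: "\<And>x y. x \<in> A \<Longrightarrow> y \<in> B \<Longrightarrow> e \<le> dist x y"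
  shows "hausdorff_outer k A + hausdorff_outer k B \<le> hausdorff_outer k (A \<union> B)"
proof -
  let ?c = "\<lambda>n. hausdorff_content k (1 / real (Suc n))"
  have inc: "incseq (\<lambda>n. ?c n X)" for X :: "'a set"
    by (intro monoI hausdorff_content_antimono) (simp add: frac_le)
  have "hausdorff_outer k A + hausdorff_outer k B = (SUP n. ?c n A + ?c n B)"
    unfolding hausdorff_outer_eq_SUP_seq by (rule ennreal_SUP_add[symmetric]) (rule inc)+
  also have "\<dots> \<le> hausdorff_outer k (A \<union> B)"
  proof (rule SUP_least)
    fix n
    \<comment> \<open>Below \<open>e\<close> the sets are separated at scale \<open>d\<close>, and
      going to a smaller scale only raises the contents.\<close>
    define d where "d = min (1 / real (Suc n)) (e / 2)"
    have d: "0 < d" "d \<le> 1 / real (Suc n)" "d < e" using e by (auto simp: d_def)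
    have "?c n A + ?c n B \<le> hausdorff_content k d A + hausdorff_content k d B"
      by (intro add_mono hausdorff_content_antimono d)
    also have "\<dots> \<le> hausdorff_content k d (A \<union> B)"
      using d sep by (intro hausdorff_content_separated) fastforce+
    also have "\<dots> \<le> hausdorff_outer k (A \<union> B)"
      by (intro hausdorff_content_le_outer d)
    finally show "?c n A + ?c n B \<le> hausdorff_outer k (A \<union> B)" .
  qed
  finally show ?thesis .
qed

lemma space_hausdorff_measure [simp]: "space (hausdorff_measure k) = UNIV"
  by (simp add: hausdorff_measure_def space_measure_of_conv)

lemma sets_hausdorff_measure [simp, measurable_cong]: "sets (hausdorff_measure k) = sets borel"
  unfolding hausdorff_measure_def by (metis sets.sets_measure_of_eq space_borel)

text \<open>\<open>measure_of\<close> returns the given set function only if it is countably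
  additive on the \<sigma>-algebra; this holds because the Borel sets lie in the Caratheodory
  \<sigma>-algebra of the outer measure.\<close>

lemma emeasure_hausdorff_measure:
  fixes A :: "'a::metric_space set"
  assumes "A \<in> sets borel"
  shows "emeasure (hausdorff_measure k) A = hausdorff_outer k A"
  unfolding hausdorff_measure_def
proof (rule emeasure_measure_of_sigma)
  let ?L = "lambda_system UNIV UNIV (hausdorff_outer k :: 'a set \<Rightarrow> ennreal)"
  have sub: "sets borel \<subseteq> ?L"
    by (intro metric_outer_measure_borel outer_measure_space_hausdorff hausdorff_outer_metric)
  have sa: "sigma_algebra UNIV (UNIV :: 'a set set)"
    using sigma_algebra_Pow[of UNIV] by simp
  have "measure_space UNIV ?L (hausdorff_outer k)"
    using sigma_algebra.caratheodory_lemma[OF sa, of "hausdorff_outer k :: 'a set \<Rightarrow> ennreal"] outer_measure_space_hausdorff[of k, where 'a='a]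
    by simp
  then have "countably_additive ?L (hausdorff_outer k)"
    by (simp add: measure_space_def)
  then show "countably_additive (sets borel) (hausdorff_outer k :: 'a set \<Rightarrow> ennreal)"
    using sub unfolding countably_additive_def by blast
  show "positive (sets borel) (hausdorff_outer k :: 'a set \<Rightarrow> ennreal)"
    using outer_measure_space_hausdorff[of k, where 'a='a] by (auto simp: outer_measure_space_def positive_def)
  show "sigma_algebra UNIV (sets (borel :: 'a measure))"
    using sets.sigma_algebra_axioms[of borel] by simp
qed (rule assms)

lemma hausdorff_gauge_isometry:
  fixes T :: "'a::metric_space \<Rightarrow> 'a"
  assumes "\<And>x y. dist (T x) (T y) = dist x y"
  shows "hausdorff_gauge k (T ` C) = hausdorff_gauge k C" "bounded (T ` C) \<longleftrightarrow> bounded C"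
    "diameter (T ` C) = diameter C"
proof -
  show d: "diameter (T ` C) = diameter C"
  proof (cases "C = {}")
    case False
    have "(\<lambda>(x, y). dist x y) ` (T ` C \<times> T ` C) = (\<lambda>(x, y). dist x y) ` (C \<times> C)"
    proof -
      have "T ` C \<times> T ` C = map_prod T T ` (C \<times> C)" by auto
      then show ?thesis
        by (simp add: image_image) (rule image_cong, auto simp: assms)
    qed
    then show ?thesis using False by (simp add: diameter_def)
  qed simp
  show "hausdorff_gauge k (T ` C) = hausdorff_gauge k C"
    by (simp add: hausdorff_gauge_def d)
  show "bounded (T ` C) \<longleftrightarrow> bounded C"
    by (simp add: bounded_two_points assms)
qed

lemma hausdorff_outer_isometry_le:
  fixes T :: "'a::metric_space \<Rightarrow> 'a"
  assumes T: "\<And>x y. dist (T x) (T y) = dist x y"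
  shows "hausdorff_outer k (T ` A) \<le> hausdorff_outer k A"
  unfolding hausdorff_outer_def
proof (rule SUP_mono, intro bexI)
  fix \<delta> :: real
  show "hausdorff_content k \<delta> (T ` A) \<le> hausdorff_content k \<delta> A"
    unfolding hausdorff_content_def[of k \<delta> A]
  proof (rule INF_greatest)
    fix C :: "nat \<Rightarrow> 'a set"
    assume "C \<in> {C. A \<subseteq> (\<Union>j. C j) \<and> (\<forall>j. bounded (C j) \<and> diameter (C j) \<le> \<delta>)}"
    then have C: "A \<subseteq> (\<Union>j. C j)" "\<And>j. bounded (C j)" "\<And>j. diameter (C j) \<le> \<delta>" by auto
    have "hausdorff_content k \<delta> (T ` A) \<le> (\<Sum>j. hausdorff_gauge k (T ` C j))"
    proof (rule hausdorff_content_le)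
      show "T ` A \<subseteq> (\<Union>j. T ` C j)" using C(1) by blast
    qed (simp_all add: hausdorff_gauge_isometry[OF T] C)
    then show "hausdorff_content k \<delta> (T ` A) \<le> (\<Sum>j. hausdorff_gauge k (C j))"
      by (simp add: hausdorff_gauge_isometry[OF T])
  qed
qed

text \<open>The missing inequality is the previous lemma applied to \<open>inv T\<close>.\<close>

lemma hausdorff_outer_isometry:
  fixes T :: "'a::metric_space \<Rightarrow> 'a"
  assumes T: "\<And>x y. dist (T x) (T y) = dist x y" and surj: "surj T"
  shows "hausdorff_outer k (T ` A) = hausdorff_outer k A"
proof (rule antisym)
  show "hausdorff_outer k (T ` A) \<le> hausdorff_outer k A"
    by (rule hausdorff_outer_isometry_le[OF T])
  have inj: "inj T" by (rule injI) (metis T dist_eq_0_iff)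
  have "dist (inv T x) (inv T y) = dist x y" for x y
    by (metis T surj surj_f_inv_f)
  from hausdorff_outer_isometry_le[OF this, of k "T ` A"]
  show "hausdorff_outer k A \<le> hausdorff_outer k (T ` A)"
    by (simp add: image_comp inj)
qed

section \<open>The Hausdorff measure of a sphere\<close>

text \<open>Covers are sequences by definition, so a finite cover is padded with empty sets, which
  have gauge 0 even for \<open>k = 0\<close>.\<close>

lemma hausdorff_content_le_finite:
  assumes "finite X" "A \<subseteq> (\<Union>x\<in>X. C x)" "\<And>x. x \<in> X \<Longrightarrow> bounded (C x)"
    "\<And>x. x \<in> X \<Longrightarrow> diameter (C x) \<le> \<delta>" "0 \<le> \<delta>"
  shows "hausdorff_content k \<delta> A \<le> (\<Sum>x\<in>X. hausdorff_gauge k (C x))"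
proof -
  obtain h where h: "bij_betw h {..<card X} X"
    using ex_bij_betw_nat_finite[OF assms(1)] by (auto simp: atLeast0LessThan)
  define D where "D j = (if j < card X then C (h j) else {})" for j
  have hX: "j < card X \<Longrightarrow> h j \<in> X" for j using h by (auto simp: bij_betw_def)
  have "hausdorff_content k \<delta> A \<le> (\<Sum>j. hausdorff_gauge k (D j))"
  proof (rule hausdorff_content_le)
    show "A \<subseteq> (\<Union>j. D j)"
    proof
      fix a assume "a \<in> A"
      then obtain x where "x \<in> X" "a \<in> C x" using assms(2) by blast
      moreover obtain j where "j < card X" "x = h j"
        using h \<open>x \<in> X\<close> by (auto simp: bij_betw_def)
      ultimately have "a \<in> D j" by (simp add: D_def)
      then show "a \<in> (\<Union>j. D j)" by blast
    qed
    show "bounded (D j)" "diameter (D j) \<le> \<delta>" for j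
      using assms(3,4)[OF hX] assms(5) by (auto simp: D_def)
  qed
  also have "\<dots> = (\<Sum>j<card X. hausdorff_gauge k (D j))"
    by (rule suminf_finite) (auto simp: D_def hausdorff_gauge_def)
  also have "\<dots> = (\<Sum>j<card X. hausdorff_gauge k (C (h j)))"
    by (rule sum.cong) (auto simp: D_def)
  also have "\<dots> = (\<Sum>x\<in>X. hausdorff_gauge k (C x))"
    by (rule sum.reindex_bij_betw[OF h])
  finally show ?thesis .
qed

text \<open>Makes the volume of a spherical shell linear in its thickness.\<close>

lemma power_diff_le:
  fixes a b :: real
  assumes "0 \<le> b" "b \<le> a"
  shows "a ^ n - b ^ n \<le> (a - b) * (real n * a ^ (n - 1))"
proof -
  have "a ^ n - b ^ n = (a - b) * (\<Sum>i<n. b ^ (n - Suc i) * a ^ i)"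
    by (rule power_diff_sumr2)
  also have "(\<Sum>i<n. b ^ (n - Suc i) * a ^ i) \<le> (\<Sum>i<n. a ^ (n - 1))"
  proof (rule sum_mono)
    fix i assume "i \<in> {..<n}"
    then have "n - 1 = (n - Suc i) + i" by auto
    then have "a ^ (n - 1) = a ^ (n - Suc i) * a ^ i" by (metis power_add)
    moreover have "b ^ (n - Suc i) \<le> a ^ (n - Suc i)" by (intro power_mono assms)
    ultimately show "b ^ (n - Suc i) * a ^ i \<le> a ^ (n - 1)"
      using assms by (auto intro: mult_right_mono)
  qed
  finally show ?thesis using assms by (simp add: mult_left_mono)
qed

text \<open>Disjoint balls around separated points of the sphere all lie in a thin shell.\<close>

lemma card_separated_sphere:
  fixes x0 :: "'a::euclidean_space"
  assumes X: "finite X" "X \<subseteq> sphere x0 R" and sep: "pairwise (\<lambda>x y. \<delta> \<le> dist x y) X"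
    and d: "0 < \<delta>" "\<delta> \<le> R"
  shows "real (card X) * \<delta> ^ (DIM('a) - 1) \<le> 2 ^ DIM('a) * (real DIM('a) * (2 * R) ^ (DIM('a) - 1))"
proof -
  let ?N = "DIM('a)"
  define \<omega> where "\<omega> = unit_ball_vol (real ?N)"
  have w: "\<omega> > 0" by (simp add: \<omega>_def)
  have N: "?N > 0" by simp
  have disj: "disjoint_family_on (\<lambda>x. ball x (\<delta>/2)) X"
  proof (unfold disjoint_family_on_def, intro ballI impI)
    fix x y assume "x \<in> X" "y \<in> X" "x \<noteq> y"
    then have "\<delta> \<le> dist x y" using sep by (auto simp: pairwise_def)
    then show "ball x (\<delta>/2) \<inter> ball y (\<delta>/2) = {}"
      by (intro disjoint_ballI) simp
  qed
  let ?U = "\<Union>x\<in>X. ball x (\<delta>/2)"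
  have "measure lborel ?U = (\<Sum>x\<in>X. measure lborel (ball x (\<delta>/2)))"
    by (rule measure_finite_Union) (use X disj in \<open>auto simp: emeasure_ball d less_imp_le\<close>)
  also have "\<dots> = real (card X) * (\<omega> * (\<delta>/2) ^ ?N)"
    using d by (simp add: content_ball \<omega>_def)
  finally have 1: "measure lborel ?U = real (card X) * (\<omega> * (\<delta>/2) ^ ?N)" .
  have "?U \<subseteq> cball x0 (R + \<delta>/2) - ball x0 (R - \<delta>/2)"
  proof
    fix y assume "y \<in> ?U"
    then obtain x where x: "x \<in> X" "dist x y < \<delta>/2" by auto
    then have "dist x0 x = R" using X by auto
    then show "y \<in> cball x0 (R + \<delta>/2) - ball x0 (R - \<delta>/2)"
      using x dist_triangle[of x0 y x] dist_triangle[of x0 x y] by (auto simp: dist_commute)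
  qed
  then have "measure lborel ?U \<le> measure lborel (cball x0 (R + \<delta>/2) - ball x0 (R - \<delta>/2))"
  proof (rule measure_mono_fmeasurable)
    show "?U \<in> sets lborel" by (simp add: borel_open open_UN)
    show "cball x0 (R + \<delta>/2) - ball x0 (R - \<delta>/2) \<in> fmeasurable lborel"
      using d by (intro fmeasurable_Diff) (auto simp: fmeasurable_def emeasure_cball)
  qed
  also have "\<dots> = \<omega> * (R + \<delta>/2) ^ ?N - \<omega> * (R - \<delta>/2) ^ ?N"
    using d by (subst measure_Diff) (auto simp: content_cball content_ball \<omega>_def emeasure_cball)
  also have "\<dots> = \<omega> * ((R + \<delta>/2) ^ ?N - (R - \<delta>/2) ^ ?N)" by (simp add: algebra_simps)
  also have "\<dots> \<le> \<omega> * ((R + \<delta>/2 - (R - \<delta>/2)) * (real ?N * (R + \<delta>/2) ^ (?N - 1)))"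
    using d w by (intro mult_left_mono power_diff_le) auto
  also have "\<dots> \<le> \<omega> * (\<delta> * (real ?N * (2 * R) ^ (?N - 1)))"
    using d w by (intro mult_mono power_mono) auto
  finally have "\<omega> * (real (card X) * (\<delta>/2) ^ ?N) \<le> \<omega> * (\<delta> * (real ?N * (2 * R) ^ (?N - 1)))"
    using 1 by (simp add: mult_ac)
  then have "real (card X) * (\<delta>/2) ^ ?N \<le> \<delta> * (real ?N * (2 * R) ^ (?N - 1))"
    using w by simp
  moreover have "\<delta> ^ ?N = \<delta> * \<delta> ^ (?N - 1)" using N by (metis power_minus_mult mult.commute)
  ultimately have "\<delta> * (real (card X) * \<delta> ^ (?N - 1)) \<le> \<delta> * (2 ^ ?N * (real ?N * (2 * R) ^ (?N - 1)))"
    by (simp add: power_divide divide_simps mult_ac)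
  then show ?thesis using d by simp
qed

text \<open>Balls of radius \<open>\<delta>\<close> around a maximal
  \<open>\<delta>\<close>-separated subset cover the sphere. The cardinality estimate bounds their
  total gauge by a number that does not depend on \<open>\<delta>\<close>.\<close>

lemma hausdorff_outer_sphere_finite:
  fixes x0 :: "'a::euclidean_space"
  assumes R: "0 < R"
  shows "hausdorff_outer (DIM('a) - 1) (sphere x0 R) < top"
proof -
  let ?N = "DIM('a)" and ?k = "DIM('a) - 1" and ?S = "sphere x0 R"
  define B where "B = 2 ^ ?N * (real ?N * (2 * R) ^ ?k)"
  define \<omega> where "\<omega> = unit_ball_vol (real ?k)"
  have w: "\<omega> > 0" by (simp add: \<omega>_def)
  have bound: "hausdorff_content ?k (2 * \<delta>) ?S \<le> ennreal (\<omega> * B)" if d: "0 < \<delta>" "\<delta> \<le> R" for \<delta>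
  proof -
    let ?P = "\<lambda>X. finite X \<and> X \<subseteq> ?S \<and> pairwise (\<lambda>x y. \<delta> \<le> dist x y) X"
    have cb: "real (card X) * \<delta> ^ ?k \<le> B" if "?P X" for X
      unfolding B_def using that d by (intro card_separated_sphere) auto
    have "card X \<le> nat \<lfloor>B / \<delta> ^ ?k\<rfloor>" if "?P X" for X
      using cb[OF that] d by (intro le_nat_floor) (simp add: field_simps)
    then have "\<forall>X. ?P X \<longrightarrow> card X < Suc (nat \<lfloor>B / \<delta> ^ ?k\<rfloor>)" by (auto simp: less_Suc_eq_le)
    moreover have "?P {}" by simp
    ultimately obtain X where X: "?P X" and max: "\<And>Y. ?P Y \<Longrightarrow> card Y \<le> card X"
      using ex_has_greatest_nat[of ?P "{}" card] by metis
    \<comment> \<open>A point left uncovered could be added to \<open>X\<close> without destroying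
      the separation, against maximality.\<close>
    have cov: "?S \<subseteq> (\<Union>x\<in>X. cball x \<delta>)"
    proof
      fix y assume y: "y \<in> ?S"
      show "y \<in> (\<Union>x\<in>X. cball x \<delta>)"
      proof (rule ccontr)
        assume "\<not> ?thesis"
        then have far: "\<And>x. x \<in> X \<Longrightarrow> \<delta> < dist x y" by auto
        then have "?P (insert y X)"
          using X y by (auto simp: pairwise_insert dist_commute intro: less_imp_le)
        from max[OF this] have "y \<in> X" using X by (auto simp: card_insert_if split: if_splits)
        then show False using far d by fastforce
      qed
    qed
    have "hausdorff_content ?k (2 * \<delta>) ?S \<le> (\<Sum>x\<in>X. hausdorff_gauge ?k (cball x \<delta>))"
      using X cov d by (intro hausdorff_content_le_finite) auto
    also have "\<dots> = (\<Sum>x\<in>X. ennreal (\<omega> * \<delta> ^ ?k))"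
      using d by (intro sum.cong) (auto simp: hausdorff_gauge_def \<omega>_def)
    also have "\<dots> = ennreal (\<omega> * (real (card X) * \<delta> ^ ?k))"
      using w d by (subst sum_ennreal) (auto simp: mult_ac)
    also have "\<dots> \<le> ennreal (\<omega> * B)"
      using cb[OF X] w by (intro ennreal_leI mult_left_mono) auto
    finally show ?thesis .
  qed
  have "hausdorff_outer ?k ?S \<le> ennreal (\<omega> * B)"
    unfolding hausdorff_outer_def
  proof (rule SUP_least)
    fix \<delta> :: real assume "\<delta> \<in> {0<..}"
    \<comment> \<open>The bound is available only for radii up to \<open>R\<close>; for larger
      scales the antitonicity of the content in the scale helps.\<close>
    then have "hausdorff_content ?k \<delta> ?S \<le> hausdorff_content ?k (2 * min (\<delta>/2) R) ?S"
      by (intro hausdorff_content_antimono) auto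
    also have "\<dots> \<le> ennreal (\<omega> * B)" using \<open>\<delta> \<in> {0<..}\<close> R by (intro bound) auto
    finally show "hausdorff_content ?k \<delta> ?S \<le> ennreal (\<omega> * B)" .
  qed
  then show ?thesis by (rule le_less_trans) simp
qed

text \<open>The cone over a small piece of the sphere lies in a thin tube around a radius; comparing volumes
  gives the lower bound for the Hausdorff measure of the sphere.\<close>

lemma cone_cover:
  fixes x0 :: "'a::euclidean_space"
  assumes a: "dist x0 a = R" and d: "0 < d" "d \<le> R"
  obtains B where "B \<in> sets borel"
    "\<And>x t. x \<in> cball a d \<Longrightarrow> 0 \<le> t \<Longrightarrow> t \<le> 1 \<Longrightarrow> x0 + t *\<^sub>R (x - x0) \<in> B"
    "emeasure lborel B \<le> ennreal (3 * R * unit_ball_vol (real DIM('a)) * 2 ^ DIM('a) * d ^ (DIM('a) - 1))"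
proof
  let ?N = "DIM('a)"
  define \<omega> where "\<omega> = unit_ball_vol (real ?N)"
  have w: "\<omega> > 0" by (simp add: \<omega>_def)
  \<comment> \<open>The \<open>n + 1\<close> centres on the radius towards \<open>a\<close> have
    spacing \<open>R / n\<close>, which is at most \<open>d\<close>. The ball radius
    \<open>2 * d\<close> absorbs this spacing and the distance of \<open>x\<close> from
    \<open>a\<close>.\<close>
  define n where "n = nat \<lceil>R / d\<rceil>"
  have n: "real n \<ge> R / d" "real n \<le> R / d + 1" "n > 0"
    using d by (auto simp: n_def)
  define p where "p i = x0 + (real i / real n) *\<^sub>R (a - x0)" for i
  define B where "B = (\<Union>i\<in>{..n}. cball (p i) (2 * d))"
  show "B \<in> sets borel" unfolding B_def by auto
  show "x0 + t *\<^sub>R (x - x0) \<in> B" if x: "x \<in> cball a d" and t: "0 \<le> t" "t \<le> 1" for x t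
  proof -
    define i where "i = nat \<lfloor>t * real n\<rfloor>"
    have i: "real i \<le> t * real n" "t * real n \<le> real i + 1"
      using t by (auto simp: i_def)
    have "t * real n \<le> real n" using t n by (simp add: mult_left_le_one_le)
    then have "i \<le> n" using i by linarith
    have "\<bar>t - real i / real n\<bar> = (t * real n - real i) / real n"
      using i n by (simp add: field_simps abs_if)
    also have "\<dots> \<le> 1 / real n" using i n by (intro divide_right_mono) auto
    finally have ti: "\<bar>t - real i / real n\<bar> \<le> 1 / real n" .
    have "x0 + t *\<^sub>R (x - x0) - p i = t *\<^sub>R (x - a) + (t - real i / real n) *\<^sub>R (a - x0)"
      by (simp add: p_def algebra_simps)
    then have "dist (p i) (x0 + t *\<^sub>R (x - x0)) \<le> \<bar>t\<bar> * norm (x - a) + \<bar>t - real i / real n\<bar> * norm (a - x0)"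
      by (metis dist_commute dist_norm norm_triangle_ineq norm_scaleR)
    also have "\<dots> \<le> 1 * d + (1 / real n) * R"
      using x a t ti d by (intro add_mono mult_mono) (auto simp: dist_norm norm_minus_commute)
    also have "\<dots> \<le> 2 * d" using n d by (simp add: field_simps)
    finally show ?thesis using \<open>i \<le> n\<close> by (auto simp: B_def)
  qed
  have "emeasure lborel B \<le> (\<Sum>i\<in>{..n}. emeasure lborel (cball (p i) (2 * d)))"
    unfolding B_def by (intro emeasure_subadditive_finite) auto
  also have "\<dots> = (\<Sum>i\<in>{..n}. ennreal (\<omega> * (2 * d) ^ ?N))"
    using d by (simp add: emeasure_cball \<omega>_def)
  also have "\<dots> = ennreal ((real n + 1) * (\<omega> * (2 * d) ^ ?N))"
    using d w by (subst sum_ennreal) (auto simp: algebra_simps)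
  also have "\<dots> \<le> ennreal (3 * R * \<omega> * 2 ^ ?N * d ^ (?N - 1))"
  proof (rule ennreal_leI)
    \<comment> \<open>From \<open>n \<le> R / d + 1\<close>, with \<open>d \<le> R\<close> turning
      the remaining 2 into at most \<open>2 * R / d\<close>.\<close>
    have "real n + 1 \<le> 3 * R / d" using n d by (simp add: field_simps)
    then have "(real n + 1) * (\<omega> * (2 * d) ^ ?N) \<le> (3 * R / d) * (\<omega> * (2 * d) ^ ?N)"
      using w d by (intro mult_right_mono) auto
    also have "d ^ ?N = d * d ^ (?N - 1)" by (metis power_minus_mult mult.commute DIM_positive)
    then have "(3 * R / d) * (\<omega> * (2 * d) ^ ?N) = 3 * R * \<omega> * 2 ^ ?N * d ^ (?N - 1)"
      using d by (simp add: power_mult_distrib)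
    finally show "(real n + 1) * (\<omega> * (2 * d) ^ ?N) \<le> 3 * R * \<omega> * 2 ^ ?N * d ^ (?N - 1)" .
  qed
  finally show "emeasure lborel B \<le> ennreal (3 * R * unit_ball_vol (real ?N) * 2 ^ ?N * d ^ (?N - 1))"
    by (simp add: \<omega>_def)
qed

text \<open>A covering set may be a single point, of diameter 0. Its cone is then a segment, which
  lies in the tubes of every radius \<open>e\<close>; the estimate follows by letting
  \<open>e\<close> tend to 0.\<close>

lemma cone_cover':
  fixes x0 :: "'a::euclidean_space"
  assumes a: "dist x0 a = R" and d: "0 \<le> d" "d \<le> R" and R: "0 < R" and N: "2 \<le> DIM('a)"
  obtains B where "B \<in> sets borel"
    "\<And>x t. x \<in> cball a d \<Longrightarrow> 0 \<le> t \<Longrightarrow> t \<le> 1 \<Longrightarrow> x0 + t *\<^sub>R (x - x0) \<in> B"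
    "emeasure lborel B \<le> ennreal (3 * R * unit_ball_vol (real DIM('a)) * 2 ^ DIM('a) * d ^ (DIM('a) - 1))"
proof (cases "d = 0")
  case False
  then show ?thesis using cone_cover[OF a, of d] d that by (metis less_eq_real_def)
next
  case True
  define K where "K = 3 * R * unit_ball_vol (real DIM('a)) * 2 ^ DIM('a)"
  have le: "emeasure lborel (closed_segment x0 a) \<le> ennreal (K * e ^ (DIM('a) - 1))"
    if e: "0 < e" "e \<le> R" for e
  proof -
    obtain B where B: "B \<in> sets borel"
      "\<And>x t. x \<in> cball a e \<Longrightarrow> 0 \<le> t \<Longrightarrow> t \<le> 1 \<Longrightarrow> x0 + t *\<^sub>R (x - x0) \<in> B"
      "emeasure lborel B \<le> ennreal (K * e ^ (DIM('a) - 1))"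
      using cone_cover[OF a e] unfolding K_def by blast
    have "closed_segment x0 a \<subseteq> B"
    proof
      fix y assume "y \<in> closed_segment x0 a"
      then obtain t where "0 \<le> t" "t \<le> 1" "y = (1 - t) *\<^sub>R x0 + t *\<^sub>R a"
        by (auto simp: closed_segment_def)
      then have "y = x0 + t *\<^sub>R (a - x0)" by (simp add: algebra_simps)
      then show "y \<in> B" using B(2)[of a t] e \<open>0 \<le> t\<close> \<open>t \<le> 1\<close> by simp
    qed
    then have "emeasure lborel (closed_segment x0 a) \<le> emeasure lborel B"
      using B(1) by (intro emeasure_mono) auto
    then show ?thesis using B(3) by (rule order_trans)
  qed
  have "((\<lambda>n. ennreal (K * (R / real (Suc n)) ^ (DIM('a) - 1))) \<longlonglongrightarrow> ennreal (K * 0 ^ (DIM('a) - 1)))"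
    by (intro tendsto_intros tendsto_ennrealI tendsto_divide_0[OF tendsto_const]
        filterlim_compose[OF filterlim_real_sequentially filterlim_Suc] filterlim_at_top_imp_at_infinity)
  then have "emeasure lborel (closed_segment x0 a) \<le> ennreal (K * 0 ^ (DIM('a) - 1))"
  proof (rule LIMSEQ_le_const, intro exI allI impI)
    fix n :: nat
    show "emeasure lborel (closed_segment x0 a) \<le> ennreal (K * (R / real (Suc n)) ^ (DIM('a) - 1))"
      by (rule le) (use R in \<open>auto simp: divide_le_eq\<close>)
  qed
  then have "emeasure lborel (closed_segment x0 a) \<le> ennreal (K * d ^ (DIM('a) - 1))"
    using True by simp
  moreover have "x0 + t *\<^sub>R (x - x0) \<in> closed_segment x0 a" if "x \<in> cball a d" "0 \<le> t" "t \<le> 1" for x t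
  proof -
    have "x0 + t *\<^sub>R (x - x0) = (1 - t) *\<^sub>R x0 + t *\<^sub>R a"
      using that True by (simp add: algebra_simps)
    then show ?thesis using that by (auto simp: closed_segment_def)
  qed
  moreover have "closed_segment x0 a \<in> sets borel"
    by (intro borel_closed closed_segment)
  ultimately show ?thesis using that unfolding K_def by blast
qed

text \<open>Otherwise the sphere has covers of arbitrarily small total gauge. The cones over their
  members cover the whole ball, and their volumes are bounded by \<open>L\<close> times the gauges,
  so the ball would have too small a volume.\<close>

lemma hausdorff_outer_sphere_pos:
  fixes x0 :: "'a::euclidean_space"
  assumes R: "0 < R" and N: "2 \<le> DIM('a)"
  shows "0 < hausdorff_outer (DIM('a) - 1) (sphere x0 R)"
proof (rule ccontr)
  let ?N = "DIM('a)" and ?k = "DIM('a) - 1" and ?S = "sphere x0 R"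
  assume "\<not> ?thesis"
  then have "hausdorff_content ?k R ?S = 0"
    using hausdorff_content_le_outer[OF R, of ?k ?S] by simp
  define \<omega> where "\<omega> = unit_ball_vol (real ?N)"
  define \<kappa> where "\<kappa> = unit_ball_vol (real ?k)"
  define K where "K = 3 * R * \<omega> * 2 ^ ?N"
  have pos: "\<omega> > 0" "\<kappa> > 0" by (simp_all add: \<omega>_def \<kappa>_def)
  have K: "K > 0" using R pos by (simp add: K_def)
  \<comment> \<open>The conversion factor from gauge to cone volume:
    \<open>K * d ^ k = L * (\<kappa> * (d / 2) ^ k)\<close> with
    \<open>k = DIM('a) - 1\<close>.\<close>
  define L where "L = K * 2 ^ ?k / \<kappa>"
  have L: "L > 0" using K pos by (simp add: L_def)
  \<comment> \<open>Chosen so that \<open>L * e\<close> is exactly the volume of the ball, which a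
    total gauge below \<open>e\<close> cannot reach.\<close>
  define e where "e = \<omega> * R ^ ?N / L"
  have e: "e > 0" using L pos R by (simp add: e_def)
  have "hausdorff_content ?k R ?S < ennreal e"
    using \<open>hausdorff_content ?k R ?S = 0\<close> e by simp
  then obtain C where C: "?S \<subseteq> (\<Union>j. C j)" "\<And>j. bounded (C j)" "\<And>j. diameter (C j) \<le> R"
    "(\<Sum>j. hausdorff_gauge ?k (C j)) < ennreal e"
    by (rule hausdorff_content_lessD) blast
  have "\<exists>B. B \<in> sets borel \<and>
      (\<forall>x t. x \<in> C j \<inter> ?S \<longrightarrow> 0 \<le> t \<longrightarrow> t \<le> 1 \<longrightarrow> x0 + t *\<^sub>R (x - x0) \<in> B) \<and>
      emeasure lborel B \<le> ennreal L * hausdorff_gauge ?k (C j)" for j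
  proof (cases "C j \<inter> ?S = {}")
    case False
    then obtain a where a: "a \<in> C j" "dist x0 a = R" by (metis Int_iff all_not_in_conv mem_sphere)
    define d where "d = diameter (C j)"
    have d: "0 \<le> d" "d \<le> R" using C(2,3)[of j] by (auto simp: d_def diameter_ge_0)
    have sub: "C j \<subseteq> cball a d"
      using diameter_bounded_bound[OF C(2)[of j] a(1)] by (auto simp: d_def)
    obtain B where B: "B \<in> sets borel"
      "\<And>x t. x \<in> cball a d \<Longrightarrow> 0 \<le> t \<Longrightarrow> t \<le> 1 \<Longrightarrow> x0 + t *\<^sub>R (x - x0) \<in> B"
      "emeasure lborel B \<le> ennreal (K * d ^ ?k)"
      using cone_cover'[OF a(2) d R N] unfolding K_def \<omega>_def by blast
    have "K * d ^ ?k = L * (\<kappa> * (d / 2) ^ ?k)"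
      using pos by (simp add: L_def power_divide)
    then have "ennreal (K * d ^ ?k) = ennreal L * hausdorff_gauge ?k (C j)"
      using a L pos d by (auto simp: hausdorff_gauge_def \<kappa>_def d_def ennreal_mult)
    then show ?thesis using B sub by (intro exI[of _ B]) auto
  qed (auto intro!: exI[of _ "{}"])
  then obtain B where B: "\<And>j. B j \<in> sets borel"
    "\<And>j x t. x \<in> C j \<inter> ?S \<Longrightarrow> 0 \<le> t \<Longrightarrow> t \<le> 1 \<Longrightarrow> x0 + t *\<^sub>R (x - x0) \<in> B j"
    "\<And>j. emeasure lborel (B j) \<le> ennreal L * hausdorff_gauge ?k (C j)"
    by metis
  have "cball x0 R \<subseteq> (\<Union>j. B j)"
  proof
    fix y assume y: "y \<in> cball x0 R"
    \<comment> \<open>Polar coordinates of \<open>y\<close>; the centre belongs to every radius and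
      takes \<open>t = 0\<close> with an arbitrary point of the sphere.\<close>
    obtain s t where s: "s \<in> ?S" "0 \<le> t" "t \<le> 1" "y = x0 + t *\<^sub>R (s - x0)"
    proof (cases "y = x0")
      case True
      obtain b :: 'a where b: "b \<in> Basis" using nonempty_Basis by blast
      show ?thesis
        by (rule that[of "x0 + R *\<^sub>R b" 0]) (use b R True in \<open>auto simp: dist_norm\<close>)
    next
      case False
      define r where "r = norm (y - x0)"
      have r: "r > 0" "r \<le> R" using False y by (auto simp: r_def dist_norm norm_minus_commute)
      show ?thesis
        by (rule that[of "x0 + (R / r) *\<^sub>R (y - x0)" "r / R"])
           (use r R in \<open>auto simp: dist_norm r_def[symmetric]\<close>)
    qed
    then obtain j where "s \<in> C j" using C(1) by auto
    then show "y \<in> (\<Union>j. B j)" using B(2)[of s j t] s by blast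
  qed
  then have "emeasure lborel (cball x0 R) \<le> emeasure lborel (\<Union>j. B j)"
    using B(1) by (intro emeasure_mono) auto
  also have "\<dots> \<le> (\<Sum>j. emeasure lborel (B j))"
    using B(1) by (intro emeasure_subadditive_countably) auto
  also have "\<dots> \<le> (\<Sum>j. ennreal L * hausdorff_gauge ?k (C j))"
    by (intro suminf_le B(3)) auto
  also have "\<dots> = ennreal L * (\<Sum>j. hausdorff_gauge ?k (C j))" by simp
  also have "\<dots> < ennreal L * ennreal e"
    using C(4) L by (intro ennreal_mult_strict_left_mono) auto
  also have "\<dots> = ennreal (\<omega> * R ^ ?N)"
    using L e by (subst ennreal_mult[symmetric]) (auto simp: e_def)
  also have "\<dots> = emeasure lborel (cball x0 R)"
    using R by (simp add: emeasure_cball \<omega>_def)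
  finally show False by simp
qed

section \<open>Isometries fixing a point\<close>

definition isometry_at :: "'a::euclidean_space \<Rightarrow> ('a \<Rightarrow> 'a) \<Rightarrow> bool" where
  "isometry_at x0 T \<longleftrightarrow> (\<exists>L. orthogonal_transformation L \<and> (\<forall>x. T x = x0 + L (x - x0)))"

lemma isometry_atD:
  assumes "isometry_at x0 T"
  shows "dist (T x) (T y) = dist x y" "T x0 = x0" "surj T" "continuous_on A T" "T \<in> borel_measurable borel"
proof -
  obtain L where L: "orthogonal_transformation L" and T: "\<And>x. T x = x0 + L (x - x0)"
    using assms by (auto simp: isometry_at_def)
  have lin: "linear L" using L by (simp add: orthogonal_transformation)
  show d: "dist (T x) (T y) = dist x y" for x y
    using orthogonal_transformation_norm[OF L, of "x - y"] by (simp add: T dist_norm linear_diff[OF lin])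
  show "T x0 = x0" by (simp add: T linear_0[OF lin])
  show "surj T"
  proof (rule surjI)
    show "T (x0 + inv L (y - x0)) = y" for y
      using surj_f_inv_f[OF orthogonal_transformation_surj[OF L], of "y - x0"] by (simp add: T)
  qed
  have c: "continuous_on UNIV T"
    unfolding continuous_on_iff d by auto
  show "continuous_on A T" by (rule continuous_on_subset[OF c]) simp
  show "T \<in> borel_measurable borel" by (rule borel_measurable_continuous_onI[OF c])
qed

text \<open>For \<open>x \<noteq> y\<close> the map is the reflection in the hyperplane through
  \<open>x0\<close> orthogonal to \<open>n = x - y\<close>. Equal distances from \<open>x0\<close>
  give 2 (x - x0) \<bullet> n = n \<bullet> n, so the reflection carries \<open>x\<close> to
  \<open>y\<close>.\<close>

lemma isometry_at_exists:
  fixes x0 x y :: "'a::euclidean_space"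
  assumes eq: "dist x0 x = dist x0 y"
  obtains T where "isometry_at x0 T" "T x = y"
proof (cases "x = y")
  case True
  have "isometry_at x0 (\<lambda>x. x)"
    unfolding isometry_at_def by (rule exI[of _ "\<lambda>x. x"]) simp
  then show ?thesis using that True by blast
next
  case False
  define n where "n = x - y"
  define L where "L z = z - (2 * (z \<bullet> n) / (n \<bullet> n)) *\<^sub>R n" for z
  have nn: "n \<bullet> n \<noteq> 0" using False by (simp add: n_def)
  have lin: "linear L"
    by (rule linearI) (simp_all add: L_def algebra_simps add_divide_distrib)
  have "norm (L z) = norm z" for z
  proof -
    have "L z \<bullet> L z = z \<bullet> z"
      using nn by (simp add: L_def inner_diff_left inner_diff_right inner_commute field_simps)
    then show ?thesis by (simp add: norm_eq_sqrt_inner)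
  qed
  then have L: "orthogonal_transformation L" using lin by (simp add: orthogonal_transformation)
  have "norm (x - x0) = norm (y - x0)" using eq by (simp add: dist_norm norm_minus_commute)
  then have "(x - x0) \<bullet> (x - x0) = (y - x0) \<bullet> (y - x0)" by (simp add: norm_eq_sqrt_inner)
  then have "2 * ((x - x0) \<bullet> n) = n \<bullet> n"
    by (simp add: n_def inner_diff_left inner_diff_right inner_commute)
  then have "x0 + L (x - x0) = y" using nn by (simp add: L_def n_def)
  moreover have "isometry_at x0 (\<lambda>x. x0 + L (x - x0))"
    unfolding isometry_at_def using L by blast
  ultimately show ?thesis using that by blast
qed

text \<open>Uniqueness of Haar measure by Fubini: the product of \<nu>(A) with the Lebesgue volume
  of the unit ball is written as a double integral over \<nu> and Lebesgue measure. Exchanging the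
  order and shifting turns it into the Lebesgue measure of \<open>A\<close> times the \<nu>-measure
  of the unit ball, and both ball measures agree.\<close>

lemma lborel_translation_unique:
  fixes \<nu> :: "'a::euclidean_space measure"
  assumes sets: "sets \<nu> = sets borel" and sf: "sigma_finite_measure \<nu>"
    and trans: "\<And>y. distr \<nu> borel ((+) y) = \<nu>"
    and ball: "emeasure \<nu> (ball 0 1) = emeasure lborel (ball (0::'a) 1)"
  shows "\<nu> = lborel"
proof (rule measure_eqI)
  show "sets \<nu> = sets lborel" using sets by simp
  fix A assume "A \<in> sets \<nu>"
  then have A[measurable]: "A \<in> sets borel" using sets by simp
  note [measurable_cong] = sets
  interpret \<nu>: sigma_finite_measure \<nu> by (rule sf)
  interpret P: pair_sigma_finite \<nu> lborel ..
  define c where "c = emeasure lborel (ball (0::'a) 1)"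
  have "unit_ball_vol (real DIM('a)) \<noteq> 0"
    by (metis less_irrefl of_nat_0_le_iff unit_ball_vol_pos)
  then have c: "c \<noteq> 0" "c \<noteq> top" by (auto simp: c_def emeasure_ball)
  let ?B = "ball (0::'a) 1"
  have [measurable]: "?B \<in> sets borel" by simp
  have 1: "(\<integral>\<^sup>+y. indicator ?B (y - x) \<partial>lborel) = c" for x :: 'a
  proof -
    have "(\<integral>\<^sup>+y. indicator ?B (y - x) \<partial>lborel) = (\<integral>\<^sup>+y. indicator (ball x 1) y \<partial>lborel)"
      by (intro nn_integral_cong) (auto simp: indicator_def dist_norm norm_minus_commute)
    then show ?thesis by (simp add: c_def emeasure_ball)
  qed
  \<comment> \<open>Translation invariance of \<nu> replaces \<open>x\<close> by
    \<open>y + x\<close>; then \<open>y - x\<close> becomes \<open>- x\<close>, and the ball is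
    symmetric.\<close>
  have 2: "(\<integral>\<^sup>+x. indicator A x * indicator ?B (y - x) \<partial>\<nu>)
      = (\<integral>\<^sup>+x. indicator A (y + x) * indicator ?B x \<partial>\<nu>)" for y :: 'a
  proof -
    have "(\<integral>\<^sup>+x. indicator A x * indicator ?B (y - x) \<partial>\<nu>)
        = (\<integral>\<^sup>+x. indicator A x * indicator ?B (y - x) \<partial>distr \<nu> borel ((+) y))"
      by (simp only: trans)
    also have "\<dots> = (\<integral>\<^sup>+x. indicator A (y + x) * indicator ?B (y - (y + x)) \<partial>\<nu>)"
      by (rule nn_integral_distr) auto
    also have "\<dots> = (\<integral>\<^sup>+x. indicator A (y + x) * indicator ?B x \<partial>\<nu>)"
      by (intro nn_integral_cong) (auto simp: indicator_def)
    finally show ?thesis .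
  qed
  have 3: "(\<integral>\<^sup>+y. indicator A (y + x) \<partial>lborel) = emeasure lborel A" for x :: 'a
  proof -
    have "emeasure lborel A = emeasure (distr lborel borel ((+) x)) A"
      using lborel_affine[of 1 x] by (simp add: density_1)
    also have "\<dots> = (\<integral>\<^sup>+y. indicator A y \<partial>distr lborel borel ((+) x))" by simp
    also have "\<dots> = (\<integral>\<^sup>+y. indicator A (x + y) \<partial>lborel)" by (rule nn_integral_distr) auto
    finally show ?thesis by (simp add: add.commute)
  qed
  have "c * emeasure \<nu> A = (\<integral>\<^sup>+x. indicator A x * (\<integral>\<^sup>+y. indicator ?B (y - x) \<partial>lborel) \<partial>\<nu>)"
    unfolding 1 using sets by (simp add: nn_integral_cmult_indicator mult.commute)
  also have "\<dots> = (\<integral>\<^sup>+x. \<integral>\<^sup>+y. indicator A x * indicator ?B (y - x) \<partial>lborel \<partial>\<nu>)"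
    by (intro nn_integral_cong nn_integral_cmult[symmetric]) measurable
  also have "\<dots> = (\<integral>\<^sup>+y. \<integral>\<^sup>+x. indicator A x * indicator ?B (y - x) \<partial>\<nu> \<partial>lborel)"
    by (rule P.Fubini'[symmetric]) measurable
  also have "\<dots> = (\<integral>\<^sup>+y. \<integral>\<^sup>+x. indicator A (y + x) * indicator ?B x \<partial>\<nu> \<partial>lborel)"
    by (simp only: 2)
  also have "\<dots> = (\<integral>\<^sup>+x. \<integral>\<^sup>+y. indicator A (y + x) * indicator ?B x \<partial>lborel \<partial>\<nu>)"
    by (rule P.Fubini') measurable
  also have "\<dots> = (\<integral>\<^sup>+x. emeasure lborel A * indicator ?B x \<partial>\<nu>)"
  proof (rule nn_integral_cong)
    fix x
    have "(\<integral>\<^sup>+y. indicator A (y + x) * indicator ?B x \<partial>lborel) = (\<integral>\<^sup>+y. indicator A (y + x) \<partial>lborel) * indicator ?B x"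
      by (rule nn_integral_multc) measurable
    then show "(\<integral>\<^sup>+y. indicator A (y + x) * indicator ?B x \<partial>lborel) = emeasure lborel A * indicator ?B x"
      by (simp only: 3)
  qed
  also have "\<dots> = emeasure lborel A * c"
    using ball by (subst nn_integral_cmult_indicator) (auto simp: c_def)
  finally show "emeasure \<nu> A = emeasure lborel A"
    using c by (simp add: mult.commute ennreal_mult_cancel_left)
qed

text \<open>The image measure is translation invariant because \<open>T\<close> is affine with
  surjective linear part, and it gives balls their Lebesgue volume because \<open>T\<close>
  preserves distances. Uniqueness then replaces any determinant computation.\<close>

lemma lborel_distr_isometry:
  fixes x0 :: "'a::euclidean_space"
  assumes T: "isometry_at x0 T"
  shows "distr lborel borel T = lborel"
proof (rule lborel_translation_unique)
  note [measurable] = isometry_atD(5)[OF T]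
  obtain L where L: "orthogonal_transformation L" and TL: "\<And>x. T x = x0 + L (x - x0)"
    using T by (auto simp: isometry_at_def)
  have lin: "linear L" using L by (simp add: orthogonal_transformation)
  have sh: "distr lborel borel ((+) y) = lborel" for y :: 'a
    using lborel_affine[of 1 y] by (simp add: density_1)
  have vol: "emeasure (distr lborel borel T) (ball (T x) r) = emeasure lborel (ball x r)" for x r
  proof -
    have "T -` ball (T x) r = ball x r"
      by (auto simp: isometry_atD(1)[OF T])
    then show ?thesis by (simp add: emeasure_distr)
  qed
  obtain x1 where "T x1 = 0" using isometry_atD(3)[OF T] by (metis surjD)
  then show "emeasure (distr lborel borel T) (ball 0 1) = emeasure lborel (ball (0::'a) 1)"
    using vol[of x1 1] by (simp add: emeasure_ball)
  show "distr (distr lborel borel T) borel ((+) y) = distr lborel borel T" for y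
  proof -
    obtain y' where y': "L y' = y" using orthogonal_transformation_surj[OF L] by (metis surjD)
    have "distr (distr lborel borel T) borel ((+) y) = distr lborel borel (\<lambda>x. y + T x)"
      by (subst distr_distr) (auto simp: o_def)
    also have "(\<lambda>x. y + T x) = T \<circ> (+) y'"
    proof (rule ext)
      fix x
      have "L (y' + x - x0) = L (y' + (x - x0))" by (simp add: algebra_simps)
      then show "y + T x = (T \<circ> (+) y') x" using y' by (simp add: TL linear_add[OF lin])
    qed
    also have "distr lborel borel (T \<circ> (+) y') = distr (distr lborel borel ((+) y')) borel T"
      by (subst distr_distr) auto
    finally show ?thesis by (simp add: sh)
  qed
  show "sigma_finite_measure (distr lborel borel T)"
  proof (rule sigma_finite_measure.intro, intro exI conjI)
    let ?A = "range (\<lambda>n::nat. ball x0 (real n))"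
    show "countable ?A" by simp
    show "?A \<subseteq> sets (distr lborel borel T)" by auto
    show "\<Union>?A = space (distr lborel borel T)" by (auto simp: dist_norm intro: reals_Archimedean2)
    have "emeasure (distr lborel borel T) (ball x0 r) \<noteq> \<infinity>" for r
      using vol[of x0 r] isometry_atD(2)[OF T] emeasure_lborel_ball_finite[of x0 r] by simp
    then show "\<forall>a\<in>?A. emeasure (distr lborel borel T) a \<noteq> \<infinity>" by auto
  qed
qed simp

section \<open>Isometry invariant measures on a sphere\<close>

text \<open>The measures live on the Borel sets of the whole space and are merely concentrated on
  the sphere, so that the Hausdorff measure and measures pushed onto the sphere by a projection can
  be compared on the same \<sigma>-algebra.\<close>

locale sphere_measure = finite_measure M for M :: "'a::euclidean_space measure" +
  fixes x0 :: 'a and R :: real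
  assumes sets_M [measurable_cong, simp]: "sets M = sets borel"
    and conc: "AE x in M. x \<in> sphere x0 R"
    and inv: "\<And>T A. isometry_at x0 T \<Longrightarrow> A \<in> sets borel \<Longrightarrow> emeasure M (T -` A) = emeasure M A"
begin

lemma space_M [simp]: "space M = UNIV"
  using sets_eq_imp_space_eq[OF sets_M] by simp

lemma emeasure_ball_const:
  assumes "x \<in> sphere x0 R" "y \<in> sphere x0 R"
  shows "emeasure M (ball x r) = emeasure M (ball y r)"
proof -
  obtain T where T: "isometry_at x0 T" "T x = y"
    using isometry_at_exists[of x0 x y] assms by auto
  have "T -` ball y r = ball x r"
    using T(2) by (auto simp: isometry_atD(1)[OF T(1)] simp flip: T(2))
  then show ?thesis using inv[OF T(1), of "ball y r"] by simp
qed

text \<open>By compactness finitely many balls of radius \<open>r\<close> centred on the sphere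
  cover it, and invariance gives all of them the same measure. If that measure were 0, the total
  mass would be 0.\<close>

lemma measure_ball_pos:
  assumes x: "x \<in> sphere x0 R" and r: "0 < r" and pos: "0 < emeasure M UNIV"
  shows "0 < measure M (ball x r)"
proof (rule ccontr)
  assume "\<not> ?thesis"
  then have "measure M (ball x r) = 0" using measure_nonneg[of M "ball x r"] by linarith
  then have z: "emeasure M (ball x r) = 0" by (simp add: emeasure_eq_measure)
  have "compact (sphere x0 R)" by simp
  moreover have "sphere x0 R \<subseteq> (\<Union>y\<in>sphere x0 R. ball y r)" using r by auto
  ultimately obtain Y where Y: "Y \<subseteq> sphere x0 R" "finite Y" "sphere x0 R \<subseteq> (\<Union>y\<in>Y. ball y r)"
    using compactE_image[of "sphere x0 R" "sphere x0 R" "\<lambda>y. ball y r"] by (metis open_ball)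
  have "ball y r \<in> null_sets M" if "y \<in> Y" for y
    using emeasure_ball_const[OF x, of y r] z Y(1) that by (auto simp: null_sets_def)
  then have "(\<Union>y\<in>Y. ball y r) \<in> null_sets M"
    using Y(2) by (intro null_sets_UN') (auto simp: countable_finite)
  then have "AE x in M. x \<notin> (\<Union>y\<in>Y. ball y r)" by (rule AE_not_in)
  with conc have "AE x in M. False" by eventually_elim (use Y(3) in blast)
  then have "emeasure M (space M) = 0" by (simp add: AE_iff_measurable[of UNIV])
  then show False using pos by simp
qed

end

text \<open>Integrate \<open>f\<close> against both measures over the pairs at distance less than \<open>r\<close>: invariance makes
  the inner integral constant, and \<open>f x\<close> is close to \<open>f y\<close> on such pairs.\<close>

lemma sphere_measures_proportional:
  fixes f :: "'a::euclidean_space \<Rightarrow> real"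
  assumes M: "sphere_measure M x0 R" and M': "sphere_measure M' x0 R"
    and f: "continuous_on UNIV f"
  shows "measure M UNIV * (\<integral>x. f x \<partial>M') = measure M' UNIV * (\<integral>x. f x \<partial>M)"
proof -
  interpret M: sphere_measure M x0 R by (rule M)
  interpret M': sphere_measure M' x0 R by (rule M')
  interpret P: pair_sigma_finite M M' ..
  let ?S = "sphere x0 R"
  have fm[measurable]: "f \<in> borel_measurable borel" by (rule borel_measurable_continuous_onI[OF f])
  have cS: "continuous_on ?S f" by (rule continuous_on_subset[OF f]) simp
  have "bounded (f ` ?S)"
    using compact_imp_bounded[OF compact_continuous_image[OF cS compact_sphere]] .
  then obtain B where "\<forall>x\<in>?S. \<bar>f x\<bar> \<le> B" by (auto simp: bounded_iff)
  then have B: "\<And>x. x \<in> ?S \<Longrightarrow> \<bar>f x\<bar> \<le> B" by blast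
  have int: "integrable M f" "integrable M' f"
    using M.conc M'.conc B
    by (auto intro!: M.integrable_const_bound[of _ B] M'.integrable_const_bound[of _ B] elim!: eventually_mono)
  show ?thesis
  proof (cases "emeasure M UNIV = 0 \<or> emeasure M' UNIV = 0 \<or> ?S = {}")
    case True
    have "emeasure M UNIV = 0" if "?S = {}"
      using M.conc that by (simp add: AE_iff_measurable[of UNIV])
    moreover have "emeasure M' UNIV = 0" if "?S = {}"
      using M'.conc that by (simp add: AE_iff_measurable[of UNIV])
    moreover have "(\<integral>x. f x \<partial>M) = 0" if "emeasure M UNIV = 0"
    proof -
      have "AE x in M. f x = 0" using that by (intro AE_I[of _ _ UNIV]) auto
      then show ?thesis by (simp add: integral_eq_zero_AE)
    qed
    moreover have "(\<integral>x. f x \<partial>M') = 0" if "emeasure M' UNIV = 0"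
    proof -
      have "AE x in M'. f x = 0" using that by (intro AE_I[of _ _ UNIV]) auto
      then show ?thesis by (simp add: integral_eq_zero_AE)
    qed
    ultimately show ?thesis using True by (auto simp: measure_def)
  next
    case False
    then have pos: "0 < emeasure M UNIV" "0 < emeasure M' UNIV" by (auto simp: zero_less_iff_neq_zero)
    obtain s where s: "s \<in> ?S" using False by blast
    define m m' where "m = measure M UNIV" and "m' = measure M' UNIV"
    have "\<bar>m * (\<integral>x. f x \<partial>M') - m' * (\<integral>x. f x \<partial>M)\<bar> \<le> e * (m * m')" if e: "0 < e" for e
    proof -
      have "uniformly_continuous_on ?S f"
        by (rule compact_uniformly_continuous[OF cS compact_sphere])
      then obtain r where r: "0 < r" "\<And>x y. x \<in> ?S \<Longrightarrow> y \<in> ?S \<Longrightarrow> dist y x < r \<Longrightarrow> dist (f y) (f x) < e"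
        unfolding uniformly_continuous_on_def using e by metis
      define \<phi> \<psi> where "\<phi> = measure M (ball s r)" and "\<psi> = measure M' (ball s r)"
      have phi: "\<And>y. y \<in> ?S \<Longrightarrow> measure M (ball y r) = \<phi>"
        and psi: "\<And>y. y \<in> ?S \<Longrightarrow> measure M' (ball y r) = \<psi>"
        using M.emeasure_ball_const[OF _ s, of _ r] M'.emeasure_ball_const[OF _ s, of _ r]
        by (auto simp: \<phi>_def \<psi>_def measure_def)
      have phi0: "0 < \<phi>" unfolding \<phi>_def by (rule M.measure_ball_pos[OF s r(1) pos(1)])
      \<comment> \<open>A symmetric kernel: for fixed \<open>y\<close> on the sphere its integral
        over \<open>x\<close> is \<open>\<phi>\<close>, and for fixed \<open>x\<close> on the sphere
        its integral over \<open>y\<close> is \<open>\<psi>\<close>.\<close>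
      let ?I = "\<lambda>x y. indicator {p. dist (fst p) (snd p) < r} (x, y) :: real"
      have Ix: "?I x y = indicator (ball y r) x" "?I x y = indicator (ball x r) y" for x y
        by (auto simp: indicator_def dist_commute)
      have Im[measurable]: "{p. dist (fst p) (snd p) < r} \<in> sets (borel \<Otimes>\<^sub>M (borel :: 'a measure))"
        unfolding borel_prod by (intro borel_open open_Collect_less continuous_intros)
      have [measurable]: "{p. dist x0 (fst p) = R} \<in> sets (borel \<Otimes>\<^sub>M (borel :: 'a measure))"
        "{p. dist x0 (snd p) = R} \<in> sets ((borel :: 'a measure) \<Otimes>\<^sub>M borel)"
        unfolding borel_prod by (intro borel_closed closed_Collect_eq continuous_intros)+
      have sp: "space (M \<Otimes>\<^sub>M M') = UNIV" by (simp add: space_pair_measure)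
      have bnd: "AE p in M \<Otimes>\<^sub>M M'. fst p \<in> ?S \<and> snd p \<in> ?S"
      proof -
        have "AE p in M \<Otimes>\<^sub>M M'. fst p \<in> ?S"
          using M.conc by (intro P.AE_pair_measure) (auto simp: sp)
        moreover have "AE p in M \<Otimes>\<^sub>M M'. snd p \<in> ?S"
          using M'.conc by (intro P.AE_pair_measure) (auto simp: sp)
        ultimately show ?thesis by eventually_elim simp
      qed
      interpret Q: finite_measure "M \<Otimes>\<^sub>M M'"
        by (rule finite_measure_pair_measure) unfold_locales
      have i1: "integrable (M \<Otimes>\<^sub>M M') (\<lambda>(x, y). ?I x y * f y)"
        and i2: "integrable (M \<Otimes>\<^sub>M M') (\<lambda>(x, y). ?I x y * f x)"
        and i3: "integrable (M \<Otimes>\<^sub>M M') (\<lambda>(x, y). ?I x y)"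
      proof -
        have "AE p in M \<Otimes>\<^sub>M M'. norm (case p of (x, y) \<Rightarrow> ?I x y * f y) \<le> \<bar>B\<bar>"
          using bnd by eventually_elim (use B in \<open>force simp: indicator_def split_beta\<close>)
        then show "integrable (M \<Otimes>\<^sub>M M') (\<lambda>(x, y). ?I x y * f y)"
          by (rule Q.integrable_const_bound) measurable
        have "AE p in M \<Otimes>\<^sub>M M'. norm (case p of (x, y) \<Rightarrow> ?I x y * f x) \<le> \<bar>B\<bar>"
          using bnd by eventually_elim (use B in \<open>force simp: indicator_def split_beta\<close>)
        then show "integrable (M \<Otimes>\<^sub>M M') (\<lambda>(x, y). ?I x y * f x)"
          by (rule Q.integrable_const_bound) measurable
        show "integrable (M \<Otimes>\<^sub>M M') (\<lambda>(x, y). ?I x y)"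
          by (rule Q.integrable_const_bound[of _ 1]) (auto simp: indicator_def split_beta)
      qed
      have J1: "(\<integral>p. (case p of (x, y) \<Rightarrow> ?I x y * f y) \<partial>(M \<Otimes>\<^sub>M M')) = \<phi> * (\<integral>y. f y \<partial>M')"
      proof -
        have "(\<integral>p. (case p of (x, y) \<Rightarrow> ?I x y * f y) \<partial>(M \<Otimes>\<^sub>M M')) = (\<integral>y. (\<integral>x. ?I x y * f y \<partial>M) \<partial>M')"
          using P.integral_snd[OF i1] by simp
        also have "\<dots> = (\<integral>y. \<phi> * f y \<partial>M')"
        proof (rule integral_cong_AE)
          show "AE y in M'. (\<integral>x. ?I x y * f y \<partial>M) = \<phi> * f y"
            using M'.conc by eventually_elim (simp add: Ix(1) phi)
        qed measurable
        finally show ?thesis by simp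
      qed
      have J2: "(\<integral>p. (case p of (x, y) \<Rightarrow> ?I x y * f x) \<partial>(M \<Otimes>\<^sub>M M')) = \<psi> * (\<integral>x. f x \<partial>M)"
      proof -
        have "(\<integral>p. (case p of (x, y) \<Rightarrow> ?I x y * f x) \<partial>(M \<Otimes>\<^sub>M M')) = (\<integral>x. (\<integral>y. ?I x y * f x \<partial>M') \<partial>M)"
          using P.integral_fst'[OF i2] by simp
        also have "\<dots> = (\<integral>x. \<psi> * f x \<partial>M)"
        proof (rule integral_cong_AE)
          show "AE x in M. (\<integral>y. ?I x y * f x \<partial>M') = \<psi> * f x"
            using M.conc by eventually_elim (simp add: Ix(2) psi)
        qed measurable
        finally show ?thesis by simp
      qed
      have J3: "(\<integral>p. (case p of (x, y) \<Rightarrow> ?I x y) \<partial>(M \<Otimes>\<^sub>M M')) = \<phi> * m'"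
      proof -
        have "(\<integral>p. (case p of (x, y) \<Rightarrow> ?I x y) \<partial>(M \<Otimes>\<^sub>M M')) = (\<integral>y. (\<integral>x. ?I x y \<partial>M) \<partial>M')"
          using P.integral_snd[OF i3] by simp
        also have "\<dots> = (\<integral>y. \<phi> \<partial>M')"
        proof (rule integral_cong_AE)
          show "AE y in M'. (\<integral>x. ?I x y \<partial>M) = \<phi>"
            using M'.conc by eventually_elim (simp add: Ix(1) phi)
        qed measurable
        finally show ?thesis by (simp add: m'_def mult.commute)
      qed
      have J4: "(\<integral>p. (case p of (x, y) \<Rightarrow> ?I x y) \<partial>(M \<Otimes>\<^sub>M M')) = \<psi> * m"
      proof -
        have "(\<integral>p. (case p of (x, y) \<Rightarrow> ?I x y) \<partial>(M \<Otimes>\<^sub>M M')) = (\<integral>x. (\<integral>y. ?I x y \<partial>M') \<partial>M)"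
          using P.integral_fst'[OF i3] by simp
        also have "\<dots> = (\<integral>x. \<psi> \<partial>M)"
        proof (rule integral_cong_AE)
          show "AE x in M. (\<integral>y. ?I x y \<partial>M') = \<psi>"
            using M.conc by eventually_elim (simp add: Ix(2) psi)
        qed measurable
        finally show ?thesis by (simp add: m_def mult.commute)
      qed
      have "\<bar>\<phi> * (\<integral>y. f y \<partial>M') - \<psi> * (\<integral>x. f x \<partial>M)\<bar>
          = \<bar>\<integral>p. (case p of (x, y) \<Rightarrow> ?I x y * f y) - (case p of (x, y) \<Rightarrow> ?I x y * f x) \<partial>(M \<Otimes>\<^sub>M M')\<bar>"
        using Bochner_Integration.integral_diff[OF i1 i2] by (simp only: J1 J2)
      also have "\<dots> \<le> (\<integral>p. e * (case p of (x, y) \<Rightarrow> ?I x y) \<partial>(M \<Otimes>\<^sub>M M'))"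
      proof (rule integral_abs_bound[THEN order_trans], rule integral_mono_AE)
        show "integrable (M \<Otimes>\<^sub>M M') (\<lambda>p. \<bar>(case p of (x, y) \<Rightarrow> ?I x y * f y) - (case p of (x, y) \<Rightarrow> ?I x y * f x)\<bar>)"
          by (rule integrable_abs[OF Bochner_Integration.integrable_diff[OF i1 i2]])
        show "integrable (M \<Otimes>\<^sub>M M') (\<lambda>p. e * (case p of (x, y) \<Rightarrow> ?I x y))"
          using i3 by auto
        show "AE p in M \<Otimes>\<^sub>M M'. \<bar>(case p of (x, y) \<Rightarrow> ?I x y * f y) - (case p of (x, y) \<Rightarrow> ?I x y * f x)\<bar>
            \<le> e * (case p of (x, y) \<Rightarrow> ?I x y)"
          using bnd
        proof eventually_elim
          case (elim p)
          then show ?case using r(2)[of "fst p" "snd p"]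
            by (auto simp: split_beta indicator_def dist_real_def dist_commute)
        qed
      qed
      also have "\<dots> = e * (\<phi> * m')" by (simp only: integral_mult_right_zero J3)
      finally have "\<bar>\<phi> * (\<integral>y. f y \<partial>M') - \<psi> * (\<integral>x. f x \<partial>M)\<bar> * m \<le> e * (\<phi> * m') * m"
        by (intro mult_right_mono) (auto simp: m_def)
      \<comment> \<open>Integrating the kernel alone in both orders gives
        \<open>\<psi> * m = \<phi> * m'\<close>. After multiplication by \<open>m\<close> this
        removes \<open>\<psi>\<close> and leaves the common factor \<open>\<phi> > 0\<close>, which
        cancels.\<close>
      moreover have "\<bar>\<phi> * (\<integral>y. f y \<partial>M') - \<psi> * (\<integral>x. f x \<partial>M)\<bar> * m
          = \<phi> * \<bar>m * (\<integral>y. f y \<partial>M') - m' * (\<integral>x. f x \<partial>M)\<bar>"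
      proof -
        have "\<psi> * m = \<phi> * m'" using J3 J4 by simp
        then have "(\<phi> * (\<integral>y. f y \<partial>M') - \<psi> * (\<integral>x. f x \<partial>M)) * m = \<phi> * (m * (\<integral>y. f y \<partial>M') - m' * (\<integral>x. f x \<partial>M))"
          by (simp add: algebra_simps)
        moreover have "0 \<le> m" by (simp add: m_def)
        ultimately show ?thesis using phi0 by (metis abs_mult abs_of_nonneg abs_of_pos)
      qed
      ultimately have "\<phi> * \<bar>m * (\<integral>y. f y \<partial>M') - m' * (\<integral>x. f x \<partial>M)\<bar> \<le> \<phi> * (e * (m * m'))"
        by (simp add: mult_ac)
      then show ?thesis using phi0 by simp
    qed
    then have lim: "\<bar>m * (\<integral>x. f x \<partial>M') - m' * (\<integral>x. f x \<partial>M)\<bar> \<le> e" if "0 < e" for e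
    proof -
      have mm: "0 \<le> m * m'" by (simp add: m_def m'_def)
      have "\<bar>m * (\<integral>x. f x \<partial>M') - m' * (\<integral>x. f x \<partial>M)\<bar> \<le> e / (m * m' + 1) * (m * m')"
        using that mm by (intro \<open>\<And>e. 0 < e \<Longrightarrow> _ \<le> e * (m * m')\<close>) auto
      also have "\<dots> \<le> e" using that mm by (simp add: field_simps)
      finally show ?thesis .
    qed
    have "\<bar>m * (\<integral>x. f x \<partial>M') - m' * (\<integral>x. f x \<partial>M)\<bar> \<le> 0"
      using lim by (rule field_le_epsilon) simp
    then show ?thesis by (simp add: m_def m'_def)
  qed
qed

section \<open>Smooth functions\<close>

text \<open>\<open>Ck\<close> refers to the derivative selected by
  \<open>frechet_derivative\<close>; uniqueness of derivatives lets any known \<open>D\<close> take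
  its place.\<close>

lemma Ck_SucI:
  assumes "\<And>x. (\<phi> has_derivative D x) (at x)" "\<And>b. b \<in> Basis \<Longrightarrow> Ck k (\<lambda>x. D x b)"
  shows "Ck (Suc k) \<phi>"
proof -
  have "frechet_derivative \<phi> (at x) = D x" for x
    using frechet_derivative_at[OF assms(1)] by simp
  then show ?thesis
    using assms by (auto simp: differentiable_def)
qed

lemma Ck_SucD:
  assumes "Ck (Suc k) \<phi>"
  shows "(\<phi> has_derivative frechet_derivative \<phi> (at x)) (at x)"
    "b \<in> Basis \<Longrightarrow> Ck k (\<lambda>x. frechet_derivative \<phi> (at x) b)"
  using assms by (auto simp: frechet_derivative_works)

lemma Ck_lower: "Ck (Suc k) \<phi> \<Longrightarrow> Ck k \<phi>"
proof (induction k arbitrary: \<phi>)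
  case 0
  then show ?case
    by (auto simp: continuous_on_eq_continuous_at intro: differentiable_imp_continuous_within)
next
  case (Suc k)
  then show ?case by (metis Ck.simps(2))
qed

lemma Ck_continuous: "Ck k \<phi> \<Longrightarrow> continuous_on UNIV \<phi>"
  by (induction k) (use Ck_lower in \<open>auto dest: Ck_lower\<close>)

lemma Ck_const: "Ck k (\<lambda>x. c)"
  by (induction k arbitrary: c) (simp, rule Ck_SucI[where D = "\<lambda>_ _. 0"], auto)

lemma Ck_add: "Ck k f \<Longrightarrow> Ck k g \<Longrightarrow> Ck k (\<lambda>x. f x + g x)"
proof (induction k arbitrary: f g)
  case (Suc k)
  show ?case
    by (rule Ck_SucI[OF has_derivative_add[OF Ck_SucD(1)[OF Suc.prems(1)] Ck_SucD(1)[OF Suc.prems(2)]]])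
       (intro Suc.IH Ck_SucD Suc.prems)
qed (auto intro: continuous_on_add)

lemma Ck_mult: "Ck k f \<Longrightarrow> Ck k g \<Longrightarrow> Ck k (\<lambda>x. f x * g x)"
proof (induction k arbitrary: f g)
  case (Suc k)
  show ?case
    by (rule Ck_SucI[OF has_derivative_mult[OF Ck_SucD(1)[OF Suc.prems(1)] Ck_SucD(1)[OF Suc.prems(2)]]])
       (intro Ck_add Suc.IH Ck_SucD(2) Suc.prems Ck_lower)
qed (auto intro: continuous_on_mult)

lemma Ck_minus: "Ck k f \<Longrightarrow> Ck k (\<lambda>x. - f x)"
  using Ck_mult[OF Ck_const[of k "-1"]] by simp

lemma Ck_diff: "Ck k f \<Longrightarrow> Ck k g \<Longrightarrow> Ck k (\<lambda>x. f x - g x)"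
  using Ck_add[OF _ Ck_minus] by simp

lemma Ck_sum: "(\<And>i. i \<in> I \<Longrightarrow> Ck k (f i)) \<Longrightarrow> Ck k (\<lambda>x. \<Sum>i\<in>I. f i x)"
  by (induction I rule: infinite_finite_induct) (auto intro: Ck_add Ck_const)

lemma Ck_prod: "(\<And>i. i \<in> I \<Longrightarrow> Ck k (f i)) \<Longrightarrow> Ck k (\<lambda>x. \<Prod>i\<in>I. f i x)"
  by (induction I rule: infinite_finite_induct) (auto intro: Ck_mult Ck_const)

lemma Ck_inner: "Ck k (\<lambda>x. (x - a) \<bullet> c)"
proof (cases k)
  case (Suc j)
  have "((\<lambda>x. (x - a) \<bullet> c) has_derivative (\<lambda>h. h \<bullet> c)) (at x)" for x
    by (auto intro!: derivative_eq_intros)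
  then show ?thesis unfolding Suc by (rule Ck_SucI) (rule Ck_const)
qed (auto intro!: continuous_intros)

lemma norm_sq_eq_sum: "(norm (x::'a::euclidean_space))\<^sup>2 = (\<Sum>b\<in>Basis. (x \<bullet> b) * (x \<bullet> b))"
  by (simp add: power2_norm_eq_inner euclidean_inner[of x x])

lemma Ck_norm_sq: "Ck k (\<lambda>x. (norm (x - a))\<^sup>2)"
  unfolding norm_sq_eq_sum by (intro Ck_sum Ck_mult Ck_inner)

lemma Ck_compose: "Ck k e \<Longrightarrow> Ck k q \<Longrightarrow> Ck k (\<lambda>x. e (q x))" for e :: "real \<Rightarrow> real"
proof (induction k arbitrary: e q)
  case 0
  then show ?case
    by (auto intro!: continuous_on_compose2[of UNIV e _ q])
next
  case (Suc k)
  let ?e = "\<lambda>t. frechet_derivative e (at t) 1"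
  have e: "(e has_derivative (\<lambda>h. h * ?e t)) (at t)" for t
  proof -
    have "frechet_derivative e (at t) = (\<lambda>h. h * ?e t)"
      using linear_frechet_derivative[of e "at t"] Suc.prems(1)
      by (auto simp: fun_eq_iff linear_iff) (metis mult.right_neutral real_scaleR_def)
    then show ?thesis using Ck_SucD(1)[OF Suc.prems(1), of t] by simp
  qed
  have "((\<lambda>x. e (q x)) has_derivative (\<lambda>h. frechet_derivative q (at x) h * ?e (q x))) (at x)" for x
    using diff_chain_at[OF Ck_SucD(1)[OF Suc.prems(2), of x] e[of "q x"]] by (simp add: o_def)
  then show ?case
  proof (rule Ck_SucI)
    fix b :: 'a assume b: "b \<in> Basis"
    have "Ck k (\<lambda>x. ?e (q x))"
      using Suc.IH[of ?e q] Ck_SucD(2)[OF Suc.prems(1), of 1] Ck_lower[OF Suc.prems(2)] by simp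
    then show "Ck k (\<lambda>x. frechet_derivative q (at x) b * ?e (q x))"
      by (rule Ck_mult[OF Ck_SucD(2)[OF Suc.prems(2) b]])
  qed
qed

text \<open>The derivatives of \<open>t \<mapsto> exp (-1/t)\<close> are combinations of these functions.\<close>

definition flat_exp :: "nat \<Rightarrow> real \<Rightarrow> real" where
  "flat_exp m t = (if 0 < t then (1 / t) ^ m * exp (- (1 / t)) else 0)"

lemma flat_exp_tendsto_0: "(flat_exp m \<longlongrightarrow> 0) (at 0)"
proof -
  have "((\<lambda>s::real. s ^ m / exp s) \<longlongrightarrow> 0) at_top" by (rule tendsto_power_div_exp_0)
  from filterlim_compose[OF this filterlim_inverse_at_top_right]
  have "((\<lambda>t. (inverse t) ^ m / exp (inverse t)) \<longlongrightarrow> 0) (at_right (0::real))" by simp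
  moreover have "eventually (\<lambda>t. (inverse t) ^ m / exp (inverse t) = flat_exp m t) (at_right (0::real))"
    using eventually_at_right_less[of 0]
    by eventually_elim (simp add: flat_exp_def exp_minus field_simps)
  ultimately have r: "(flat_exp m \<longlongrightarrow> 0) (at_right 0)"
    by (rule Lim_transform_eventually)
  have "eventually (\<lambda>t. 0 = flat_exp m t) (at_left 0)"
    unfolding eventually_at_filter by (rule always_eventually) (auto simp: flat_exp_def)
  then have l: "(flat_exp m \<longlongrightarrow> 0) (at_left 0)"
    by (rule Lim_transform_eventually[OF tendsto_const])
  show ?thesis using l r by (rule filterlim_split_at)
qed

lemma flat_exp_DERIV:
  "(flat_exp m has_real_derivative flat_exp (m + 2) t - real m * flat_exp (m + 1) t) (at t)"
proof -
  consider "t < 0" | "t = 0" | "0 < t" by linarith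
  then show ?thesis
  proof cases
    case 1
    have "((\<lambda>_. 0) has_real_derivative 0) (at t)" by simp
    moreover have "eventually (\<lambda>s. flat_exp m s = 0) (nhds t)"
      using eventually_nhds_in_open[of "{..<0}" t] 1 by (auto elim!: eventually_mono simp: flat_exp_def)
    ultimately show ?thesis
      using 1 by (subst DERIV_cong_ev[OF refl _ refl, where g = "\<lambda>_. 0"]) (auto simp: flat_exp_def)
  next
    case 2
    \<comment> \<open>The difference quotient at 0 is itself a member of the family, namely
      \<open>flat_exp (m + 1) h\<close>.\<close>
    have "((\<lambda>h. (flat_exp m (0 + h) - flat_exp m 0) / h) \<longlongrightarrow> 0) (at 0)"
    proof (rule Lim_transform_eventually[OF flat_exp_tendsto_0[of "m + 1"]])
      show "\<forall>\<^sub>F h in at 0. flat_exp (m + 1) h = (flat_exp m (0 + h) - flat_exp m 0) / h"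
        by (rule always_eventually) (auto simp: flat_exp_def)
    qed
    then show ?thesis using 2 by (simp add: DERIV_def) (simp add: flat_exp_def)
  next
    case 3
    have "((\<lambda>s. (1 / s) ^ m * exp (- (1 / s))) has_real_derivative
        flat_exp (m + 2) t - real m * flat_exp (m + 1) t) (at t)"
      using 3 by (auto intro!: derivative_eq_intros simp: flat_exp_def)
        (cases m; simp add: field_simps power2_eq_square)
    moreover have "eventually (\<lambda>s. flat_exp m s = (1 / s) ^ m * exp (- (1 / s))) (nhds t)"
      using eventually_nhds_in_open[of "{0<..}" t] 3 by (auto elim!: eventually_mono simp: flat_exp_def)
    ultimately show ?thesis
      using 3 by (subst DERIV_cong_ev[OF refl _ refl, where g = "\<lambda>s. (1 / s) ^ m * exp (- (1 / s))"]) auto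
  qed
qed

text \<open>The derivative of each member is a combination of two others, so a single induction over
  \<open>k\<close> treats all \<open>m\<close> together.\<close>

lemma Ck_flat_exp: "Ck k (flat_exp m)"
proof (induction k arbitrary: m)
  case 0
  show ?case
    using flat_exp_DERIV by (auto intro!: continuous_at_imp_continuous_on DERIV_isCont)
next
  case (Suc k)
  have "(flat_exp m has_derivative (\<lambda>h. (flat_exp (m + 2) t - real m * flat_exp (m + 1) t) * h)) (at t)" for t
    using flat_exp_DERIV[of m t] by (simp add: has_field_derivative_def)
  then show ?case
    by (rule Ck_SucI) (intro Ck_mult Ck_diff Suc.IH Ck_const)
qed

text \<open>The value 1 is approached only at infinity; this is why the cut-offs built from it
  multiply their argument by \<open>n\<close>.\<close>

abbreviation smooth_step :: "real \<Rightarrow> real" where "smooth_step \<equiv> flat_exp 0"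

lemma smooth_step_bounds: "0 \<le> smooth_step t" "smooth_step t \<le> 1"
  by (auto simp: flat_exp_def)

lemma smooth_step_nonpos: "t \<le> 0 \<Longrightarrow> smooth_step t = 0"
  by (simp add: flat_exp_def)

lemma smooth_step_pos: "0 < t \<Longrightarrow> 0 < smooth_step t"
  by (simp add: flat_exp_def)

lemma smooth_step_DERIV: "(smooth_step has_real_derivative flat_exp 2 t) (at t)"
  using flat_exp_DERIV[of 0 t] by (simp add: numeral_2_eq_2)

lemma flat_exp_2_bounds: "0 \<le> flat_exp 2 t" "0 < t \<Longrightarrow> flat_exp 2 t \<le> 1 / t\<^sup>2"
  by (auto simp: flat_exp_def power_one_over divide_simps mult_le_cancel_left1)

lemma smooth_step_tendsto_1: "0 < t \<Longrightarrow> (\<lambda>n. smooth_step (real n * t)) \<longlonglongrightarrow> 1"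
proof -
  assume t: "0 < t"
  have "(\<lambda>n. exp (- (1 / (real n * t)))) \<longlonglongrightarrow> exp (- 0)"
    using t by (intro tendsto_intros tendsto_divide_0[OF tendsto_const] filterlim_at_top_imp_at_infinity
        filterlim_at_top_mult_tendsto_pos[OF tendsto_const] filterlim_real_sequentially
        filterlim_tendsto_pos_mult_at_top) (auto simp: filterlim_real_sequentially)
  moreover have "eventually (\<lambda>n. exp (- (1 / (real n * t))) = smooth_step (real n * t)) sequentially"
    using eventually_gt_at_top[of 0] by eventually_elim (use t in \<open>auto simp: flat_exp_def\<close>)
  ultimately show ?thesis by (simp add: Lim_transform_eventually)
qed

section \<open>Differentiation under the integral sign\<close>

lemma has_derivative_0_outside:
  assumes "closed K" "\<And>y. y \<notin> K \<Longrightarrow> \<phi> y = 0" "x \<notin> K" "(\<phi> has_derivative D) (at x)"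
  shows "D h = 0"
proof -
  have "(\<phi> has_derivative (\<lambda>_. 0)) (at x)"
  proof (rule has_derivative_transform_within_open)
    show "((\<lambda>_. 0) has_derivative (\<lambda>_. 0)) (at x)" by simp
    show "open (- K)" "x \<in> - K" using assms by auto
    show "\<And>y. y \<in> - K \<Longrightarrow> 0 = \<phi> y" using assms by auto
  qed
  from has_derivative_unique[OF assms(4) this] show ?thesis by simp
qed

text \<open>\<open>v\<close> is only bounded and measurable, so every derivative falls on
  \<open>\<phi>\<close>. The difference quotients are dominated by means of a Lipschitz bound for
  \<open>\<phi>\<close> in direction \<open>d\<close> and the compact support.\<close>

lemma DERIV_integral_shift:
  fixes v \<phi> :: "'a::euclidean_space \<Rightarrow> real"
  assumes v: "v \<in> borel_measurable lebesgue" "\<And>x. \<bar>v x\<bar> \<le> B"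
    and D: "\<And>x. (\<phi> has_derivative D x) (at x)" and cont: "continuous_on UNIV (\<lambda>x. D x d)"
    and K: "compact K" "\<And>x. x \<notin> K \<Longrightarrow> \<phi> x = 0"
  shows "((\<lambda>t. LINT x|lebesgue. v x * \<phi> (x + t *\<^sub>R d)) has_real_derivative
    (LINT x|lebesgue. v x * D (x + t *\<^sub>R d) d)) (at t)"
proof -
  have c\<phi>: "continuous_on UNIV \<phi>"
    using D by (auto simp: continuous_on_eq_continuous_at intro: has_derivative_continuous)
  have D0: "D x d = 0" if "x \<notin> K" for x
    using has_derivative_0_outside[OF compact_imp_closed[OF K(1)] K(2) that D[of x]] .
  have bnd: "\<exists>C. \<forall>x. \<bar>f x\<bar> \<le> C" if f: "continuous_on UNIV f" "\<And>x. x \<notin> K \<Longrightarrow> f x = 0" for f :: "'a \<Rightarrow> real"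
  proof -
    have "bounded (f ` K)"
      using f(1) by (intro compact_imp_bounded compact_continuous_image K) (auto intro: continuous_on_subset)
    then obtain C where "\<forall>x\<in>K. \<bar>f x\<bar> \<le> C" by (auto simp: bounded_iff)
    then have "\<bar>f x\<bar> \<le> max C 0" for x by (cases "x \<in> K") (auto simp: f(2) intro: order_trans max.cobounded1)
    then show ?thesis by blast
  qed
  obtain C where C: "\<And>x. \<bar>D x d\<bar> \<le> C" using bnd[OF cont D0] by blast
  obtain C' where C': "\<And>x. \<bar>\<phi> x\<bar> \<le> C'" using bnd[OF c\<phi> K(2)] by blast
  have B0: "0 \<le> B" using v(2)[of 0] by linarith
  obtain \<rho> where "\<forall>x\<in>K. norm x \<le> \<rho>" using compact_imp_bounded[OF K(1)] by (auto simp: bounded_iff)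
  then have \<rho>: "K \<subseteq> cball 0 \<rho>" by auto
  have meas: "(\<lambda>x. f (x + s *\<^sub>R d)) \<in> borel_measurable lebesgue" if "continuous_on UNIV f" for f :: "'a \<Rightarrow> real" and s
  proof -
    have "continuous_on UNIV (\<lambda>x. f (x + s *\<^sub>R d))"
      by (intro continuous_on_compose2[OF that]) (auto intro!: continuous_intros)
    from borel_measurable_continuous_onI[OF this] show ?thesis
      by (intro measurable_completion) simp
  qed
  have lip: "\<bar>\<phi> (x + s *\<^sub>R d) - \<phi> (x + t *\<^sub>R d)\<bar> \<le> C * \<bar>s - t\<bar>" for x s
  proof -
    have "norm (\<phi> (x + s *\<^sub>R d) - \<phi> (x + t *\<^sub>R d)) \<le> C * norm (s - t)"
    proof (rule field_differentiable_bound[of UNIV "\<lambda>\<tau>. \<phi> (x + \<tau> *\<^sub>R d)" "\<lambda>\<tau>. D (x + \<tau> *\<^sub>R d) d"])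
      fix \<tau> :: real
      have "((\<lambda>\<tau>. x + \<tau> *\<^sub>R d) has_derivative (\<lambda>h. h *\<^sub>R d)) (at \<tau>)"
        by (auto intro!: derivative_eq_intros)
      from diff_chain_at[OF this D]
      have "((\<lambda>\<tau>. \<phi> (x + \<tau> *\<^sub>R d)) has_derivative (\<lambda>h. D (x + \<tau> *\<^sub>R d) (h *\<^sub>R d))) (at \<tau>)"
        by (simp add: o_def)
      also have "(\<lambda>h. D (x + \<tau> *\<^sub>R d) (h *\<^sub>R d)) = (*) (D (x + \<tau> *\<^sub>R d) d)"
        using linear_scale[OF has_derivative_linear[OF D[of "x + \<tau> *\<^sub>R d"]]] by (auto simp: mult.commute)
      finally show "((\<lambda>\<tau>. \<phi> (x + \<tau> *\<^sub>R d)) has_field_derivative D (x + \<tau> *\<^sub>R d) d) (at \<tau> within UNIV)"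
        by (simp add: has_field_derivative_def)
      show "norm (D (x + \<tau> *\<^sub>R d) d) \<le> C" using C by simp
    qed auto
    then show ?thesis by simp
  qed
  have int: "integrable lebesgue (\<lambda>x. v x * \<phi> (x + s *\<^sub>R d))" for s
  proof (rule Bochner_Integration.integrable_bound)
    show "integrable lebesgue (\<lambda>x. B * C' * indicator (cball 0 (\<rho> + \<bar>s\<bar> * norm d)) x :: real)"
      by (intro integrable_mult_right) (simp flip: lmeasurable_iff_integrable)
    show "(\<lambda>x. v x * \<phi> (x + s *\<^sub>R d)) \<in> borel_measurable lebesgue"
      by (intro borel_measurable_times v meas c\<phi>)
    have "norm (v x * \<phi> (x + s *\<^sub>R d)) \<le> norm (B * C' * indicator (cball 0 (\<rho> + \<bar>s\<bar> * norm d)) x :: real)" for x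
    proof (cases "x + s *\<^sub>R d \<in> K")
      case True
      then have "norm (x + s *\<^sub>R d) \<le> \<rho>" using \<rho> by auto
      then have "norm x \<le> \<rho> + \<bar>s\<bar> * norm d" using norm_triangle_ineq4[of "x + s *\<^sub>R d" "s *\<^sub>R d"] by simp
      moreover have "0 \<le> C'" using C'[of 0] by linarith
      ultimately show ?thesis using mult_mono[OF v(2) C' B0 abs_ge_zero] B0 by (simp add: abs_mult)
    qed (simp add: K(2))
    then show "AE x in lebesgue. norm (v x * \<phi> (x + s *\<^sub>R d)) \<le> norm (B * C' * indicator (cball 0 (\<rho> + \<bar>s\<bar> * norm d)) x :: real)"
      by simp
  qed
  show ?thesis
    unfolding DERIV_def tendsto_at_iff_sequentially
  proof (intro allI impI)
    fix X :: "nat \<Rightarrow> real"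
    assume X0: "\<forall>i. X i \<in> UNIV - {0}" and X: "X \<longlonglongrightarrow> 0"
    obtain M where M: "\<And>i. \<bar>X i\<bar> \<le> M" using convergent_imp_Bseq[of X] X by (auto simp: convergent_def Bseq_def)
    let ?q = "\<lambda>i x. v x * ((\<phi> (x + (t + X i) *\<^sub>R d) - \<phi> (x + t *\<^sub>R d)) / X i)"
    \<comment> \<open>A ball of this radius contains the supports of all the shifted functions,
      since the increments \<open>X i\<close> are bounded by \<open>M\<close>.\<close>
    let ?r = "\<rho> + (\<bar>t\<bar> + M) * norm d"
    have "(\<lambda>i. LINT x|lebesgue. ?q i x) \<longlonglongrightarrow> (LINT x|lebesgue. v x * D (x + t *\<^sub>R d) d)"
    proof (rule integral_dominated_convergence)
      show "integrable lebesgue (\<lambda>x. B * C * indicator (cball 0 ?r) x :: real)"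
        by (intro integrable_mult_right) (simp flip: lmeasurable_iff_integrable)
      show "(\<lambda>x. v x * D (x + t *\<^sub>R d) d) \<in> borel_measurable lebesgue"
        by (intro borel_measurable_times v meas[of "\<lambda>y. D y d"] cont)
      show "\<And>i. ?q i \<in> borel_measurable lebesgue"
        by (intro borel_measurable_times borel_measurable_divide borel_measurable_diff v meas c\<phi> borel_measurable_const)
      show "AE x in lebesgue. (\<lambda>i. ?q i x) \<longlonglongrightarrow> v x * D (x + t *\<^sub>R d) d"
      proof (rule AE_I2)
        fix x
        have "((\<lambda>\<tau>. x + \<tau> *\<^sub>R d) has_derivative (\<lambda>h. h *\<^sub>R d)) (at t)"
          by (auto intro!: derivative_eq_intros)
        from diff_chain_at[OF this D]
        have "((\<lambda>\<tau>. \<phi> (x + \<tau> *\<^sub>R d)) has_derivative (\<lambda>h. D (x + t *\<^sub>R d) (h *\<^sub>R d))) (at t)"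
          by (simp add: o_def)
        also have "(\<lambda>h. D (x + t *\<^sub>R d) (h *\<^sub>R d)) = (*) (D (x + t *\<^sub>R d) d)"
          using linear_scale[OF has_derivative_linear[OF D[of "x + t *\<^sub>R d"]]] by (auto simp: mult.commute)
        finally have "((\<lambda>\<tau>. \<phi> (x + \<tau> *\<^sub>R d)) has_real_derivative D (x + t *\<^sub>R d) d) (at t)"
          by (simp add: has_field_derivative_def)
        then have "((\<lambda>h. (\<phi> (x + (t + h) *\<^sub>R d) - \<phi> (x + t *\<^sub>R d)) / h) \<circ> X) \<longlonglongrightarrow> D (x + t *\<^sub>R d) d"
          using X0 X unfolding DERIV_def tendsto_at_iff_sequentially by blast
        then show "(\<lambda>i. ?q i x) \<longlonglongrightarrow> v x * D (x + t *\<^sub>R d) d"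
          by (intro tendsto_mult tendsto_const) (simp add: o_def)
      qed
      fix i
      have "norm (?q i x) \<le> B * C * indicator (cball 0 ?r) x" for x
      proof (cases "x \<in> cball 0 ?r")
        case True
        have "\<bar>(\<phi> (x + (t + X i) *\<^sub>R d) - \<phi> (x + t *\<^sub>R d)) / X i\<bar> \<le> C"
          using lip[of x "t + X i"] X0 by (simp add: field_simps)
        then have "\<bar>v x\<bar> * \<bar>(\<phi> (x + (t + X i) *\<^sub>R d) - \<phi> (x + t *\<^sub>R d)) / X i\<bar> \<le> B * C"
          by (intro mult_mono v(2) B0) auto
        then show ?thesis using True by (simp add: abs_mult)
      next
        case False
        have out: "x + s *\<^sub>R d \<notin> K" if "\<bar>s\<bar> \<le> \<bar>t\<bar> + M" for s
        proof
          assume "x + s *\<^sub>R d \<in> K"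
          then have "norm (x + s *\<^sub>R d) \<le> \<rho>" using \<rho> by auto
          then have "norm x \<le> \<rho> + \<bar>s\<bar> * norm d" using norm_triangle_ineq4[of "x + s *\<^sub>R d" "s *\<^sub>R d"] by simp
          also have "\<dots> \<le> ?r" using that by (intro add_left_mono mult_right_mono) auto
          finally show False using False by simp
        qed
        have "\<bar>t + X i\<bar> \<le> \<bar>t\<bar> + M" "\<bar>t\<bar> \<le> \<bar>t\<bar> + M" using M[of i] by linarith+
        then show ?thesis using False K(2)[OF out] by simp
      qed
      then show "AE x in lebesgue. norm (?q i x) \<le> B * C * indicator (cball 0 ?r) x" by simp
    qed
    moreover have "(LINT x|lebesgue. ?q i x) =
        ((LINT x|lebesgue. v x * \<phi> (x + (t + X i) *\<^sub>R d)) - (LINT x|lebesgue. v x * \<phi> (x + t *\<^sub>R d))) / X i" for i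
    proof -
      have "(LINT x|lebesgue. ?q i x) = (LINT x|lebesgue. (v x * \<phi> (x + (t + X i) *\<^sub>R d) - v x * \<phi> (x + t *\<^sub>R d)) / X i)"
        by (intro Bochner_Integration.integral_cong) (auto simp: algebra_simps diff_divide_distrib)
      then show ?thesis by (simp only: integral_divide_zero Bochner_Integration.integral_diff[OF int int])
    qed
    ultimately show "((\<lambda>h. ((LINT x|lebesgue. v x * \<phi> (x + (t + h) *\<^sub>R d)) - (LINT x|lebesgue. v x * \<phi> (x + t *\<^sub>R d))) / h) \<circ> X)
        \<longlonglongrightarrow> (LINT x|lebesgue. v x * D (x + t *\<^sub>R d) d)"
      by (simp only: o_def)
  qed
qed

text \<open>The integral of a shifted function does not depend on the shift; its derivative at shift
  0, computed by the previous lemma with \<open>v = 1\<close>, is therefore 0.\<close>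

lemma integral_derivative_compact_support:
  fixes \<phi> :: "'a::euclidean_space \<Rightarrow> real"
  assumes D: "\<And>x. (\<phi> has_derivative D x) (at x)" and cont: "continuous_on UNIV (\<lambda>x. D x d)"
    and K: "compact K" "\<And>x. x \<notin> K \<Longrightarrow> \<phi> x = 0"
  shows "(LINT x|lebesgue. D x d) = 0"
proof -
  have c\<phi>: "continuous_on UNIV \<phi>"
    using D by (auto simp: continuous_on_eq_continuous_at intro: has_derivative_continuous)
  have [measurable]: "\<phi> \<in> borel_measurable borel" by (rule borel_measurable_continuous_onI[OF c\<phi>])
  have "(LINT x|lebesgue. 1 * \<phi> (x + t *\<^sub>R d)) = (LINT x|lborel. \<phi> x)" for t
  proof -
    have "(LINT x|lebesgue. 1 * \<phi> (x + t *\<^sub>R d)) = (LINT x|lborel. \<phi> (t *\<^sub>R d + x))"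
      by (simp add: integral_completion add.commute)
    also have "\<dots> = (LINT x|distr lborel borel ((+) (t *\<^sub>R d)). \<phi> x)"
      by (simp add: integral_distr)
    also have "distr lborel borel ((+) (t *\<^sub>R d)) = lborel"
      using lborel_affine[of 1 "t *\<^sub>R d"] by (simp add: density_1)
    finally show ?thesis .
  qed
  then have "((\<lambda>t. LINT x|lborel. \<phi> x) has_real_derivative (LINT x|lebesgue. 1 * D (x + 0 *\<^sub>R d) d)) (at 0)"
    using DERIV_integral_shift[of "\<lambda>_. 1" 1, OF _ _ D cont K, of 0] by simp
  then have "(LINT x|lebesgue. 1 * D (x + 0 *\<^sub>R d) d) = 0"
    using DERIV_unique[OF _ DERIV_const] by blast
  then show ?thesis by simp
qed

section \<open>Vanishing integrals over boxes\<close>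

lemma Int_stable_boxes: "Int_stable (range (\<lambda>(a, b). box a b :: 'a::euclidean_space set))"
proof (rule Int_stableI)
  fix A B assume "A \<in> range (\<lambda>(a, b). box a b :: 'a set)" "B \<in> range (\<lambda>(a, b). box a b :: 'a set)"
  then obtain a b c d where "A = box a b" "B = box c d" by auto
  moreover obtain p q where "box a b \<inter> box c d = box p q"
    unfolding box_Int_box by blast
  ultimately show "A \<inter> B \<in> range (\<lambda>(a, b). box a b)"
    by (intro image_eqI[of _ _ "(p, q)"]) auto
qed

text \<open>The positive and the negative part of \<open>f\<close> are densities of two finite
  measures that agree on the intersection-stable generator of boxes, hence on all Borel sets; then
  test with the set where \<open>f > 0\<close>. Only \<open>f\<close> has to be integrable, so the
  lemma also serves for a Hausdorff measure on the whole space.\<close>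

lemma AE_zero_of_box_integrals:
  fixes f :: "'a::euclidean_space \<Rightarrow> real"
  assumes sets: "sets M = sets borel" and f: "integrable M f"
    and zero: "\<And>a b. (\<integral>x. indicator (box a b) x * f x \<partial>M) = 0"
  shows "AE x in M. f x = 0"
proof -
  note [measurable_cong] = sets
  have [measurable]: "f \<in> borel_measurable M" using f by auto
  define P N where "P = density M (\<lambda>x. ennreal (f x))" and "N = density M (\<lambda>x. ennreal (- f x))"
  have fin: "(\<integral>\<^sup>+x. ennreal (f x) * indicator A x \<partial>M) < \<infinity>" "(\<integral>\<^sup>+x. ennreal (- f x) * indicator A x \<partial>M) < \<infinity>" for A
  proof -
    have "(\<integral>\<^sup>+x. ennreal (norm (f x)) \<partial>M) < \<infinity>" using f by (simp add: integrable_iff_bounded)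
    moreover have "(\<integral>\<^sup>+x. ennreal (f x) * indicator A x \<partial>M) \<le> (\<integral>\<^sup>+x. ennreal (norm (f x)) \<partial>M)"
      "(\<integral>\<^sup>+x. ennreal (- f x) * indicator A x \<partial>M) \<le> (\<integral>\<^sup>+x. ennreal (norm (f x)) \<partial>M)"
      by (intro nn_integral_mono; auto simp: indicator_def ennreal_leI)+
    ultimately show "(\<integral>\<^sup>+x. ennreal (f x) * indicator A x \<partial>M) < \<infinity>"
      "(\<integral>\<^sup>+x. ennreal (- f x) * indicator A x \<partial>M) < \<infinity>" by (auto intro: le_less_trans)
  qed
  have intA: "integrable M (\<lambda>x. indicator A x * f x)" if "A \<in> sets borel" for A
    using that integrable_mult_indicator[of A M f] f sets by simp
  have split: "(\<integral>x. indicator A x * f x \<partial>M) = enn2real (emeasure P A) - enn2real (emeasure N A)"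
    if A: "A \<in> sets borel" for A
  proof -
    have "(\<integral>x. indicator A x * f x \<partial>M)
        = enn2real (\<integral>\<^sup>+x. ennreal (indicator A x * f x) \<partial>M) - enn2real (\<integral>\<^sup>+x. ennreal (- (indicator A x * f x)) \<partial>M)"
      using real_lebesgue_integral_def[OF intA[OF A]] by simp
    also have "(\<integral>\<^sup>+x. ennreal (indicator A x * f x) \<partial>M) = emeasure P A"
      unfolding P_def using A sets by (subst emeasure_density) (auto intro!: nn_integral_cong simp: indicator_def)
    also have "(\<integral>\<^sup>+x. ennreal (- (indicator A x * f x)) \<partial>M) = emeasure N A"
      unfolding N_def using A sets by (subst emeasure_density) (auto intro!: nn_integral_cong simp: indicator_def)
    finally show ?thesis .
  qed
  have finPN: "emeasure P A < \<infinity>" "emeasure N A < \<infinity>" if "A \<in> sets borel" for A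
    using that sets fin[of A] by (simp_all add: P_def N_def emeasure_density)
  have "P = N"
  proof (rule measure_eqI_generator_eq[OF Int_stable_boxes])
    show "range (\<lambda>(a, b). box a b :: 'a set) \<subseteq> Pow UNIV" by simp
    show "emeasure P X = emeasure N X" if "X \<in> range (\<lambda>(a, b). box a b)" for X
    proof -
      obtain a b where X: "X = box a b" using \<open>X \<in> _\<close> by auto
      have "enn2real (emeasure P X) = enn2real (emeasure N X)"
        using split[of X] zero[of a b] X by simp
      then show ?thesis using finPN[of X] X by (metis borel_open ennreal_enn2real infinity_ennreal_def open_box)
    qed
    have "sets M = sigma_sets UNIV (range (\<lambda>(a, b). box a b :: 'a set))"
      unfolding sets by (subst borel_eq_box) simp
    then show "sets P = sigma_sets UNIV (range (\<lambda>(a, b). box a b :: 'a set))"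
      "sets N = sigma_sets UNIV (range (\<lambda>(a, b). box a b :: 'a set))" by (simp_all add: P_def N_def)
    let ?A = "\<lambda>n::nat. box (- (real n *\<^sub>R One)) (real n *\<^sub>R One) :: 'a set"
    show "range ?A \<subseteq> range (\<lambda>(a, b). box a b)" by auto
    show "(\<Union>i. ?A i) = UNIV" by (rule UN_box_eq_UNIV)
    show "emeasure P (?A i) \<noteq> \<infinity>" for i using finPN(1)[of "?A i"] by simp
  qed
  then have zA: "(\<integral>x. indicator A x * f x \<partial>M) = 0" if "A \<in> sets borel" for A
    using split[OF that] by simp
  define A where "A = {x. 0 < f x}"
  have fb: "f \<in> borel_measurable borel" using f sets by (metis borel_measurable_integrable measurable_cong_sets)
  have A: "A \<in> sets borel" "- A \<in> sets borel" using fb unfolding A_def by auto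
  have "AE x in M. indicator A x * f x = 0"
    using integral_nonneg_eq_0_iff_AE[OF intA[OF A(1)]] zA[OF A(1)] by (auto simp: A_def indicator_def)
  moreover have "AE x in M. indicator (- A) x * - f x = 0"
  proof -
    have "integrable M (\<lambda>x. indicator (- A) x * - f x)" using intA[OF A(2)] by simp
    moreover have "(\<integral>x. indicator (- A) x * - f x \<partial>M) = 0" using zA[OF A(2)] by simp
    ultimately show ?thesis
      by (subst (asm) integral_nonneg_eq_0_iff_AE) (auto simp: A_def indicator_def)
  qed
  ultimately show ?thesis by eventually_elim (auto simp: indicator_def split: if_splits)
qed

text \<open>Reduces to the Borel case through a Borel function that agrees with \<open>f\<close>
  almost everywhere.\<close>

lemma AE_lebesgue_zero_of_box_integrals:
  fixes f :: "'a::euclidean_space \<Rightarrow> real"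
  assumes f: "integrable lebesgue f" and zero: "\<And>a b. (\<integral>x. indicator (box a b) x * f x \<partial>lebesgue) = 0"
  shows "AE x in lebesgue. f x = 0"
proof -
  obtain g where g: "g \<in> borel_measurable lborel" "AE x in lborel. f x = g x"
    using completion_ex_borel_measurable_real[of f lborel] f by auto
  have ae: "AE x in lebesgue. f x = g x" using g(2) by (rule AE_completion)
  have gm: "g \<in> borel_measurable lebesgue" using g(1) by (rule measurable_completion)
  have "integrable lebesgue g"
    using integrable_cong_AE_imp[OF f gm] ae by (auto elim: eventually_mono)
  then have gi: "integrable lborel g" using g(1) by (simp add: integrable_completion)
  have "AE x in lborel. g x = 0"
  proof (rule AE_zero_of_box_integrals[OF sets_lborel gi])
    fix a b :: 'a
    have "(\<integral>x. indicator (box a b) x * g x \<partial>lborel) = (\<integral>x. indicator (box a b) x * g x \<partial>lebesgue)"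
      using g(1) by (intro integral_completion[symmetric]) simp
    also have "\<dots> = (\<integral>x. indicator (box a b) x * f x \<partial>lebesgue)"
      using ae gm f by (intro integral_cong_AE borel_measurable_times borel_measurable_indicator) (auto elim: eventually_mono)
    finally show "(\<integral>x. indicator (box a b) x * g x \<partial>lborel) = 0" using zero by simp
  qed
  then have "AE x in lebesgue. g x = 0" by (rule AE_completion)
  with ae show ?thesis by eventually_elim simp
qed

text \<open>A smooth stand-in for the indicator of the open box, reached pointwise as
  \<open>n\<close> tends to infinity; each coordinate contributes one factor per face.\<close>

definition box_bump :: "'a::euclidean_space \<Rightarrow> 'a \<Rightarrow> nat \<Rightarrow> 'a \<Rightarrow> real" where
  "box_bump a b n x = (\<Prod>i\<in>Basis. smooth_step (real n * ((x - a) \<bullet> i)) * smooth_step (real n * - ((x - b) \<bullet> i)))"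

lemma Ck_box_bump: "Ck k (box_bump a b n)"
  unfolding box_bump_def by (intro Ck_prod Ck_mult Ck_compose[OF Ck_flat_exp] Ck_const Ck_inner Ck_minus)

lemma box_bump_bounds: "0 \<le> box_bump a b n x" "box_bump a b n x \<le> 1"
  unfolding box_bump_def
  by (auto intro!: prod_nonneg prod_le_1 mult_le_one smooth_step_bounds mult_nonneg_nonneg)

lemma box_bump_outside:
  assumes "x \<notin> box a b"
  shows "box_bump a b n x = 0"
proof -
  obtain i where i: "i \<in> Basis" "x \<bullet> i \<le> a \<bullet> i \<or> b \<bullet> i \<le> x \<bullet> i"
    using assms by (auto simp: mem_box not_less)
  then have "smooth_step (real n * ((x - a) \<bullet> i)) * smooth_step (real n * - ((x - b) \<bullet> i)) = 0"
    by (auto simp: smooth_step_nonpos inner_diff_left mult_nonneg_nonpos mult_nonneg_nonneg)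
  then show ?thesis unfolding box_bump_def using i(1) by (intro prod_zero) auto
qed

lemma box_bump_tendsto: "(\<lambda>n. box_bump a b n x) \<longlonglongrightarrow> indicator (box a b) x"
proof (cases "x \<in> box a b")
  case True
  have "(\<lambda>n. box_bump a b n x) \<longlonglongrightarrow> (\<Prod>i\<in>(Basis::'a set). 1)"
    unfolding box_bump_def
  proof (rule tendsto_prod)
    fix i :: 'a assume "i \<in> Basis"
    then have "0 < (x - a) \<bullet> i" "0 < - ((x - b) \<bullet> i)" using True by (auto simp: mem_box inner_diff_left)
    from tendsto_mult[OF this[THEN smooth_step_tendsto_1]]
    show "(\<lambda>n. smooth_step (real n * ((x - a) \<bullet> i)) * smooth_step (real n * - ((x - b) \<bullet> i))) \<longlonglongrightarrow> 1"
      by simp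
  qed
  then show ?thesis using True by simp
qed (simp add: box_bump_outside)

section \<open>Weak gradients\<close>

lemma test_functionsD:
  assumes "\<phi> \<in> test_functions \<Omega>"
  obtains K where "compact K" "K \<subseteq> \<Omega>" "\<And>x. x \<notin> K \<Longrightarrow> \<phi> x = 0"
    "\<And>x b. x \<notin> K \<Longrightarrow> frechet_derivative \<phi> (at x) b = 0"
    "\<And>x. (\<phi> has_derivative frechet_derivative \<phi> (at x)) (at x)"
    "continuous_on UNIV \<phi>" "\<And>b. b \<in> Basis \<Longrightarrow> continuous_on UNIV (\<lambda>x. frechet_derivative \<phi> (at x) b)"
proof -
  obtain K where K: "compact K" "K \<subseteq> \<Omega>" "\<And>x. x \<notin> K \<Longrightarrow> \<phi> x = 0" and C: "\<And>k. Ck k \<phi>"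
    using assms by (auto simp: test_functions_def)
  have D: "\<And>x. (\<phi> has_derivative frechet_derivative \<phi> (at x)) (at x)"
    using Ck_SucD(1)[OF C[of "Suc 0"]] .
  show ?thesis
  proof (rule that[OF K _ D Ck_continuous[OF C[of 0]]])
    show "frechet_derivative \<phi> (at x) b = 0" if "x \<notin> K" for x b
      by (rule has_derivative_0_outside[OF compact_imp_closed[OF K(1)] K(3) that D])
    show "continuous_on UNIV (\<lambda>x. frechet_derivative \<phi> (at x) b)" if "b \<in> Basis" for b
      using Ck_SucD(2)[OF C[of "Suc 0"] that] by simp
  qed
qed

text \<open>A weak gradient is only locally integrable; the compact support of the second factor
  makes up for this.\<close>

lemma integrable_lebesgue_on_mult:
  fixes v \<psi> :: "'a::euclidean_space \<Rightarrow> real"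
  assumes v: "integrable (lebesgue_on K) v" and K: "compact K" "K \<subseteq> \<Omega>" and \<Omega>: "\<Omega> \<in> sets lebesgue"
    and \<psi>: "continuous_on UNIV \<psi>" "\<And>x. x \<notin> K \<Longrightarrow> \<psi> x = 0"
  shows "integrable (lebesgue_on \<Omega>) (\<lambda>x. v x * \<psi> x)"
proof -
  have Km: "K \<in> sets lebesgue" using K(1) by (simp add: borel_compact)
  have "bounded (\<psi> ` K)"
    using \<psi>(1) by (intro compact_imp_bounded compact_continuous_image K) (auto intro: continuous_on_subset)
  then obtain C where C: "\<forall>x\<in>K. \<bar>\<psi> x\<bar> \<le> C" by (auto simp: bounded_iff)
  have i: "integrable lebesgue (\<lambda>x. indicator K x * v x)"
    using v Km by (simp add: integrable_restrict_space)
  have "integrable lebesgue (\<lambda>x. indicator K x * v x * \<psi> x)"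
  proof (rule Bochner_Integration.integrable_bound)
    show "integrable lebesgue (\<lambda>x. C * (indicator K x * v x))" using i by simp
    have "\<psi> \<in> borel_measurable lebesgue"
      using borel_measurable_continuous_onI[OF \<psi>(1)] by (intro measurable_completion) simp
    then show "(\<lambda>x. indicator K x * v x * \<psi> x) \<in> borel_measurable lebesgue" using i by auto
    have "norm (indicator K x * v x * \<psi> x) \<le> norm (C * (indicator K x * v x))" for x
    proof (cases "x \<in> K")
      case True
      then have "\<bar>v x\<bar> * \<bar>\<psi> x\<bar> \<le> \<bar>v x\<bar> * \<bar>C\<bar>" using C by (intro mult_left_mono) force+
      then show ?thesis using True by (simp add: abs_mult mult.commute)
    qed simp
    then show "AE x in lebesgue. norm (indicator K x * v x * \<psi> x) \<le> norm (C * (indicator K x * v x))" by simp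
  qed
  moreover have "indicator K x * v x * \<psi> x = indicator \<Omega> x *\<^sub>R (v x * \<psi> x)" for x
    using K(2) \<psi>(2) by (auto simp: indicator_def)
  ultimately show ?thesis using \<Omega> by (simp add: integrable_restrict_space)
qed

lemma is_weak_gradient_integrable:
  assumes w: "is_weak_gradient \<Omega> v G" and \<phi>: "\<phi> \<in> test_functions \<Omega>" and b: "b \<in> Basis" and \<Omega>: "\<Omega> \<in> sets lebesgue"
  shows "integrable (lebesgue_on \<Omega>) (\<lambda>x. v x * frechet_derivative \<phi> (at x) b)"
    "integrable (lebesgue_on \<Omega>) (\<lambda>x. (G x \<bullet> b) * \<phi> x)"
proof -
  obtain K where K: "compact K" "K \<subseteq> \<Omega>" "\<And>x. x \<notin> K \<Longrightarrow> \<phi> x = 0"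
    "\<And>x b. x \<notin> K \<Longrightarrow> frechet_derivative \<phi> (at x) b = 0"
    "continuous_on UNIV \<phi>" "\<And>b. b \<in> Basis \<Longrightarrow> continuous_on UNIV (\<lambda>x. frechet_derivative \<phi> (at x) b)"
    using test_functionsD[OF \<phi>] by metis
  have i: "integrable (lebesgue_on K) v" "integrable (lebesgue_on K) G"
    using w K(1,2) by (auto simp: is_weak_gradient_def)
  show "integrable (lebesgue_on \<Omega>) (\<lambda>x. v x * frechet_derivative \<phi> (at x) b)"
    by (rule integrable_lebesgue_on_mult[OF i(1) K(1,2) \<Omega> K(6)[OF b] K(4)])
  show "integrable (lebesgue_on \<Omega>) (\<lambda>x. (G x \<bullet> b) * \<phi> x)"
    by (rule integrable_lebesgue_on_mult[OF integrable_inner_left[OF i(2)] K(1,2) \<Omega> K(5,3)])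
qed

lemma is_weak_gradient_add_scaled:
  assumes v: "is_weak_gradient \<Omega> v G" and w: "is_weak_gradient \<Omega> w H" and \<Omega>: "\<Omega> \<in> sets lebesgue"
  shows "is_weak_gradient \<Omega> (\<lambda>x. v x + c * w x) (\<lambda>x. G x + c *\<^sub>R H x)"
  unfolding is_weak_gradient_def
proof (intro conjI allI impI ballI)
  fix K assume "compact K \<and> K \<subseteq> \<Omega>"
  then show "integrable (lebesgue_on K) (\<lambda>x. v x + c * w x)" "integrable (lebesgue_on K) (\<lambda>x. G x + c *\<^sub>R H x)"
    using v w by (auto simp: is_weak_gradient_def)
next
  fix \<phi> and b :: 'a assume \<phi>: "\<phi> \<in> test_functions \<Omega>" and b: "b \<in> Basis"
  note i = is_weak_gradient_integrable[OF v \<phi> b \<Omega>] is_weak_gradient_integrable[OF w \<phi> b \<Omega>]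
  have "(LINT x|lebesgue_on \<Omega>. (v x + c * w x) * frechet_derivative \<phi> (at x) b)
      = (LINT x|lebesgue_on \<Omega>. v x * frechet_derivative \<phi> (at x) b + c * (w x * frechet_derivative \<phi> (at x) b))"
    by (intro Bochner_Integration.integral_cong) (auto simp: algebra_simps)
  also have "\<dots> = (LINT x|lebesgue_on \<Omega>. v x * frechet_derivative \<phi> (at x) b)
      + c * (LINT x|lebesgue_on \<Omega>. w x * frechet_derivative \<phi> (at x) b)"
    using i by simp
  also have "\<dots> = - ((LINT x|lebesgue_on \<Omega>. (G x \<bullet> b) * \<phi> x) + c * (LINT x|lebesgue_on \<Omega>. (H x \<bullet> b) * \<phi> x))"
    using v w \<phi> b by (simp add: is_weak_gradient_def)
  also have "(LINT x|lebesgue_on \<Omega>. (G x \<bullet> b) * \<phi> x) + c * (LINT x|lebesgue_on \<Omega>. (H x \<bullet> b) * \<phi> x)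
      = (LINT x|lebesgue_on \<Omega>. (G x \<bullet> b) * \<phi> x + c * ((H x \<bullet> b) * \<phi> x))"
    using i by simp
  also have "\<dots> = (LINT x|lebesgue_on \<Omega>. ((G x + c *\<^sub>R H x) \<bullet> b) * \<phi> x)"
    by (intro Bochner_Integration.integral_cong) (auto simp: algebra_simps)
  finally show "(LINT x|lebesgue_on \<Omega>. (v x + c * w x) * frechet_derivative \<phi> (at x) b)
      = - (LINT x|lebesgue_on \<Omega>. ((G x + c *\<^sub>R H x) \<bullet> b) * \<phi> x)" .
qed

text \<open>The fundamental lemma of the calculus of variations. Inside a closed box contained in
  \<open>\<Omega>\<close>, testing with \<open>box_bump\<close> makes all integrals of the
  components over smaller boxes vanish; countably many such boxes exhaust
  \<open>\<Omega>\<close>.\<close>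

lemma is_weak_gradient_zero_AE:
  assumes w: "is_weak_gradient \<Omega> (\<lambda>x. 0) G" and \<Omega>: "open \<Omega>"
  shows "AE x in lebesgue_on \<Omega>. G x = 0"
proof -
  have \<Omega>m: "\<Omega> \<in> sets lebesgue" using \<Omega> by simp
  obtain \<D> where \<D>: "countable \<D>" "\<D> \<subseteq> Pow \<Omega>" "\<And>X. X \<in> \<D> \<Longrightarrow> \<exists>c d. X = cbox c d" "\<Union>\<D> = \<Omega>"
    using open_countable_Union_open_cbox[OF \<Omega>] by metis
  have ae: "AE x in lebesgue. x \<in> cbox c d \<longrightarrow> G x \<bullet> i = 0" if sub: "cbox c d \<subseteq> \<Omega>" and i: "i \<in> Basis" for c d i
  proof -
    define f where "f x = indicator (box c d) x * (G x \<bullet> i)" for x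
    have "integrable (lebesgue_on (cbox c d)) G" using w sub by (auto simp: is_weak_gradient_def)
    then have "integrable (lebesgue_on (cbox c d)) (\<lambda>x. G x \<bullet> i)" by (rule integrable_inner_left)
    then have ic: "integrable lebesgue (\<lambda>x. indicator (cbox c d) x * (G x \<bullet> i))"
      by (simp add: integrable_restrict_space)
    have f: "integrable lebesgue f"
    proof -
      have "f = (\<lambda>x. indicator (box c d) x *\<^sub>R (indicator (cbox c d) x * (G x \<bullet> i)))"
        using box_subset_cbox by (auto simp: f_def indicator_def fun_eq_iff)
      then show ?thesis using integrable_mult_indicator[OF _ ic, of "box c d"] by simp
    qed
    have "AE x in lebesgue. f x = 0"
    proof (rule AE_lebesgue_zero_of_box_integrals[OF f])
      fix a b :: 'a
      \<comment> \<open>Cutting with \<open>box c d\<close> keeps the support of the bump inside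
        \<open>\<Omega>\<close>. If the intersection is empty, the bump is identically 0 and the
        empty set serves as its support.\<close>
      obtain a' b' where ab: "box a b \<inter> box c d = box a' b'" unfolding box_Int_box by blast
      have sub': "cbox a' b' \<subseteq> cbox c d \<or> box a' b' = {}"
        using ab by (metis Int_lower2 box_subset_cbox closure_box closure_mono closed_cbox closure_minimal order_trans)
      have t: "box_bump a' b' n \<in> test_functions \<Omega>" for n
      proof (cases "box a' b' = {}")
        case True
        then show ?thesis
          by (auto simp: test_functions_def Ck_box_bump box_bump_outside intro!: exI[of _ "{}"])
      next
        case False
        have "box_bump a' b' n x = 0" if "x \<notin> cbox a' b'" for x
          using that box_subset_cbox by (intro box_bump_outside) blast
        then show ?thesis
          using sub' sub False by (auto simp: test_functions_def Ck_box_bump intro!: exI[of _ "cbox a' b'"])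
      qed
      have z: "(\<integral>x. box_bump a' b' n x * f x \<partial>lebesgue) = 0" for n
      proof -
        have "(\<integral>x. box_bump a' b' n x * f x \<partial>lebesgue) = (\<integral>x. indicator \<Omega> x *\<^sub>R ((G x \<bullet> i) * box_bump a' b' n x) \<partial>lebesgue)"
        proof (intro Bochner_Integration.integral_cong refl)
          fix x
          show "box_bump a' b' n x * f x = indicator \<Omega> x *\<^sub>R ((G x \<bullet> i) * box_bump a' b' n x)"
          proof (cases "x \<in> box a' b'")
            case True
            then have "x \<in> box c d" using ab by auto
            then show ?thesis using box_subset_cbox sub by (auto simp: f_def indicator_def)
          qed (simp add: box_bump_outside)
        qed
        also have "\<dots> = (LINT x|lebesgue_on \<Omega>. (G x \<bullet> i) * box_bump a' b' n x)"
          using \<Omega>m by (simp add: integral_restrict_space)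
        also have "\<dots> = 0" using w t i by (simp add: is_weak_gradient_def)
        finally show ?thesis .
      qed
      have "(\<lambda>n. \<integral>x. box_bump a' b' n x * f x \<partial>lebesgue) \<longlonglongrightarrow> (\<integral>x. indicator (box a' b') x * f x \<partial>lebesgue)"
      proof (rule integral_dominated_convergence)
        show "integrable lebesgue (\<lambda>x. norm (f x))" using f by simp
        show "(\<lambda>x. indicator (box a' b') x * f x) \<in> borel_measurable lebesgue"
          using f by (intro borel_measurable_times borel_measurable_indicator) auto
        have "box_bump a' b' n \<in> borel_measurable lebesgue" for n
          using borel_measurable_continuous_onI[OF Ck_continuous[OF Ck_box_bump]]
          by (intro measurable_completion) simp
        then show "(\<lambda>x. box_bump a' b' n x * f x) \<in> borel_measurable lebesgue" for n using f by auto
        show "AE x in lebesgue. (\<lambda>n. box_bump a' b' n x * f x) \<longlonglongrightarrow> indicator (box a' b') x * f x"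
          by (intro AE_I2 tendsto_mult box_bump_tendsto tendsto_const)
        show "AE x in lebesgue. norm (box_bump a' b' n x * f x) \<le> norm (f x)" for n
          using box_bump_bounds[of a' b' n] by (intro AE_I2) (simp add: abs_mult mult_left_le_one_le)
      qed
      then have "(\<integral>x. indicator (box a' b') x * f x \<partial>lebesgue) = 0"
        unfolding z by (simp add: LIMSEQ_const_iff)
      also have "(\<lambda>x. indicator (box a' b') x * f x) = (\<lambda>x. indicator (box a b) x * f x)"
        unfolding ab[symmetric] by (auto simp: f_def indicator_def)
      finally show "(\<integral>x. indicator (box a b) x * f x \<partial>lebesgue) = 0" .
    qed
    moreover have "AE x in lebesgue. x \<notin> cbox c d - box c d"
      using negligible_frontier_interval[of c d] by (intro AE_not_in) (simp add: negligible_iff_null_sets)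
    ultimately show ?thesis by eventually_elim (auto simp: f_def indicator_def)
  qed
  have "AE x in lebesgue. \<forall>X\<in>\<D>. \<forall>i\<in>Basis. x \<in> X \<longrightarrow> G x \<bullet> i = 0"
  proof (rule AE_ball_countable[OF \<D>(1), THEN iffD2], rule ballI)
    fix X assume X: "X \<in> \<D>"
    then obtain c d where "X = cbox c d" using \<D>(3) by blast
    then show "AE x in lebesgue. \<forall>i\<in>Basis. x \<in> X \<longrightarrow> G x \<bullet> i = 0"
      using ae[of c d] X \<D>(2) by (intro AE_ball_countable[OF countable_finite[OF finite_Basis], THEN iffD2] ballI) auto
  qed
  then have "AE x in lebesgue. x \<in> \<Omega> \<longrightarrow> G x = 0"
  proof eventually_elim
    case (elim x)
    then show ?case using \<D>(4) by (auto simp: euclidean_all_zero_iff)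
  qed
  then show ?thesis using \<Omega>m by (simp add: AE_restrict_space_iff)
qed

lemma is_weak_gradient_unique:
  assumes "is_weak_gradient \<Omega> v G" "is_weak_gradient \<Omega> v H" "open \<Omega>"
  shows "AE x in lebesgue_on \<Omega>. G x = H x"
proof -
  have "is_weak_gradient \<Omega> (\<lambda>x. v x + (-1) * v x) (\<lambda>x. G x + (-1) *\<^sub>R H x)"
    using assms by (intro is_weak_gradient_add_scaled) auto
  then have "AE x in lebesgue_on \<Omega>. G x + (-1) *\<^sub>R H x = 0"
    using assms(3) by (intro is_weak_gradient_zero_AE) simp_all
  then show ?thesis by eventually_elim simp
qed

lemma weak_gradient_AE_eq:
  assumes "is_weak_gradient \<Omega> v G" "open \<Omega>"
  shows "AE x in lebesgue_on \<Omega>. weak_gradient \<Omega> v x = G x" "is_weak_gradient \<Omega> v (weak_gradient \<Omega> v)"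
proof -
  show i: "is_weak_gradient \<Omega> v (weak_gradient \<Omega> v)"
    unfolding weak_gradient_def by (rule someI[of "is_weak_gradient \<Omega> v", OF assms(1)])
  show "AE x in lebesgue_on \<Omega>. weak_gradient \<Omega> v x = G x"
    by (rule is_weak_gradient_unique[OF i assms])
qed

lemma continuous_integrable_lebesgue_on:
  fixes f :: "'a::euclidean_space \<Rightarrow> 'b::euclidean_space"
  assumes "compact K" "continuous_on K f"
  shows "integrable (lebesgue_on K) f"
proof -
  have "integrable lborel (\<lambda>x. indicator K x *\<^sub>R f x)"
    by (rule borel_integrable_compact[OF assms])
  moreover have "(\<lambda>x. indicator K x *\<^sub>R f x) \<in> borel_measurable borel"
    using assms by (intro borel_measurable_continuous_on_indicator borel_compact)
  ultimately have "integrable lebesgue (\<lambda>x. indicator K x *\<^sub>R f x)"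
    by (simp add: integrable_completion)
  then show ?thesis using assms(1) by (simp add: integrable_restrict_space borel_compact)
qed

text \<open>Integration by parts: \<open>w * \<phi>\<close> has compact support in
  \<open>\<Omega>\<close>, so the integral of its directional derivative vanishes, and the product
  rule splits it.\<close>

lemma is_weak_gradient_C1:
  fixes w :: "'a::euclidean_space \<Rightarrow> real"
  assumes D: "\<And>x. (w has_derivative (\<lambda>h. G x \<bullet> h)) (at x)" and G: "continuous_on UNIV G" and \<Omega>: "open \<Omega>"
  shows "is_weak_gradient \<Omega> w G"
  unfolding is_weak_gradient_def
proof (intro conjI allI impI ballI)
  have cw: "continuous_on UNIV w"
    using D by (auto simp: continuous_on_eq_continuous_at intro: has_derivative_continuous)
  have int: "integrable (lebesgue_on K) w" "integrable (lebesgue_on K) G" if "compact K" for K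
    using that cw G by (auto intro!: continuous_integrable_lebesgue_on intro: continuous_on_subset)
  show "integrable (lebesgue_on K) w" "integrable (lebesgue_on K) G" if "compact K \<and> K \<subseteq> \<Omega>" for K
    using int that by auto
  fix \<phi> and b :: 'a assume \<phi>: "\<phi> \<in> test_functions \<Omega>" and b: "b \<in> Basis"
  obtain K where K: "compact K" "K \<subseteq> \<Omega>" "\<And>x. x \<notin> K \<Longrightarrow> \<phi> x = 0"
    "\<And>x b. x \<notin> K \<Longrightarrow> frechet_derivative \<phi> (at x) b = 0"
    "\<And>x. (\<phi> has_derivative frechet_derivative \<phi> (at x)) (at x)"
    "continuous_on UNIV \<phi>" "\<And>b. b \<in> Basis \<Longrightarrow> continuous_on UNIV (\<lambda>x. frechet_derivative \<phi> (at x) b)"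
    using test_functionsD[OF \<phi>] by metis
  have \<Omega>m: "\<Omega> \<in> sets lebesgue" using \<Omega> by simp
  have i: "integrable (lebesgue_on \<Omega>) (\<lambda>x. w x * frechet_derivative \<phi> (at x) b)"
    by (rule integrable_lebesgue_on_mult[OF int(1)[OF K(1)] K(1,2) \<Omega>m K(7)[OF b] K(4)])
  have i': "integrable (lebesgue_on \<Omega>) (\<lambda>x. (G x \<bullet> b) * \<phi> x)"
    by (rule integrable_lebesgue_on_mult[OF integrable_inner_left[OF int(2)[OF K(1)]] K(1,2) \<Omega>m K(6,3)])
  let ?D = "\<lambda>x h. w x * frechet_derivative \<phi> (at x) h + (G x \<bullet> h) * \<phi> x"
  have "(LINT x|lebesgue. ?D x b) = 0"
  proof (rule integral_derivative_compact_support[OF _ _ K(1)])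
    show "((\<lambda>x. w x * \<phi> x) has_derivative ?D x) (at x)" for x
      using has_derivative_mult[OF D[of x] K(5)[of x]] by simp
    show "continuous_on UNIV (\<lambda>x. ?D x b)"
      by (intro continuous_intros cw G K(6) K(7)[OF b])
  qed (simp add: K(3))
  moreover have "(LINT x|lebesgue. ?D x b) = (LINT x|lebesgue_on \<Omega>. ?D x b)"
  proof -
    have "?D x b = indicator \<Omega> x *\<^sub>R ?D x b" for x
    proof (cases "x \<in> \<Omega>")
      case False
      then have "x \<notin> K" using K(2) by blast
      then show ?thesis by (simp add: K(3,4))
    qed simp
    then show ?thesis
      using \<Omega>m by (subst integral_restrict_space) (auto intro!: Bochner_Integration.integral_cong)
  qed
  moreover have "\<dots> = (LINT x|lebesgue_on \<Omega>. w x * frechet_derivative \<phi> (at x) b) + (LINT x|lebesgue_on \<Omega>. (G x \<bullet> b) * \<phi> x)"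
    by (rule Bochner_Integration.integral_add[OF i i'])
  ultimately show "(LINT x|lebesgue_on \<Omega>. w x * frechet_derivative \<phi> (at x) b) = - (LINT x|lebesgue_on \<Omega>. (G x \<bullet> b) * \<phi> x)"
    by simp
qed

text \<open>Averages of \<open>v\<close> against a bump function do not change when the bump is moved from \<open>y\<close> to \<open>z\<close>.\<close>

lemma weak_gradient_zero_constant:
  fixes v :: "'a::euclidean_space \<Rightarrow> real"
  assumes v: "continuous_on (cball x0 R) v" and w: "is_weak_gradient (ball x0 R) v (\<lambda>x. 0)"
    and yz: "y \<in> ball x0 R" "z \<in> ball x0 R"
  shows "v y = v z"
proof (rule ccontr)
  let ?\<Omega> = "ball x0 R"
  assume "v y \<noteq> v z"
  \<comment> \<open>A third of the gap: each average differs from its centre value by at most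
    \<open>e\<close>, which leaves a difference of at most \<open>2 * e\<close>, a
    contradiction.\<close>
  define e where "e = \<bar>v y - v z\<bar> / 3"
  have e: "0 < e" using \<open>v y \<noteq> v z\<close> by (simp add: e_def)
  have near: "\<exists>d>0. \<forall>x. dist x p \<le> d \<longrightarrow> \<bar>v x - v p\<bar> \<le> e" if p: "p \<in> ?\<Omega>" for p
  proof -
    have "continuous_on ?\<Omega> v" by (rule continuous_on_subset[OF v]) auto
    then have "isCont v p" using p by (simp add: continuous_on_eq_continuous_at)
    then obtain d where "0 < d" "\<And>x. dist x p < d \<Longrightarrow> dist (v x) (v p) < e"
      using e unfolding continuous_at_eps_delta by metis
    then show ?thesis by (intro exI[of _ "d / 2"]) (auto simp: dist_real_def intro!: less_imp_le)
  qed
  obtain d1 where d1: "0 < d1" "\<And>x. dist x y \<le> d1 \<Longrightarrow> \<bar>v x - v y\<bar> \<le> e" using near[OF yz(1)] by blast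
  obtain d2 where d2: "0 < d2" "\<And>x. dist x z \<le> d2 \<Longrightarrow> \<bar>v x - v z\<bar> \<le> e" using near[OF yz(2)] by blast
  define q where "q = max (dist x0 y) (dist x0 z)"
  have q: "q < R" using yz by (auto simp: q_def)
  define r where "r = min ((R - q) / 2) (min d1 d2)"
  have "r \<le> (R - q) / 2" unfolding r_def by (rule min.cobounded1)
  then have r: "0 < r" "q + r < R" "r \<le> d1" "r \<le> d2" using q d1 d2 by (auto simp: r_def field_simps)
  define \<phi> where "\<phi> x = smooth_step (r\<^sup>2 - (norm (x - y))\<^sup>2)" for x
  have C: "Ck k (\<lambda>x. smooth_step (r\<^sup>2 - (norm (x - a))\<^sup>2))" for k and a :: 'a
    by (intro Ck_compose[OF Ck_flat_exp] Ck_diff Ck_const Ck_norm_sq)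
  have C\<phi>: "Ck k \<phi>" for k unfolding \<phi>_def by (rule C)
  have out: "\<phi> x = 0" if "x \<notin> cball y r" for x
  proof -
    have "r < norm (x - y)" using that by (simp add: dist_norm norm_minus_commute)
    then have "r\<^sup>2 \<le> (norm (x - y))\<^sup>2" using r by (intro power_mono) auto
    then show ?thesis by (simp add: \<phi>_def smooth_step_nonpos)
  qed
  have \<phi>0: "0 \<le> \<phi> x" "\<phi> x \<le> 1" for x by (simp_all add: \<phi>_def smooth_step_bounds)
  \<comment> \<open>The extension by zero allows integration over the whole space, where the bump
    can be shifted freely.\<close>
  define V where "V x = indicator ?\<Omega> x * v x" for x
  have Vm: "V \<in> borel_measurable lebesgue"
  proof -
    have "continuous_on ?\<Omega> v" by (rule continuous_on_subset[OF v]) auto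
    then have "(\<lambda>x. indicator ?\<Omega> x *\<^sub>R v x) \<in> borel_measurable borel"
      by (intro borel_measurable_continuous_on_indicator) auto
    then show ?thesis unfolding V_def by (intro measurable_completion) simp
  qed
  have "bounded (v ` cball x0 R)"
    by (intro compact_imp_bounded compact_continuous_image v) simp
  then obtain B where "\<forall>x\<in>cball x0 R. \<bar>v x\<bar> \<le> B" by (auto simp: bounded_iff)
  then have VB: "\<bar>V x\<bar> \<le> \<bar>B\<bar>" for x
    by (cases "x \<in> ?\<Omega>") (auto simp: V_def intro: order_trans[OF _ abs_ge_self])
  let ?D = "\<lambda>x. frechet_derivative \<phi> (at x)"
  let ?d = "y - z"
  have D: "(\<phi> has_derivative ?D x) (at x)" for x by (rule Ck_SucD(1)[OF C\<phi>[of "Suc 0"]])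
  have cD: "continuous_on UNIV (\<lambda>x. ?D x b)" if "b \<in> Basis" for b
    using Ck_SucD(2)[OF C\<phi>[of "Suc 0"] that] by simp
  have Dexp: "?D x h = (\<Sum>b\<in>Basis. (h \<bullet> b) * ?D x b)" for x h
  proof -
    have lin: "linear (?D x)" by (rule has_derivative_linear[OF D])
    have "?D x h = ?D x (\<Sum>b\<in>Basis. (h \<bullet> b) *\<^sub>R b)" by (simp add: euclidean_representation)
    then show ?thesis by (simp add: linear_sum[OF lin] linear_scale[OF lin])
  qed
  have cDd: "continuous_on UNIV (\<lambda>x. ?D x ?d)"
    unfolding Dexp[of _ ?d] by (intro continuous_intros cD)
  define F where "F t = (LINT x|lebesgue. V x * \<phi> (x + t *\<^sub>R ?d))" for t
  have F': "(F has_real_derivative (LINT x|lebesgue. V x * ?D (x + t *\<^sub>R ?d) ?d)) (at t)" for t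
    unfolding F_def by (rule DERIV_integral_shift[OF Vm VB D cDd compact_cball[of y r] out])
  \<comment> \<open>The derivative along the shift is a weak gradient integral tested with the bump
    centred at a point \<open>p\<close> of the segment from \<open>y\<close> to \<open>z\<close>.
    Convexity of the ball of radius \<open>q\<close> keeps that bump supported in the domain, and
    the weak gradient is 0.\<close>
  have zero: "(LINT x|lebesgue. V x * ?D (x + t *\<^sub>R ?d) ?d) = 0" if t: "0 \<le> t" "t \<le> 1" for t
  proof -
    define p where "p = y - t *\<^sub>R ?d"
    have \<phi>t: "(\<lambda>x. \<phi> (x + t *\<^sub>R ?d)) = (\<lambda>x. smooth_step (r\<^sup>2 - (norm (x - p))\<^sup>2))"
      by (auto simp: \<phi>_def p_def algebra_simps)
    have Dt: "((\<lambda>x. \<phi> (x + t *\<^sub>R ?d)) has_derivative ?D (x + t *\<^sub>R ?d)) (at x)" for x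
    proof -
      have "((\<lambda>x. x + t *\<^sub>R ?d) has_derivative (\<lambda>h. h)) (at x)" by (auto intro!: derivative_eq_intros)
      from diff_chain_at[OF this D] show ?thesis by (simp add: o_def)
    qed
    have "dist x0 p \<le> q"
    proof -
      have "p = (1 - t) *\<^sub>R y + t *\<^sub>R z" by (simp add: p_def algebra_simps)
      moreover have "convex (cball x0 q)" "y \<in> cball x0 q" "z \<in> cball x0 q" by (auto simp: q_def)
      ultimately show ?thesis using t by (metis convexD_alt mem_cball)
    qed
    then have sub: "cball p r \<subseteq> ?\<Omega>"
    proof (intro subsetI)
      fix x assume "dist x0 p \<le> q" "x \<in> cball p r"
      then show "x \<in> ?\<Omega>" using r dist_triangle[of x0 x p] by simp
    qed
    have test: "(\<lambda>x. \<phi> (x + t *\<^sub>R ?d)) \<in> test_functions ?\<Omega>"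
    proof -
      have "\<forall>x. x \<notin> cball p r \<longrightarrow> \<phi> (x + t *\<^sub>R ?d) = 0"
        using out by (auto simp: p_def dist_norm algebra_simps)
      moreover have "\<forall>k. Ck k (\<lambda>x. \<phi> (x + t *\<^sub>R ?d))" unfolding \<phi>t using C by blast
      ultimately show ?thesis
        unfolding test_functions_def using sub by (intro CollectI conjI exI[of _ "cball p r"]) auto
    qed
    have "(LINT x|lebesgue_on ?\<Omega>. v x * ?D (x + t *\<^sub>R ?d) b) = 0"
      "integrable (lebesgue_on ?\<Omega>) (\<lambda>x. v x * ?D (x + t *\<^sub>R ?d) b)" if b: "b \<in> Basis" for b
    proof -
      have "frechet_derivative (\<lambda>x. \<phi> (x + t *\<^sub>R ?d)) (at x) = ?D (x + t *\<^sub>R ?d)" for x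
        using frechet_derivative_at[OF Dt] by simp
      then show "(LINT x|lebesgue_on ?\<Omega>. v x * ?D (x + t *\<^sub>R ?d) b) = 0"
        "integrable (lebesgue_on ?\<Omega>) (\<lambda>x. v x * ?D (x + t *\<^sub>R ?d) b)"
        using bspec[OF bspec[OF conjunct2[OF w[unfolded is_weak_gradient_def]] test] b]
          is_weak_gradient_integrable(1)[OF w test b] by simp_all
    qed
    then have z: "(LINT x|lebesgue. V x * ?D (x + t *\<^sub>R ?d) b) = 0"
      "integrable lebesgue (\<lambda>x. V x * ?D (x + t *\<^sub>R ?d) b)" if "b \<in> Basis" for b
      using that by (simp_all add: V_def integral_restrict_space integrable_restrict_space mult.assoc)
    have "(LINT x|lebesgue. V x * ?D (x + t *\<^sub>R ?d) ?d) = (LINT x|lebesgue. (\<Sum>b\<in>Basis. (?d \<bullet> b) * (V x * ?D (x + t *\<^sub>R ?d) b)))"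
      by (subst Dexp) (simp add: sum_distrib_left mult_ac)
    also have "\<dots> = (\<Sum>b\<in>Basis. (?d \<bullet> b) * (LINT x|lebesgue. V x * ?D (x + t *\<^sub>R ?d) b))"
      using z(2) by (simp add: Bochner_Integration.integral_sum)
    finally show ?thesis using z(1) by simp
  qed
  have "F 1 = F 0"
  proof (rule DERIV_isconst2[of 0 1 F 1])
    show "continuous_on {0..1} F"
      using F' by (auto intro!: continuous_at_imp_continuous_on DERIV_isCont)
    show "\<And>x. 0 < x \<Longrightarrow> x < 1 \<Longrightarrow> DERIV F x :> 0" using F' zero by (metis less_imp_le)
  qed auto
  define m where "m = (LINT x|lborel. \<phi> x)"
  have \<phi>m: "\<phi> \<in> borel_measurable borel" by (rule borel_measurable_continuous_onI[OF Ck_continuous[OF C\<phi>[of 0]]])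
  have \<phi>i: "integrable lborel \<phi>"
  proof (rule Bochner_Integration.integrable_bound)
    show "integrable lborel (indicator (cball y r) :: 'a \<Rightarrow> real)"
      using emeasure_lborel_cball_finite[of y r] by (intro integrable_real_indicator) auto
    show "AE x in lborel. norm (\<phi> x) \<le> norm (indicator (cball y r) x :: real)"
      using out \<phi>0 by (intro AE_I2) (auto simp: indicator_def)
  qed (use \<phi>m in simp)
  have m0: "0 < m"
  proof (rule ccontr)
    assume "\<not> 0 < m"
    moreover have "0 \<le> m" unfolding m_def using \<phi>0 by simp
    ultimately have "m = 0" by simp
    then have "AE x in lborel. \<phi> x = 0"
      using integral_nonneg_eq_0_iff_AE[OF \<phi>i] \<phi>0 by (simp add: m_def)
    moreover have "\<phi> x \<noteq> 0" if "x \<in> ball y r" for x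
    proof -
      have "(norm (x - y))\<^sup>2 < r\<^sup>2" using that by (intro power_strict_mono) (auto simp: dist_norm norm_minus_commute)
      then show ?thesis using smooth_step_pos[of "r\<^sup>2 - (norm (x - y))\<^sup>2"] by (simp add: \<phi>_def)
    qed
    ultimately have "AE x in lborel. x \<notin> ball y r" by (auto elim: eventually_mono)
    then have "emeasure lborel (ball y r) = 0" by (subst (asm) AE_iff_measurable[of "ball y r"]) auto
    then show False using r unit_ball_vol_pos[of "real DIM('a)"]
      by (simp add: emeasure_ball)
  qed
  \<comment> \<open>The bump shifted by \<open>t\<close> is centred at \<open>p\<close> and has mass
    \<open>m\<close>; on its support \<open>v\<close> differs from \<open>v p\<close> by at most
    \<open>e\<close>.\<close>
  have est: "\<bar>F t - v p * m\<bar> \<le> e * m" if p: "p = y - t *\<^sub>R ?d" "p \<in> ?\<Omega>" "\<And>x. dist x p \<le> r \<Longrightarrow> x \<in> ?\<Omega> \<and> \<bar>v x - v p\<bar> \<le> e" for t p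
  proof -
    have shift: "integrable lborel (\<lambda>x. \<phi> (x + t *\<^sub>R ?d))" "(LINT x|lborel. \<phi> (x + t *\<^sub>R ?d)) = m"
    proof -
      have d: "distr lborel borel ((+) (t *\<^sub>R ?d)) = lborel"
        using lborel_affine[of 1 "t *\<^sub>R ?d"] by (simp add: density_1)
      show "integrable lborel (\<lambda>x. \<phi> (x + t *\<^sub>R ?d))"
        using integrable_distr[of "(+) (t *\<^sub>R ?d)" lborel borel \<phi>] \<phi>i by (simp add: d add.commute)
      have "(LINT x|lborel. \<phi> (x + t *\<^sub>R ?d)) = (LINT x|distr lborel borel ((+) (t *\<^sub>R ?d)). \<phi> x)"
        using \<phi>m by (subst integral_distr) (auto simp: add.commute)
      then show "(LINT x|lborel. \<phi> (x + t *\<^sub>R ?d)) = m" by (simp add: d m_def)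
    qed
    have \<phi>tm: "(\<lambda>x. \<phi> (x + t *\<^sub>R ?d)) \<in> borel_measurable borel" using \<phi>m by measurable
    have iL: "integrable lebesgue (\<lambda>x. \<phi> (x + t *\<^sub>R ?d))" "(LINT x|lebesgue. \<phi> (x + t *\<^sub>R ?d)) = m"
      using shift \<phi>tm by (simp_all add: integrable_completion integral_completion)
    have pw: "\<bar>V x * \<phi> (x + t *\<^sub>R ?d) - v p * \<phi> (x + t *\<^sub>R ?d)\<bar> \<le> e * \<phi> (x + t *\<^sub>R ?d)" for x
    proof (cases "dist x p \<le> r")
      case True
      then have "\<bar>V x - v p\<bar> \<le> e" using p(3) by (simp add: V_def)
      then have "\<bar>V x - v p\<bar> * \<phi> (x + t *\<^sub>R ?d) \<le> e * \<phi> (x + t *\<^sub>R ?d)" using \<phi>0 by (intro mult_right_mono)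
      then show ?thesis using \<phi>0(1)[of "x + t *\<^sub>R ?d"]
        by (simp add: abs_mult flip: left_diff_distrib)
    next
      case False
      then have "x + t *\<^sub>R ?d \<notin> cball y r" using p(1) by (simp add: dist_norm algebra_simps norm_minus_commute)
      then show ?thesis using out by simp
    qed
    have iV: "integrable lebesgue (\<lambda>x. V x * \<phi> (x + t *\<^sub>R ?d))"
    proof (rule Bochner_Integration.integrable_bound)
      show "integrable lebesgue (\<lambda>x. \<bar>B\<bar> * \<phi> (x + t *\<^sub>R ?d))" using iL by simp
      show "(\<lambda>x. V x * \<phi> (x + t *\<^sub>R ?d)) \<in> borel_measurable lebesgue"
        using Vm iL by (intro borel_measurable_times) auto
      show "AE x in lebesgue. norm (V x * \<phi> (x + t *\<^sub>R ?d)) \<le> norm (\<bar>B\<bar> * \<phi> (x + t *\<^sub>R ?d))"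
        using VB \<phi>0 by (intro AE_I2) (simp add: abs_mult mult_right_mono)
    qed
    have "F t - v p * m = (LINT x|lebesgue. V x * \<phi> (x + t *\<^sub>R ?d) - v p * \<phi> (x + t *\<^sub>R ?d))"
      unfolding F_def using iL iV by simp
    also have "\<bar>\<dots>\<bar> \<le> (LINT x|lebesgue. \<bar>V x * \<phi> (x + t *\<^sub>R ?d) - v p * \<phi> (x + t *\<^sub>R ?d)\<bar>)"
      by (rule integral_abs_bound)
    also have "\<dots> \<le> (LINT x|lebesgue. e * \<phi> (x + t *\<^sub>R ?d))"
      using pw iL iV by (intro integral_mono) auto
    finally show ?thesis using iL by simp
  qed
  have inO: "x \<in> ?\<Omega>" if "dist x p \<le> r" "p = y \<or> p = z" for x p
  proof -
    have "dist x0 x \<le> dist x0 p + dist p x" by (rule dist_triangle)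
    also have "\<dots> \<le> q + r" using that by (auto simp: q_def dist_commute)
    finally show ?thesis using r by simp
  qed
  have "\<bar>F 0 - v y * m\<bar> \<le> e * m"
    by (rule est) (use yz d1 r inO in \<open>auto intro: order_trans\<close>)
  moreover have "\<bar>F 1 - v z * m\<bar> \<le> e * m"
    by (rule est) (use yz d2 r inO in \<open>auto intro: order_trans\<close>)
  ultimately have "\<bar>v y * m - v z * m\<bar> \<le> 2 * e * m" using \<open>F 1 = F 0\<close> by linarith
  then have "\<bar>v y - v z\<bar> * m \<le> 2 * e * m" using m0 by (simp add: abs_mult flip: left_diff_distrib)
  then have "\<bar>v y - v z\<bar> \<le> 2 * e" using m0 by simp
  then show False using e by (simp add: e_def)
qed

section \<open>The divergence theorem on a ball\<close>

locale ball_domain =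
  fixes x0 :: "'a::euclidean_space" and R :: real
  assumes R_pos: "0 < R" and DIM_ge_2: "2 \<le> DIM('a)"
begin

abbreviation "\<Omega> \<equiv> ball x0 R"
abbreviation "S \<equiv> sphere x0 R"
abbreviation "H \<equiv> hausdorff_measure (DIM('a) - 1) :: 'a measure"
abbreviation "\<mu> \<equiv> bdry_measure \<Omega>"
text \<open>The boundary measure carried over to the Borel sets of the whole space, as
  \<open>sphere_measure\<close> requires.\<close>

definition "\<sigma> = distr \<mu> borel (\<lambda>x. x)"
definition "P = measure \<mu> S"
definition "vol = measure lebesgue \<Omega>"

section \<open>The boundary measure of the ball\<close>

lemma frontier_Omega [simp]: "frontier \<Omega> = S"
  using R_pos by (simp add: frontier_ball)

lemma closure_Omega [simp]: "closure \<Omega> = cball x0 R"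
  using R_pos by simp

lemma bdry_measure_eq: "\<mu> = restrict_space H S"
  by (simp add: bdry_measure_def)

lemma space_bdry [simp]: "space \<mu> = S"
  by (simp add: bdry_measure_eq space_restrict_space)

lemma sets_bdry: "sets \<mu> = sets (restrict_space borel S)"
  unfolding bdry_measure_eq by (rule sets_restrict_space_cong) simp

lemma sets_bdry_iff: "A \<in> sets \<mu> \<longleftrightarrow> A \<in> sets borel \<and> A \<subseteq> S"
  unfolding sets_bdry by (subst sets_restrict_space_iff) auto

lemma measurable_bdry_continuous: "continuous_on S f \<Longrightarrow> f \<in> borel_measurable \<mu>"
  using borel_measurable_continuous_on_restrict[of S f] measurable_cong_sets[OF sets_bdry refl] by blast

lemma emeasure_bdry: "A \<in> sets \<mu> \<Longrightarrow> emeasure \<mu> A = hausdorff_outer (DIM('a) - 1) A"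
  unfolding sets_bdry_iff unfolding bdry_measure_eq
  by (subst emeasure_restrict_space) (auto simp: emeasure_hausdorff_measure)

lemma id_measurable: "(\<lambda>x. x) \<in> measurable \<mu> borel"
  by (rule measurable_bdry_continuous) (rule continuous_on_id)

lemma emeasure_sigma: "A \<in> sets borel \<Longrightarrow> emeasure \<sigma> A = hausdorff_outer (DIM('a) - 1) (A \<inter> S)"
  unfolding \<sigma>_def by (subst emeasure_distr[OF id_measurable]) (auto simp: sets_bdry_iff emeasure_bdry)

lemma emeasure_bdry_sphere: "emeasure \<mu> S = ennreal P" "0 < P"
proof -
  have S: "S \<in> sets \<mu>" by (simp add: sets_bdry_iff)
  have "emeasure \<mu> S < top" "0 < emeasure \<mu> S"
    using hausdorff_outer_sphere_finite[OF R_pos, of x0] hausdorff_outer_sphere_pos[OF R_pos DIM_ge_2, of x0]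
    by (simp_all add: emeasure_bdry[OF S])
  then show "emeasure \<mu> S = ennreal P" "0 < P"
    unfolding P_def by (auto simp: measure_def enn2real_positive_iff)
qed

sublocale bdry: finite_measure \<mu>
  by (rule finite_measureI) (simp add: emeasure_bdry_sphere)

lemma measure_bdry_space: "measure \<mu> S = P"
  by (simp add: P_def)

lemma isometry_sphere: "isometry_at x0 T \<Longrightarrow> T x \<in> S \<longleftrightarrow> x \<in> S"
  using isometry_atD(1,2)[of x0 T] by (metis mem_sphere)

lemma sphere_measure_sigma: "sphere_measure \<sigma> x0 R"
proof (intro sphere_measure.intro finite_measureI sphere_measure_axioms.intro)
  show "emeasure \<sigma> (space \<sigma>) \<noteq> \<infinity>"
    using emeasure_bdry_sphere(1) unfolding \<sigma>_def by (subst emeasure_distr[OF id_measurable]) auto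
  show "sets \<sigma> = sets borel" by (simp add: \<sigma>_def)
  show "AE x in \<sigma>. x \<in> S"
    unfolding \<sigma>_def by (subst AE_distr_iff[OF id_measurable]) auto
  fix T :: "'a \<Rightarrow> 'a" and A :: "'a set" assume T: "isometry_at x0 T" and A: "A \<in> sets borel"
  have T': "T -` A \<in> sets borel" using measurable_sets[OF isometry_atD(5)[OF T] A] by simp
  have "T ` (T -` A \<inter> S) = A \<inter> S"
  proof (intro equalityI subsetI)
    fix y assume "y \<in> A \<inter> S"
    moreover obtain x where "y = T x" using isometry_atD(3)[OF T] by (metis surjD)
    ultimately show "y \<in> T ` (T -` A \<inter> S)" using isometry_sphere[OF T, of x] by blast
  qed (use isometry_sphere[OF T] in blast)
  then have "hausdorff_outer (DIM('a) - 1) (T -` A \<inter> S) = hausdorff_outer (DIM('a) - 1) (A \<inter> S)"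
    using hausdorff_outer_isometry[OF isometry_atD(1)[OF T] isometry_atD(3)[OF T]] by metis
  then show "emeasure \<sigma> (T -` A) = emeasure \<sigma> A"
    using A T' by (simp add: emeasure_sigma)
qed

sublocale sig: sphere_measure \<sigma> x0 R
  by (rule sphere_measure_sigma)

lemma measure_sigma_UNIV: "measure \<sigma> UNIV = P"
  unfolding \<sigma>_def P_def by (subst measure_distr[OF id_measurable]) auto

lemma integral_sigma: "f \<in> borel_measurable borel \<Longrightarrow> (\<integral>x. f x \<partial>\<sigma>) = (\<integral>x. f x \<partial>\<mu>)" for f :: "'a \<Rightarrow> real"
  unfolding \<sigma>_def by (rule integral_distr[OF id_measurable]) auto

lemma bdry_ball_pos:
  assumes "s \<in> S" "0 < r"
  shows "0 < emeasure \<mu> (ball s r \<inter> S)"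
proof -
  have "0 < emeasure \<sigma> UNIV"
    using emeasure_bdry_sphere unfolding \<sigma>_def by (subst emeasure_distr[OF id_measurable]) auto
  from sig.measure_ball_pos[OF assms this] have "0 < emeasure \<sigma> (ball s r)"
    by (simp add: measure_def enn2real_positive_iff)
  then show ?thesis
    by (simp add: \<sigma>_def emeasure_distr[OF id_measurable])
qed

text \<open>A strict violation at \<open>s\<close> would persist in a neighbourhood of
  \<open>s\<close> on the sphere by continuity, and such a neighbourhood has positive
  measure.\<close>

lemma bdry_AE_imp_all:
  assumes f: "continuous_on S f" "continuous_on S g" and ae: "AE x in \<mu>. f x \<le> (g x :: real)" and s: "s \<in> S"
  shows "f s \<le> g s"
proof (rule ccontr)
  assume "\<not> f s \<le> g s"
  then have e: "0 < f s - g s" by simp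
  have "continuous_on S (\<lambda>x. f x - g x)" by (intro continuous_intros f)
  then obtain r where r: "0 < r" "\<And>x. x \<in> S \<Longrightarrow> dist x s < r \<Longrightarrow> dist (f x - g x) (f s - g s) < f s - g s"
    using e s unfolding continuous_on_iff by metis
  have "AE x in \<mu>. x \<notin> ball s r \<inter> S"
    using ae AE_space
  proof eventually_elim
    case (elim x)
    then show ?case using r(2)[of x] by (auto simp: dist_commute dist_real_def)
  qed
  then have "emeasure \<mu> (ball s r \<inter> S) = 0"
    by (subst (asm) AE_iff_measurable[of "ball s r \<inter> S"]) (auto simp: sets_bdry_iff)
  then show False using bdry_ball_pos[OF s r(1)] by simp
qed

lemma bdry_AE_eq_imp_all:
  assumes "continuous_on S f" "continuous_on S g" "AE x in \<mu>. f x = (g x :: real)" "s \<in> S"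
  shows "f s = g s"
  using assms by (intro antisym bdry_AE_imp_all[of f g] bdry_AE_imp_all[of g f]) (auto elim: eventually_mono)

lemma bdry_integrable_continuous:
  assumes "continuous_on S f"
  shows "integrable \<mu> (f :: 'a \<Rightarrow> real)"
proof -
  have "bounded (f ` S)" by (intro compact_imp_bounded compact_continuous_image assms) simp
  then obtain B where "\<forall>x\<in>S. \<bar>f x\<bar> \<le> B" by (auto simp: bounded_iff)
  then show ?thesis
    by (intro bdry.integrable_const_bound[of _ B] measurable_bdry_continuous assms) auto
qed

lemma Omega_sets [simp]: "\<Omega> \<in> sets lebesgue" "\<Omega> \<in> sets borel"
  by auto

lemma vol_pos: "0 < vol"
  using R_pos unit_ball_vol_pos[of "real DIM('a)"] by (simp add: vol_def content_ball)

text \<open>The cut-offs \<open>\<eta>\<close> increase to 1 in the ball; \<open>\<kappa> = - (x - x0) \<bullet> \<nabla>\<eta>\<close> concentrates on the sphere.\<close>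

definition rad :: "nat \<Rightarrow> real" where "rad n = R * real n / (real n + 1)"

definition gap :: "nat \<Rightarrow> 'a \<Rightarrow> real" where "gap n x = (rad n)\<^sup>2 - (norm (x - x0))\<^sup>2"

definition \<eta> :: "nat \<Rightarrow> 'a \<Rightarrow> real" where "\<eta> n x = smooth_step (real n * gap n x)"

definition \<kappa> :: "nat \<Rightarrow> 'a \<Rightarrow> real" where
  "\<kappa> n x = 2 * real n * (norm (x - x0))\<^sup>2 * flat_exp 2 (real n * gap n x)"

lemma rad_bounds: "0 \<le> rad n" "rad n < R"
  using R_pos by (auto simp: rad_def divide_simps)

lemma rad_tendsto: "rad \<longlonglongrightarrow> R"
proof -
  have "(\<lambda>n. R * (real n / (real n + 1))) \<longlonglongrightarrow> R * 1"
    by (intro tendsto_intros LIMSEQ_n_over_Suc_n[unfolded of_nat_Suc add.commute[of 1]])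
  then show ?thesis by (simp add: rad_def[abs_def])
qed

lemma Ck_eta: "Ck k (\<eta> n)"
  unfolding \<eta>_def gap_def
  by (intro Ck_compose[OF Ck_flat_exp] Ck_mult Ck_diff Ck_const Ck_norm_sq)

lemma eta_bounds: "0 \<le> \<eta> n x" "\<eta> n x \<le> 1"
  by (simp_all add: \<eta>_def smooth_step_bounds)

lemma gap_outside: "x \<notin> cball x0 (rad n) \<Longrightarrow> real n * gap n x \<le> 0"
proof -
  assume "x \<notin> cball x0 (rad n)"
  then have "rad n \<le> norm (x - x0)" by (simp add: dist_norm norm_minus_commute)
  then have "(rad n)\<^sup>2 \<le> (norm (x - x0))\<^sup>2" using rad_bounds by (intro power_mono)
  then show ?thesis by (simp add: gap_def mult_nonneg_nonpos)
qed

lemma eta_outside: "x \<notin> cball x0 (rad n) \<Longrightarrow> \<eta> n x = 0"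
  using gap_outside by (simp add: \<eta>_def smooth_step_nonpos)

lemma kappa_outside: "x \<notin> cball x0 (rad n) \<Longrightarrow> \<kappa> n x = 0"
  using gap_outside[of x n] by (simp add: \<kappa>_def flat_exp_def)

lemma kappa_nonneg: "0 \<le> \<kappa> n x"
  by (simp add: \<kappa>_def flat_exp_2_bounds)

lemma kappa_continuous: "continuous_on UNIV (\<kappa> n)"
  unfolding \<kappa>_def[abs_def] gap_def
  by (intro Ck_continuous[of 0] Ck_mult Ck_const Ck_norm_sq Ck_compose[OF Ck_flat_exp] Ck_diff)

lemma kappa_borel [measurable]: "\<kappa> n \<in> borel_measurable borel"
  by (rule borel_measurable_continuous_onI[OF kappa_continuous])

lemma eta_derivative:
  "(\<eta> n has_derivative (\<lambda>h. - (2 * real n * flat_exp 2 (real n * gap n x)) * ((x - x0) \<bullet> h))) (at x)"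
proof -
  have "((\<lambda>x. (norm (x - x0))\<^sup>2) has_derivative (\<lambda>h. 2 * ((x - x0) \<bullet> h))) (at x)"
    unfolding power2_norm_eq_inner
    by (auto intro!: derivative_eq_intros simp: inner_commute)
  then have "((\<lambda>x. real n * gap n x) has_derivative (\<lambda>h. real n * (0 - 2 * ((x - x0) \<bullet> h)))) (at x)"
    unfolding gap_def by (intro has_derivative_mult_right has_derivative_diff has_derivative_const)
  from diff_chain_at[OF this smooth_step_DERIV[unfolded has_field_derivative_def]]
  show ?thesis unfolding \<eta>_def by (simp add: o_def mult_ac)
qed

lemma eta_tendsto:
  assumes "x \<in> \<Omega>"
  shows "(\<lambda>n. \<eta> n x) \<longlonglongrightarrow> 1"
proof -
  define t where "t = (R\<^sup>2 - (norm (x - x0))\<^sup>2) / 2"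
  have "norm (x - x0) < R" using assms by (simp add: dist_norm norm_minus_commute)
  then have "(norm (x - x0))\<^sup>2 < R\<^sup>2" by (intro power_strict_mono) auto
  then have t: "0 < t" by (simp add: t_def)
  have "(\<lambda>n. gap n x) \<longlonglongrightarrow> R\<^sup>2 - (norm (x - x0))\<^sup>2"
    unfolding gap_def by (intro tendsto_intros rad_tendsto)
  moreover have "t < R\<^sup>2 - (norm (x - x0))\<^sup>2" using t by (simp add: t_def)
  ultimately have "eventually (\<lambda>n. t < gap n x) sequentially" by (rule order_tendstoD)
  then have "eventually (\<lambda>n. smooth_step (real n * t) \<le> \<eta> n x) sequentially"
    using eventually_gt_at_top[of 0]
  proof eventually_elim
    case (elim n)
    then have "0 < real n * t" "real n * t \<le> real n * gap n x" using t by auto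
    then show ?case unfolding \<eta>_def by (simp add: flat_exp_def frac_le)
  qed
  moreover have "eventually (\<lambda>n. \<eta> n x \<le> 1) sequentially" by (simp add: eta_bounds)
  ultimately show ?thesis
    by (rule tendsto_sandwich[OF _ _ smooth_step_tendsto_1[OF t] tendsto_const])
qed

lemma kappa_integrable_mult:
  assumes "continuous_on UNIV f"
  shows "integrable lborel (\<lambda>x. \<kappa> n x * f x :: real)"
proof -
  have "integrable lborel (\<lambda>x. indicator (cball x0 R) x *\<^sub>R (\<kappa> n x * f x))"
    using assms kappa_continuous
    by (intro borel_integrable_compact) (auto intro!: continuous_intros intro: continuous_on_subset)
  moreover have "(\<lambda>x. indicator (cball x0 R) x *\<^sub>R (\<kappa> n x * f x)) = (\<lambda>x. \<kappa> n x * f x)"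
    using kappa_outside[of _ n] rad_bounds(2)[of n] by (force simp: indicator_def)
  ultimately show ?thesis by (simp only:)
qed

text \<open>Radial projection to the sphere. At the centre the division by 0 gives the value
  \<open>x0\<close>, off the sphere; a single point is a Lebesgue null set.\<close>

definition proj :: "'a \<Rightarrow> 'a" where "proj x = x0 + (R / norm (x - x0)) *\<^sub>R (x - x0)"

lemma proj_measurable [measurable]: "proj \<in> borel_measurable borel"
  unfolding proj_def[abs_def] by measurable

lemma proj_sphere: "x \<noteq> x0 \<Longrightarrow> proj x \<in> S"
  using R_pos by (simp add: proj_def dist_norm)

lemma proj_dist: "x \<in> \<Omega> \<Longrightarrow> x \<noteq> x0 \<Longrightarrow> dist (proj x) x = R - norm (x - x0)"
proof -
  assume x: "x \<in> \<Omega>" "x \<noteq> x0"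
  define r where "r = norm (x - x0)"
  have r: "0 < r" "r < R" using x by (auto simp: r_def dist_norm norm_minus_commute)
  have "proj x - x = (R / r - 1) *\<^sub>R (x - x0)" by (simp add: proj_def r_def algebra_simps)
  then have "dist (proj x) x = \<bar>R / r - 1\<bar> * r" by (simp add: dist_norm r_def)
  also have "\<dots> = R - r" using r by (simp add: field_simps)
  finally show ?thesis by (simp add: r_def)
qed

text \<open>The mass with density \<open>\<kappa> n\<close>, pushed radially onto the sphere, so
  that the uniqueness of invariant measures there applies to it.\<close>

definition shell :: "nat \<Rightarrow> 'a measure" where
  "shell n = distr (density lborel (\<lambda>x. ennreal (\<kappa> n x))) borel proj"

lemma emeasure_shell:
  assumes [measurable]: "A \<in> sets borel"
  shows "emeasure (shell n) A = (\<integral>\<^sup>+x. ennreal (\<kappa> n x) * indicator A (proj x) \<partial>lborel)"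
proof -
  have "emeasure (shell n) A = emeasure (density lborel (\<lambda>x. ennreal (\<kappa> n x))) (proj -` A)"
    unfolding shell_def by (subst emeasure_distr) auto
  also have "\<dots> = (\<integral>\<^sup>+x. ennreal (\<kappa> n x) * indicator (proj -` A) x \<partial>lborel)"
    using measurable_sets[OF proj_measurable assms] by (subst emeasure_density) auto
  finally show ?thesis by (simp add: indicator_def[abs_def])
qed

lemma integral_shell:
  assumes [measurable]: "f \<in> borel_measurable borel"
  shows "(\<integral>x. f x \<partial>shell n) = (\<integral>x. \<kappa> n x * f (proj x) \<partial>lborel)"
proof -
  have "(\<integral>x. f x \<partial>shell n) = (\<integral>x. f (proj x) \<partial>density lborel (\<lambda>x. ennreal (\<kappa> n x)))"
    unfolding shell_def by (rule integral_distr) auto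
  also have "\<dots> = (\<integral>x. \<kappa> n x *\<^sub>R f (proj x) \<partial>lborel)"
    by (rule integral_density) (auto simp: kappa_nonneg)
  finally show ?thesis by simp
qed

text \<open>Invariance holds because Lebesgue measure is invariant, \<open>\<kappa> n\<close>
  depends only on the distance from \<open>x0\<close>, and \<open>proj\<close> commutes with
  isometries fixing \<open>x0\<close>.\<close>

lemma sphere_measure_shell: "sphere_measure (shell n) x0 R"
proof (intro sphere_measure.intro finite_measureI sphere_measure_axioms.intro)
  have "(\<integral>\<^sup>+x. ennreal (\<kappa> n x) \<partial>lborel) < \<infinity>"
    using kappa_integrable_mult[of "\<lambda>_. 1" n] kappa_nonneg[of n] by (auto simp: integrable_iff_bounded)
  then show "emeasure (shell n) (space (shell n)) \<noteq> \<infinity>"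
    using emeasure_shell[of UNIV n] by (simp add: shell_def)
  show "sets (shell n) = sets borel" by (simp add: shell_def)
  have "AE x in lborel. x \<noteq> x0" by (rule AE_lborel_singleton)
  then have "AE x in density lborel (\<lambda>x. ennreal (\<kappa> n x)). proj x \<in> S"
    by (subst AE_density) (auto elim!: eventually_mono intro: proj_sphere simp del: mem_sphere)
  then show "AE x in shell n. x \<in> S"
    unfolding shell_def by (subst AE_distr_iff) auto
  fix T :: "'a \<Rightarrow> 'a" and A :: "'a set" assume T: "isometry_at x0 T" and A[measurable]: "A \<in> sets borel"
  note [measurable] = isometry_atD(5)[OF T]
  have T': "T -` A \<in> sets borel" using measurable_sets[OF isometry_atD(5)[OF T] A] by simp
  have nT: "norm (T x - x0) = norm (x - x0)" for x
    using isometry_atD(1)[OF T, of x x0] isometry_atD(2)[OF T] by (simp add: dist_norm)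
  obtain L where L: "orthogonal_transformation L" and TL: "\<And>x. T x = x0 + L (x - x0)"
    using T by (auto simp: isometry_at_def)
  have lin: "linear L" using L by (simp add: orthogonal_transformation)
  have pT: "proj (T x) = T (proj x)" for x
    using nT[of x] by (simp add: proj_def TL linear_scale[OF lin])
  have kT: "\<kappa> n (T x) = \<kappa> n x" for x by (simp add: \<kappa>_def gap_def nT)
  have "emeasure (shell n) A = (\<integral>\<^sup>+x. ennreal (\<kappa> n x) * indicator A (proj x) \<partial>distr lborel borel T)"
    by (simp add: emeasure_shell[OF A] lborel_distr_isometry[OF T])
  also have "\<dots> = (\<integral>\<^sup>+x. ennreal (\<kappa> n (T x)) * indicator A (proj (T x)) \<partial>lborel)"
    by (rule nn_integral_distr) measurable
  also have "\<dots> = (\<integral>\<^sup>+x. ennreal (\<kappa> n x) * indicator (T -` A) (proj x) \<partial>lborel)"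
    by (simp add: kT pT indicator_def)
  also have "\<dots> = emeasure (shell n) (T -` A)" by (rule emeasure_shell[OF T', symmetric])
  finally show "emeasure (shell n) (T -` A) = emeasure (shell n) A" by simp
qed

lemma integral_kappa_proj:
  assumes f: "continuous_on UNIV f"
  shows "P * (\<integral>x. \<kappa> n x * f (proj x) \<partial>lborel) = (\<integral>x. \<kappa> n x \<partial>lborel) * (\<integral>x. f x \<partial>\<mu>)"
proof -
  have fm: "f \<in> borel_measurable borel" by (rule borel_measurable_continuous_onI[OF f])
  have "measure (shell n) UNIV = (\<integral>x. \<kappa> n x \<partial>lborel)"
    using integral_shell[of "\<lambda>_. 1" n] by (simp add: shell_def)
  then show ?thesis
    using sphere_measures_proportional[OF sphere_measure_sigma sphere_measure_shell f, of n]
    by (simp add: measure_sigma_UNIV integral_sigma[OF fm] integral_shell[OF fm])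
qed

text \<open>Replacing \<open>f\<close> by its value at the radial projection costs nothing in the
  limit: near the sphere by uniform continuity, further inside because \<open>\<kappa> n\<close> is
  of order 1/n there. For the projected values the shell measure is proportional to the surface
  measure.\<close>

lemma kappa_limit:
  assumes f: "continuous_on UNIV f" and M: "(\<lambda>n. \<integral>x. \<kappa> n x \<partial>lborel) \<longlonglongrightarrow> M"
  shows "(\<lambda>n. \<integral>x. \<kappa> n x * f x \<partial>lborel) \<longlonglongrightarrow> M / P * (\<integral>x. f x \<partial>\<mu>)"
proof -
  have fm[measurable]: "f \<in> borel_measurable borel" by (rule borel_measurable_continuous_onI[OF f])
  have P: "0 < P" by (rule emeasure_bdry_sphere)
  have cf: "continuous_on (cball x0 R) f" by (rule continuous_on_subset[OF f]) simp
  have "bounded (f ` cball x0 R)" by (intro compact_imp_bounded compact_continuous_image cf) simp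
  then obtain B where "\<forall>x\<in>cball x0 R. \<bar>f x\<bar> \<le> B" by (auto simp: bounded_iff)
  then have B: "\<And>x. x \<in> cball x0 R \<Longrightarrow> \<bar>f x\<bar> \<le> B" by blast
  have B0: "0 \<le> B" using B[of x0] R_pos by (auto intro: order_trans[OF abs_ge_zero])
  let ?k = "\<lambda>n. \<integral>x. \<kappa> n x \<partial>lborel"
  have ik: "integrable lborel (\<kappa> n)" for n using kappa_integrable_mult[of "\<lambda>_. 1" n] by simp
  have k0: "0 \<le> ?k n" for n by (simp add: kappa_nonneg)
  have S_sub: "S \<subseteq> cball x0 R" by auto
  have ae: "AE x in lborel. x \<noteq> x0" by (rule AE_lborel_singleton)
  have ip: "integrable lborel (\<lambda>x. \<kappa> n x * f (proj x))" for n
  proof (rule Bochner_Integration.integrable_bound)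
    show "integrable lborel (\<lambda>x. B * \<kappa> n x)" using ik by simp
    show "AE x in lborel. norm (\<kappa> n x * f (proj x)) \<le> norm (B * \<kappa> n x)"
      using ae
    proof eventually_elim
      case (elim x)
      then have "\<bar>f (proj x)\<bar> \<le> B" using B proj_sphere S_sub by blast
      then have "\<kappa> n x * \<bar>f (proj x)\<bar> \<le> \<kappa> n x * B" by (intro mult_left_mono kappa_nonneg)
      then show ?case using kappa_nonneg[of n x] B0 by (simp add: abs_mult mult.commute)
    qed
  qed measurable
  have diff: "(\<lambda>n. (\<integral>x. \<kappa> n x * f x \<partial>lborel) - (\<integral>x. \<kappa> n x * f (proj x) \<partial>lborel)) \<longlonglongrightarrow> 0"
  proof (rule LIMSEQ_I)
    fix e :: real assume e: "0 < e"
    obtain K where K: "\<And>n. ?k n \<le> K" "0 < K"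
      using convergent_imp_Bseq[of ?k] M by (auto simp: convergent_def Bseq_def)
        (metis abs_le_D1)
    define e' where "e' = e / (2 * K)"
    have e': "0 < e'" using e K by (simp add: e'_def)
    have "uniformly_continuous_on (cball x0 R) f" by (rule compact_uniformly_continuous[OF cf]) simp
    then obtain d where d: "0 < d" "\<And>x y. x \<in> cball x0 R \<Longrightarrow> y \<in> cball x0 R \<Longrightarrow> dist y x < d \<Longrightarrow> dist (f y) (f x) < e'"
      unfolding uniformly_continuous_on_def using e' by metis
    \<comment> \<open>Points at distance more than \<open>r\<close> from \<open>x0\<close> move by
      less than \<open>d\<close> under \<open>proj\<close>.\<close>
    define r where "r = R - min d R / 2"
    have r: "0 < r" "r < R" "R - r < d" using d R_pos by (auto simp: r_def min_def)
    define c where "c = (R\<^sup>2 - r\<^sup>2) / 2"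
    have "r\<^sup>2 < R\<^sup>2" using r by (intro power_strict_mono) auto
    then have c: "0 < c" "r\<^sup>2 + c < R\<^sup>2" by (auto simp: c_def field_simps)
    have "(\<lambda>n. (rad n)\<^sup>2) \<longlonglongrightarrow> R\<^sup>2" by (intro tendsto_intros rad_tendsto)
    then have ev1: "eventually (\<lambda>n. r\<^sup>2 + c < (rad n)\<^sup>2) sequentially" using c by (intro order_tendstoD)
    \<comment> \<open>\<open>D / real n\<close> will be the contribution of the inner ball:
      oscillation \<open>2 * B\<close>, times the bound for \<open>\<kappa> n\<close> there, times a
      volume.\<close>
    define D where "D = 2 * B * (2 * R\<^sup>2 / c\<^sup>2) * measure lborel (cball x0 R)"
    have "(\<lambda>n. D / real n) \<longlonglongrightarrow> 0" by (rule lim_const_over_n)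
    then have ev2: "eventually (\<lambda>n. D / real n < e / 2) sequentially" using e by (intro order_tendstoD) auto
    have "eventually (\<lambda>n. norm ((\<integral>x. \<kappa> n x * f x \<partial>lborel) - (\<integral>x. \<kappa> n x * f (proj x) \<partial>lborel) - 0) < e) sequentially"
      using ev1 ev2 eventually_gt_at_top[of 0]
    proof eventually_elim
      case (elim n)
      \<comment> \<open>On the inner ball the gap stays above \<open>c\<close>, and
        \<open>flat_exp 2 s\<close> is at most 1/s^2; this beats the factor \<open>n\<close> in
        \<open>\<kappa>\<close> and leaves a bound of order 1/n.\<close>
      have inner: "\<kappa> n x \<le> 2 * R\<^sup>2 / c\<^sup>2 / real n" if x: "norm (x - x0) \<le> r" for x
      proof -
        have "(norm (x - x0))\<^sup>2 \<le> r\<^sup>2" using x by (intro power_mono) auto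
        then have g: "c \<le> gap n x" using elim(1) by (simp add: gap_def)
        then have "flat_exp 2 (real n * gap n x) \<le> 1 / (real n * gap n x)\<^sup>2"
          using c elim by (intro flat_exp_2_bounds) auto
        also have "\<dots> \<le> 1 / (real n * c)\<^sup>2"
          using g c elim by (intro divide_left_mono power_mono mult_left_mono) auto
        finally have "flat_exp 2 (real n * gap n x) \<le> 1 / (real n * c)\<^sup>2" .
        moreover have "(norm (x - x0))\<^sup>2 \<le> R\<^sup>2" using x r by (intro power_mono) auto
        ultimately have "\<kappa> n x \<le> 2 * real n * R\<^sup>2 * (1 / (real n * c)\<^sup>2)"
          unfolding \<kappa>_def by (intro mult_mono flat_exp_2_bounds) auto
        also have "\<dots> = 2 * R\<^sup>2 / c\<^sup>2 / real n" using elim c by (simp add: power_mult_distrib power2_eq_square)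
        finally show ?thesis .
      qed
      let ?b = "\<lambda>x. e' * \<kappa> n x + 2 * B * (2 * R\<^sup>2 / c\<^sup>2 / real n) * indicator (cball x0 R) x"
      have ib: "integrable lborel ?b"
        using ik emeasure_lborel_cball_finite[of x0 R]
        by (intro Bochner_Integration.integrable_add integrable_mult_right integrable_real_indicator) auto
      have pw: "\<bar>\<kappa> n x * f x - \<kappa> n x * f (proj x)\<bar> \<le> ?b x" if x: "x \<noteq> x0" for x
      proof (cases "x \<in> cball x0 (rad n)")
        case False
        then have "\<kappa> n x = 0" by (rule kappa_outside)
        then show ?thesis using B0 by (simp add: indicator_def)
      next
        case True
        then have xO: "x \<in> \<Omega>" using rad_bounds(2)[of n] by simp
        then have xc: "x \<in> cball x0 R" by simp
        have pc: "proj x \<in> cball x0 R" using proj_sphere[OF x] by auto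
        have eq: "\<bar>\<kappa> n x * f x - \<kappa> n x * f (proj x)\<bar> = \<kappa> n x * \<bar>f x - f (proj x)\<bar>"
          using kappa_nonneg[of n x] by (simp add: abs_mult flip: right_diff_distrib)
        show ?thesis
        proof (cases "norm (x - x0) \<le> r")
          case True
          have "\<bar>f x - f (proj x)\<bar> \<le> 2 * B" using B[OF xc] B[OF pc] by linarith
          then have "\<kappa> n x * \<bar>f x - f (proj x)\<bar> \<le> (2 * R\<^sup>2 / c\<^sup>2 / real n) * (2 * B)"
            using inner[OF True] kappa_nonneg[of n x] by (intro mult_mono) auto
          moreover have "0 \<le> e' * \<kappa> n x" using e' kappa_nonneg by simp
          ultimately show ?thesis unfolding eq using xc by (simp add: mult_ac)
        next
          case False
          then have "dist (proj x) x < d" using proj_dist[OF xO x] r by simp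
          then have "\<bar>f x - f (proj x)\<bar> \<le> e'" using d(2)[OF xc pc] by (simp add: dist_real_def abs_minus_commute)
          then have "\<kappa> n x * \<bar>f x - f (proj x)\<bar> \<le> \<kappa> n x * e'" using kappa_nonneg by (intro mult_left_mono) auto
          moreover have "0 \<le> 2 * B * (2 * R\<^sup>2 / c\<^sup>2 / real n) * indicator (cball x0 R) x"
            using B0 by (intro mult_nonneg_nonneg) auto
          ultimately show ?thesis unfolding eq by (simp add: mult.commute)
        qed
      qed
      have "\<bar>(\<integral>x. \<kappa> n x * f x \<partial>lborel) - (\<integral>x. \<kappa> n x * f (proj x) \<partial>lborel)\<bar>
          = \<bar>\<integral>x. \<kappa> n x * f x - \<kappa> n x * f (proj x) \<partial>lborel\<bar>"
        using kappa_integrable_mult[OF f] ip by simp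
      also have "\<dots> \<le> (\<integral>x. ?b x \<partial>lborel)"
      proof (rule integral_abs_bound[THEN order_trans], rule integral_mono_AE[OF _ ib])
        show "integrable lborel (\<lambda>x. \<bar>\<kappa> n x * f x - \<kappa> n x * f (proj x)\<bar>)"
          using kappa_integrable_mult[OF f] ip by auto
        show "AE x in lborel. \<bar>\<kappa> n x * f x - \<kappa> n x * f (proj x)\<bar> \<le> ?b x"
          using ae by eventually_elim (rule pw)
      qed
      also have "\<dots> = e' * ?k n + D / real n"
      proof -
        have "(\<integral>x. ?b x \<partial>lborel) = (\<integral>x. e' * \<kappa> n x \<partial>lborel) + (\<integral>x. 2 * B * (2 * R\<^sup>2 / c\<^sup>2 / real n) * indicator (cball x0 R) x \<partial>lborel)"
          using ik emeasure_lborel_cball_finite[of x0 R]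
          by (intro Bochner_Integration.integral_add integrable_mult_right integrable_real_indicator) auto
        then show ?thesis by (simp add: D_def)
      qed
      also have "\<dots> < e"
      proof -
        have "e' * ?k n \<le> e' * K" using K e' by (intro mult_left_mono) auto
        also have "\<dots> = e / 2" using K by (simp add: e'_def)
        finally show ?thesis using elim(2) by linarith
      qed
      finally show ?case by simp
    qed
    then show "\<exists>no. \<forall>n\<ge>no. norm ((\<integral>x. \<kappa> n x * f x \<partial>lborel) - (\<integral>x. \<kappa> n x * f (proj x) \<partial>lborel) - 0) < e"
      by (simp add: eventually_sequentially)
  qed
  have "(\<integral>x. \<kappa> n x * f (proj x) \<partial>lborel) = ?k n / P * (\<integral>x. f x \<partial>\<mu>)" for n
    using integral_kappa_proj[OF f, of n] P by (simp add: field_simps)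
  then have "(\<lambda>n. \<integral>x. \<kappa> n x * f (proj x) \<partial>lborel) \<longlonglongrightarrow> M / P * (\<integral>x. f x \<partial>\<mu>)"
    using M P by (auto intro!: tendsto_intros)
  from tendsto_add[OF diff this] show ?thesis by simp
qed


section \<open>Integration over the ball and the divergence formula\<close>

lemma Omega_lebesgue_on:
  fixes f :: "'a \<Rightarrow> real"
  assumes f: "continuous_on UNIV f" "\<And>x. x \<notin> \<Omega> \<Longrightarrow> f x = 0"
  shows "(LINT x|lebesgue_on \<Omega>. f x) = (LINT x|lborel. f x)"
proof -
  have "(LINT x|lebesgue_on \<Omega>. f x) = (LINT x|lebesgue. indicator \<Omega> x *\<^sub>R f x)"
    by (simp add: integral_restrict_space)
  also have "(\<lambda>x. indicator \<Omega> x *\<^sub>R f x) = f"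
    using f(2) by (force simp: indicator_def)
  also have "(LINT x|lebesgue. f x) = (LINT x|lborel. f x)"
    using borel_measurable_continuous_onI[OF f(1)] by (intro integral_completion) simp
  finally show ?thesis .
qed

lemma Omega_integrable_continuous:
  fixes f :: "'a \<Rightarrow> 'b::euclidean_space"
  assumes "continuous_on (cball x0 R) f"
  shows "integrable (lebesgue_on \<Omega>) f"
proof -
  have "integrable (lebesgue_on (cball x0 R)) f"
    using assms by (intro continuous_integrable_lebesgue_on) simp
  then have "integrable lebesgue (\<lambda>x. indicator (cball x0 R) x *\<^sub>R f x)"
    by (simp add: integrable_restrict_space)
  from integrable_mult_indicator[OF Omega_sets(1) this]
  have "integrable lebesgue (\<lambda>x. indicator \<Omega> x *\<^sub>R indicator (cball x0 R) x *\<^sub>R f x)" .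
  also have "(\<lambda>x. indicator \<Omega> x *\<^sub>R indicator (cball x0 R) x *\<^sub>R f x) = (\<lambda>x. indicator \<Omega> x *\<^sub>R f x)"
    by (auto simp: indicator_def)
  finally show ?thesis by (simp add: integrable_restrict_space)
qed

lemma Omega_measurable_continuous: "continuous_on (cball x0 R) f \<Longrightarrow> f \<in> borel_measurable (lebesgue_on \<Omega>)"
  for f :: "'a \<Rightarrow> 'b::euclidean_space"
  by (rule borel_measurable_integrable[OF Omega_integrable_continuous])

lemma finite_measure_Omega: "finite_measure (lebesgue_on \<Omega>)"
  by (rule finite_measure_lebesgue_on) simp

lemma measure_Omega: "measure (lebesgue_on \<Omega>) (space (lebesgue_on \<Omega>)) = vol"
  by (simp add: vol_def measure_restrict_space)

lemma Omega_integrable_inner: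
  fixes G X :: "'a \<Rightarrow> 'a"
  assumes G: "integrable (lebesgue_on \<Omega>) G" and X: "continuous_on (cball x0 R) X"
  shows "integrable (lebesgue_on \<Omega>) (\<lambda>x. G x \<bullet> X x)"
proof -
  have "bounded (X ` cball x0 R)" by (intro compact_imp_bounded compact_continuous_image X) simp
  then obtain B where B: "\<forall>x\<in>cball x0 R. norm (X x) \<le> B" by (auto simp: bounded_iff)
  show ?thesis
  proof (rule Bochner_Integration.integrable_bound)
    show "integrable (lebesgue_on \<Omega>) (\<lambda>x. B * norm (G x))" by (intro integrable_mult_right integrable_norm G)
    show "(\<lambda>x. G x \<bullet> X x) \<in> borel_measurable (lebesgue_on \<Omega>)"
      using G Omega_measurable_continuous[OF X] by (intro borel_measurable_inner) auto
    show "AE x in lebesgue_on \<Omega>. norm (G x \<bullet> X x) \<le> norm (B * norm (G x))"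
    proof (rule AE_I2)
      fix x assume "x \<in> space (lebesgue_on \<Omega>)"
      then have "norm (X x) \<le> B" using B by (auto simp: space_restrict_space)
      then have "norm (G x) * norm (X x) \<le> norm (G x) * \<bar>B\<bar>" by (intro mult_left_mono) auto
      then show "norm (G x \<bullet> X x) \<le> norm (B * norm (G x))"
        using Cauchy_Schwarz_ineq2[of "G x" "X x"] by (simp add: abs_mult mult.commute)
    qed
  qed
qed

lemma radial_derivative:
  assumes \<psi>: "\<And>k. Ck k \<psi>"
  shows "frechet_derivative \<psi> (at x) h = (\<Sum>b\<in>Basis. (h \<bullet> b) * frechet_derivative \<psi> (at x) b)"
    "continuous_on UNIV (\<lambda>x. frechet_derivative \<psi> (at x) (x - x0))"
proof -
  have D: "(\<psi> has_derivative frechet_derivative \<psi> (at x)) (at x)" for x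
    by (rule Ck_SucD(1)[OF \<psi>[of "Suc 0"]])
  show *: "frechet_derivative \<psi> (at x) h = (\<Sum>b\<in>Basis. (h \<bullet> b) * frechet_derivative \<psi> (at x) b)" for x h
  proof -
    have lin: "linear (frechet_derivative \<psi> (at x))" by (rule has_derivative_linear[OF D])
    have "frechet_derivative \<psi> (at x) h = frechet_derivative \<psi> (at x) (\<Sum>b\<in>Basis. (h \<bullet> b) *\<^sub>R b)"
      by (simp add: euclidean_representation)
    then show ?thesis by (simp add: linear_sum[OF lin] linear_scale[OF lin])
  qed
  have "continuous_on UNIV (\<lambda>x. frechet_derivative \<psi> (at x) b)" if "b \<in> Basis" for b
    using Ck_SucD(2)[OF \<psi>[of "Suc 0"] that] by simp
  then show "continuous_on UNIV (\<lambda>x. frechet_derivative \<psi> (at x) (x - x0))"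
    unfolding *[of _ "_ - x0"] by (intro continuous_intros)
qed

text \<open>The weak gradient is tested in each coordinate direction with the matching component of
  the field \<eta> \<psi> (x - x0), and the results are added. The divergence of this field is N
  \<eta> \<psi> - \<kappa> \<psi> + \<eta> D\<psi>(x - x0).\<close>

lemma divergence_cutoff:
  assumes w: "is_weak_gradient \<Omega> w G" and \<psi>: "\<And>k. Ck k \<psi>"
  shows "(LINT x|lebesgue_on \<Omega>. w x * (real DIM('a) * (\<eta> n x * \<psi> x) - \<kappa> n x * \<psi> x
        + \<eta> n x * frechet_derivative \<psi> (at x) (x - x0)))
      = - (LINT x|lebesgue_on \<Omega>. (G x \<bullet> (x - x0)) * (\<eta> n x * \<psi> x))"
proof -
  define \<phi> where "\<phi> b x = ((x - x0) \<bullet> b) * (\<eta> n x * \<psi> x)" for b x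
  define F where "F = (\<lambda>x. 2 * real n * flat_exp 2 (real n * gap n x))"
  have D\<psi>: "(\<psi> has_derivative frechet_derivative \<psi> (at x)) (at x)" for x
    by (rule Ck_SucD(1)[OF \<psi>[of "Suc 0"]])
  have test: "\<phi> b \<in> test_functions \<Omega>" for b
  proof -
    have "Ck k (\<phi> b)" for k unfolding \<phi>_def by (intro Ck_mult Ck_inner Ck_eta \<psi>)
    moreover have "\<forall>x. x \<notin> cball x0 (rad n) \<longrightarrow> \<phi> b x = 0" by (simp add: \<phi>_def eta_outside del: mem_cball)
    moreover have "cball x0 (rad n) \<subseteq> \<Omega>" using rad_bounds(2)[of n] by auto
    ultimately show ?thesis unfolding test_functions_def by (intro CollectI conjI allI exI[of _ "cball x0 (rad n)"]) auto
  qed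
  have d\<phi>: "frechet_derivative (\<phi> b) (at x) b = ((x - x0) \<bullet> b) * (\<eta> n x * frechet_derivative \<psi> (at x) b)
      - F x * ((x - x0) \<bullet> b) * ((x - x0) \<bullet> b) * \<psi> x + \<eta> n x * \<psi> x" if b: "b \<in> Basis" for b x
  proof -
    have "((\<lambda>x. (x - x0) \<bullet> b) has_derivative (\<lambda>h. h \<bullet> b)) (at x)" by (auto intro!: derivative_eq_intros)
    from has_derivative_mult[OF this has_derivative_mult[OF eta_derivative D\<psi>]]
    have "(\<phi> b has_derivative (\<lambda>h. ((x - x0) \<bullet> b) * (\<eta> n x * frechet_derivative \<psi> (at x) h
        + (- F x * ((x - x0) \<bullet> h)) * \<psi> x) + (h \<bullet> b) * (\<eta> n x * \<psi> x))) (at x)"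
      unfolding \<phi>_def F_def .
    from frechet_derivative_at[OF this, symmetric] show ?thesis
      using b by (simp add: algebra_simps)
  qed
  have sum1: "(\<Sum>b\<in>Basis. w x * frechet_derivative (\<phi> b) (at x) b) = w x * (real DIM('a) * (\<eta> n x * \<psi> x) - \<kappa> n x * \<psi> x
        + \<eta> n x * frechet_derivative \<psi> (at x) (x - x0))" for x
  proof -
    have "(\<Sum>b\<in>Basis. frechet_derivative (\<phi> b) (at x) b)
        = (\<Sum>b\<in>Basis. ((x - x0) \<bullet> b) * (\<eta> n x * frechet_derivative \<psi> (at x) b))
          - (\<Sum>b\<in>Basis. F x * ((x - x0) \<bullet> b) * ((x - x0) \<bullet> b) * \<psi> x) + (\<Sum>b\<in>(Basis::'a set). \<eta> n x * \<psi> x)"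
      by (simp add: d\<phi> sum.distrib sum_subtractf)
    also have "(\<Sum>b\<in>Basis. ((x - x0) \<bullet> b) * (\<eta> n x * frechet_derivative \<psi> (at x) b)) = \<eta> n x * frechet_derivative \<psi> (at x) (x - x0)"
      unfolding radial_derivative(1)[OF \<psi>, of x "x - x0"] by (simp add: sum_distrib_left mult_ac)
    also have "(\<Sum>b\<in>Basis. F x * ((x - x0) \<bullet> b) * ((x - x0) \<bullet> b) * \<psi> x) = F x * (norm (x - x0))\<^sup>2 * \<psi> x"
      unfolding norm_sq_eq_sum[of "x - x0"] by (simp add: sum_distrib_left sum_distrib_right mult_ac)
    also have "F x * (norm (x - x0))\<^sup>2 = \<kappa> n x" by (simp add: F_def \<kappa>_def)
    finally have e: "(\<Sum>b\<in>Basis. frechet_derivative (\<phi> b) (at x) b)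
        = \<eta> n x * frechet_derivative \<psi> (at x) (x - x0) - \<kappa> n x * \<psi> x + real DIM('a) * (\<eta> n x * \<psi> x)" by simp
    show ?thesis unfolding sum_distrib_left[symmetric] e by (simp add: algebra_simps)
  qed
  have sum2: "(\<Sum>b\<in>Basis. (G x \<bullet> b) * \<phi> b x) = (G x \<bullet> (x - x0)) * (\<eta> n x * \<psi> x)" for x
    unfolding euclidean_inner[of "G x" "x - x0"] by (simp add: \<phi>_def sum_distrib_right mult.assoc)
  have "(LINT x|lebesgue_on \<Omega>. (\<Sum>b\<in>Basis. w x * frechet_derivative (\<phi> b) (at x) b))
      = (\<Sum>b\<in>Basis. LINT x|lebesgue_on \<Omega>. w x * frechet_derivative (\<phi> b) (at x) b)"
    using is_weak_gradient_integrable(1)[OF w test] by (intro Bochner_Integration.integral_sum) simp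
  also have "\<dots> = (\<Sum>b\<in>Basis. - (LINT x|lebesgue_on \<Omega>. (G x \<bullet> b) * \<phi> b x))"
    using w test by (intro sum.cong) (auto simp: is_weak_gradient_def)
  also have "\<dots> = - (LINT x|lebesgue_on \<Omega>. (\<Sum>b\<in>Basis. (G x \<bullet> b) * \<phi> b x))"
    using is_weak_gradient_integrable(2)[OF w test] by (simp add: Bochner_Integration.integral_sum sum_negf)
  finally show ?thesis unfolding sum1 sum2 .
qed

text \<open>With \<open>w = 1\<close> and \<open>\<psi> = 1\<close> the gradient side vanishes, so
  the mass of \<open>\<kappa> n\<close> is N times the integral of \<open>\<eta> n\<close>, which
  tends to the volume.\<close>

lemma kappa_mass_limit: "(\<lambda>n. LINT x|lborel. \<kappa> n x) \<longlonglongrightarrow> real DIM('a) * vol"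
proof -
  interpret F: finite_measure "lebesgue_on \<Omega>" by (rule finite_measure_Omega)
  have w: "is_weak_gradient \<Omega> (\<lambda>x. 1) (\<lambda>x. 0)"
    by (rule is_weak_gradient_C1) auto
  have eta_c: "continuous_on A (\<eta> n)" for A n
    by (rule continuous_on_subset[OF Ck_continuous[OF Ck_eta[of 0]]]) simp
  have eta_i: "integrable (lebesgue_on \<Omega>) (\<eta> n)" for n by (rule Omega_integrable_continuous[OF eta_c])
  have kappa_i: "integrable (lebesgue_on \<Omega>) (\<kappa> n)" for n
    by (rule Omega_integrable_continuous) (rule continuous_on_subset[OF kappa_continuous], simp)
  have "(LINT x|lborel. \<kappa> n x) = real DIM('a) * (LINT x|lebesgue_on \<Omega>. \<eta> n x)" for n
  proof -
    have "\<kappa> n x = 0" if "x \<notin> \<Omega>" for x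
      using that rad_bounds(2)[of n] by (intro kappa_outside) auto
    then have "(LINT x|lborel. \<kappa> n x) = (LINT x|lebesgue_on \<Omega>. \<kappa> n x)"
      by (intro Omega_lebesgue_on[symmetric] kappa_continuous)
    moreover have "frechet_derivative (\<lambda>x::'a. 1 :: real) (at x) h = 0" for x h
      using frechet_derivative_at[OF has_derivative_const[of "1::real" "at x"], symmetric] by simp
    then have "(LINT x|lebesgue_on \<Omega>. real DIM('a) * \<eta> n x - \<kappa> n x) = 0"
      using divergence_cutoff[OF w Ck_const[of _ 1], of n] by simp
    ultimately show ?thesis using eta_i kappa_i by simp
  qed
  moreover have "(\<lambda>n. LINT x|lebesgue_on \<Omega>. \<eta> n x) \<longlonglongrightarrow> (LINT x|lebesgue_on \<Omega>. 1)"
  proof (rule integral_dominated_convergence[where w = "\<lambda>_. 1"])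
    show "AE x in lebesgue_on \<Omega>. (\<lambda>n. \<eta> n x) \<longlonglongrightarrow> 1"
      by (rule AE_I2) (simp add: eta_tendsto space_restrict_space)
  qed (use eta_i eta_bounds in auto)
  moreover have "(LINT x|lebesgue_on \<Omega>. 1) = vol" using measure_Omega by (simp add: space_restrict_space)
  ultimately show ?thesis by (auto intro!: tendsto_intros)
qed

lemma kappa_limit': "continuous_on UNIV f \<Longrightarrow>
    (\<lambda>n. LINT x|lborel. \<kappa> n x * f x) \<longlonglongrightarrow> real DIM('a) * vol / P * (LINT x|\<mu>. f x)"
  by (rule kappa_limit[OF _ kappa_mass_limit])

text \<open>The limit of the cut-off identity. Classically the factor before the boundary integral
  is \<open>R\<close>, the normal component of x - x0 on the sphere; expressed as N
  \<open>vol\<close> / \<open>P\<close> it needs no formula for the area.\<close>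

proposition divergence_theorem:
  assumes w: "is_weak_gradient \<Omega> w G" and cw: "continuous_on (cball x0 R) w"
    and G: "integrable (lebesgue_on \<Omega>) G" and \<psi>: "\<And>k. Ck k \<psi>"
  shows "(LINT x|lebesgue_on \<Omega>. w x * (real DIM('a) * \<psi> x + frechet_derivative \<psi> (at x) (x - x0))
          + (G x \<bullet> (x - x0)) * \<psi> x)
      = real DIM('a) * vol / P * (LINT x|\<mu>. w x * \<psi> x)"
proof -
  let ?D = "\<lambda>x. frechet_derivative \<psi> (at x) (x - x0)"
  let ?A = "\<lambda>x. w x * (real DIM('a) * \<psi> x + ?D x) + (G x \<bullet> (x - x0)) * \<psi> x"
  have c\<psi>: "continuous_on A \<psi>" for A by (rule continuous_on_subset[OF Ck_continuous[OF \<psi>[of 0]]]) simp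
  have cD: "continuous_on A ?D" for A by (rule continuous_on_subset[OF radial_derivative(2)[OF \<psi>]]) simp
  have c\<eta>: "continuous_on A (\<eta> n)" for A n
    by (rule continuous_on_subset[OF Ck_continuous[OF Ck_eta[of 0]]]) simp
  have c\<kappa>: "continuous_on A (\<kappa> n)" for A n by (rule continuous_on_subset[OF kappa_continuous]) simp
  have iG: "integrable (lebesgue_on \<Omega>) (\<lambda>x. (G x \<bullet> (x - x0)) * (\<theta> x * \<psi> x))" if "continuous_on (cball x0 R) \<theta>" for \<theta>
  proof -
    have "integrable (lebesgue_on \<Omega>) (\<lambda>x. G x \<bullet> ((\<theta> x * \<psi> x) *\<^sub>R (x - x0)))"
      by (intro Omega_integrable_inner G continuous_intros c\<psi> that)
    then show ?thesis by (simp add: mult.commute)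
  qed
  have iA: "integrable (lebesgue_on \<Omega>) ?A"
  proof (rule Bochner_Integration.integrable_add)
    show "integrable (lebesgue_on \<Omega>) (\<lambda>x. w x * (real DIM('a) * \<psi> x + ?D x))"
      by (intro Omega_integrable_continuous continuous_intros cw c\<psi> cD)
    show "integrable (lebesgue_on \<Omega>) (\<lambda>x. (G x \<bullet> (x - x0)) * \<psi> x)"
      using iG[of "\<lambda>_. 1"] by simp
  qed
  have eq: "(LINT x|lebesgue_on \<Omega>. w x * (\<kappa> n x * \<psi> x)) = (LINT x|lebesgue_on \<Omega>. \<eta> n x * ?A x)" for n
  proof -
    let ?B = "\<lambda>x. w x * (real DIM('a) * (\<eta> n x * \<psi> x) - \<kappa> n x * \<psi> x + \<eta> n x * ?D x)"
    let ?C = "\<lambda>x. (G x \<bullet> (x - x0)) * (\<eta> n x * \<psi> x)"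
    have iB: "integrable (lebesgue_on \<Omega>) ?B"
      by (intro Omega_integrable_continuous continuous_intros cw c\<psi> cD c\<eta> c\<kappa>)
    have iC: "integrable (lebesgue_on \<Omega>) ?C" by (rule iG[OF c\<eta>])
    have iK: "integrable (lebesgue_on \<Omega>) (\<lambda>x. w x * (\<kappa> n x * \<psi> x))"
      by (intro Omega_integrable_continuous continuous_intros cw c\<psi> c\<kappa>)
    have "(LINT x|lebesgue_on \<Omega>. \<eta> n x * ?A x) = (LINT x|lebesgue_on \<Omega>. (?B x + w x * (\<kappa> n x * \<psi> x)) + ?C x)"
      by (intro Bochner_Integration.integral_cong refl) (simp add: algebra_simps)
    also have "\<dots> = (LINT x|lebesgue_on \<Omega>. ?B x) + (LINT x|lebesgue_on \<Omega>. w x * (\<kappa> n x * \<psi> x)) + (LINT x|lebesgue_on \<Omega>. ?C x)"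
      by (simp only: Bochner_Integration.integral_add[OF Bochner_Integration.integrable_add[OF iB iK] iC]
          Bochner_Integration.integral_add[OF iB iK])
    also have "(LINT x|lebesgue_on \<Omega>. ?B x) = - (LINT x|lebesgue_on \<Omega>. ?C x)"
      by (rule divergence_cutoff[OF w \<psi>])
    finally show ?thesis by simp
  qed
  have "(\<lambda>n. LINT x|lebesgue_on \<Omega>. \<eta> n x * ?A x) \<longlonglongrightarrow> (LINT x|lebesgue_on \<Omega>. ?A x)"
  proof (rule integral_dominated_convergence)
    show "integrable (lebesgue_on \<Omega>) (\<lambda>x. norm (?A x))" using iA by (rule integrable_norm)
    show "?A \<in> borel_measurable (lebesgue_on \<Omega>)" using iA by (rule borel_measurable_integrable)
    then show "(\<lambda>x. \<eta> n x * ?A x) \<in> borel_measurable (lebesgue_on \<Omega>)" for n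
      using Omega_measurable_continuous[OF c\<eta>] by (rule borel_measurable_times[rotated])
    show "AE x in lebesgue_on \<Omega>. (\<lambda>n. \<eta> n x * ?A x) \<longlonglongrightarrow> ?A x"
    proof (rule AE_I2)
      fix x assume "x \<in> space (lebesgue_on \<Omega>)"
      then have "(\<lambda>n. \<eta> n x) \<longlonglongrightarrow> 1" by (intro eta_tendsto) (simp add: space_restrict_space)
      from tendsto_mult[OF this tendsto_const] show "(\<lambda>n. \<eta> n x * ?A x) \<longlonglongrightarrow> ?A x" by simp
    qed
    show "AE x in lebesgue_on \<Omega>. norm (\<eta> n x * ?A x) \<le> norm (?A x)" for n
    proof (rule AE_I2)
      fix x
      show "norm (\<eta> n x * ?A x) \<le> norm (?A x)"
        using eta_bounds[of n x] unfolding norm_mult by (intro mult_left_le_one_le) auto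
    qed
  qed
  moreover
  \<comment> \<open>\<open>w\<close> is continuous only on the closed ball, while the limit lemma
    asks for continuity everywhere; the nearest-point map onto the ball provides a continuous
    extension.\<close>
  define c where "c = closest_point (cball x0 R)"
  have cc: "continuous_on UNIV c" "\<And>x. c x \<in> cball x0 R" "\<And>x. x \<in> cball x0 R \<Longrightarrow> c x = x"
    unfolding c_def using R_pos
    by (auto intro!: continuous_on_closest_point closest_point_in_set closest_point_self simp del: mem_cball)
  define f where "f x = w (c x) * \<psi> (c x)" for x
  have f: "continuous_on UNIV f"
    unfolding f_def using cc(2) by (intro continuous_intros continuous_on_compose2[OF cw cc(1)] continuous_on_compose2[OF c\<psi>[of UNIV] cc(1)]) auto
  have "(LINT x|lebesgue_on \<Omega>. w x * (\<kappa> n x * \<psi> x)) = (LINT x|lborel. \<kappa> n x * f x)" for n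
  proof -
    have "(LINT x|lebesgue_on \<Omega>. w x * (\<kappa> n x * \<psi> x)) = (LINT x|lebesgue_on \<Omega>. \<kappa> n x * f x)"
      using cc(3) by (intro Bochner_Integration.integral_cong refl) (auto simp: f_def space_restrict_space)
    also have "\<dots> = (LINT x|lborel. \<kappa> n x * f x)"
    proof (rule Omega_lebesgue_on)
      show "continuous_on UNIV (\<lambda>x. \<kappa> n x * f x)" by (intro continuous_intros c\<kappa> f)
      show "\<kappa> n x * f x = 0" if "x \<notin> \<Omega>" for x
        using that rad_bounds(2)[of n] kappa_outside[of x n] by auto
    qed
    finally show ?thesis .
  qed
  moreover have "(LINT x|\<mu>. f x) = (LINT x|\<mu>. w x * \<psi> x)"
    using cc(3) by (intro Bochner_Integration.integral_cong refl) (auto simp: f_def)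
  ultimately show ?thesis
    using kappa_limit'[OF f] LIMSEQ_unique by (simp add: eq)
qed

end

section \<open>Traces of continuous functions\<close>

lemma powr_add_le:
  fixes a b p :: real
  assumes "0 \<le> a" "0 \<le> b" "1 \<le> p"
  shows "(a + b) powr p \<le> 2 powr p * (a powr p + b powr p)"
proof -
  have "(a + b) powr p \<le> (2 * max a b) powr p" using assms by (intro powr_mono2) auto
  also have "\<dots> = 2 powr p * (max a b) powr p" using assms by (simp add: powr_mult)
  also have "\<dots> \<le> 2 powr p * (a powr p + b powr p)"
    by (intro mult_left_mono) (auto simp: max_def)
  finally show ?thesis .
qed

text \<open>On a finite measure space this passes from convergence in L^p to convergence in L^1
  without Hoelder's inequality: the constant part is small with \<open>e\<close>, the power part
  tends to 0 for fixed \<open>e\<close>.\<close>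

lemma le_powr_eps:
  fixes x e p :: real
  assumes "0 \<le> x" "0 < e" "1 \<le> p"
  shows "x \<le> e + e powr (1 - p) * x powr p"
proof (cases "x \<le> e")
  case False
  then have x: "e < x" by simp
  have "x = x powr (1 - p) * x powr p" using assms x by (simp flip: powr_add)
  also have "\<dots> \<le> e powr (1 - p) * x powr p"
    using assms x by (intro mult_right_mono powr_mono2') auto
  finally show ?thesis using assms by simp
qed (use assms in \<open>simp add: add_increasing2\<close>)

lemma Lp_add_scaled:
  fixes v w :: "'a \<Rightarrow> 'b::euclidean_space"
  assumes v: "v \<in> Lp M p" and w: "w \<in> Lp M p" and p: "1 \<le> p"
  shows "(\<lambda>x. v x + c *\<^sub>R w x) \<in> Lp M p"
proof -
  have [measurable]: "v \<in> borel_measurable M" "w \<in> borel_measurable M" using v w by (auto simp: Lp_def)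
  have "integrable M (\<lambda>x. norm (v x + c *\<^sub>R w x) powr p)"
  proof (rule Bochner_Integration.integrable_bound)
    show "integrable M (\<lambda>x. 2 powr p * (norm (v x) powr p + \<bar>c\<bar> powr p * norm (w x) powr p))"
      using v w by (auto simp: Lp_def)
    have "norm (v x + c *\<^sub>R w x) powr p \<le> 2 powr p * (norm (v x) powr p + \<bar>c\<bar> powr p * norm (w x) powr p)" for x
    proof -
      have "norm (v x + c *\<^sub>R w x) powr p \<le> (norm (v x) + \<bar>c\<bar> * norm (w x)) powr p"
        using p norm_triangle_ineq[of "v x" "c *\<^sub>R w x"] by (intro powr_mono2) auto
      also have "\<dots> \<le> 2 powr p * (norm (v x) powr p + (\<bar>c\<bar> * norm (w x)) powr p)"
        using p by (intro powr_add_le) auto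
      finally show ?thesis by (simp add: powr_mult)
    qed
    then show "AE x in M. norm (norm (v x + c *\<^sub>R w x) powr p) \<le> norm (2 powr p * (norm (v x) powr p + \<bar>c\<bar> powr p * norm (w x) powr p))"
      by (intro AE_I2) simp
  qed measurable
  then show ?thesis by (auto simp: Lp_def)
qed

lemma (in finite_measure) Lp_integrable:
  fixes v :: "'a \<Rightarrow> 'b::euclidean_space"
  assumes v: "v \<in> Lp M p" and p: "1 \<le> p"
  shows "integrable M v"
proof (rule Bochner_Integration.integrable_bound)
  show "integrable M (\<lambda>x. 1 + norm (v x) powr p)" using v by (auto simp: Lp_def)
  show "v \<in> borel_measurable M" using v by (simp add: Lp_def)
  show "AE x in M. norm (v x) \<le> norm (1 + norm (v x) powr p)"
    using le_powr_eps[of "norm (v _)" 1 p] p by (intro AE_I2) simp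
qed

lemma (in finite_measure) Lp_tendsto_imp_L1_tendsto:
  fixes f :: "nat \<Rightarrow> 'a \<Rightarrow> 'b::euclidean_space"
  assumes f: "\<And>k. f k \<in> Lp M p" and p: "1 \<le> p"
    and lim: "(\<lambda>k. \<integral>x. norm (f k x) powr p \<partial>M) \<longlonglongrightarrow> 0"
  shows "(\<lambda>k. \<integral>x. norm (f k x) \<partial>M) \<longlonglongrightarrow> 0"
proof (rule LIMSEQ_I)
  fix r :: real assume r: "0 < r"
  let ?m = "measure M (space M)"
  define e where "e = r / (2 * (?m + 1))"
  have m: "0 \<le> ?m" by simp
  have e: "0 < e" unfolding e_def using r m by (intro divide_pos_pos mult_pos_pos add_nonneg_pos) auto
  have em: "e * ?m < r / 2"
  proof -
    have "e * ?m < e * (?m + 1)" using e by simp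
    also have "\<dots> = r / 2"
    proof -
      have "?m + 1 \<noteq> 0" using m by linarith
      then show ?thesis unfolding e_def by (simp only: divide_divide_eq_left[symmetric] times_divide_eq_left nonzero_mult_div_cancel_right) (simp add: field_simps)
    qed
    finally show ?thesis .
  qed
  have "(\<lambda>k. e * ?m + e powr (1 - p) * (\<integral>x. norm (f k x) powr p \<partial>M)) \<longlonglongrightarrow> e * ?m + e powr (1 - p) * 0"
    by (intro tendsto_intros lim)
  then have "eventually (\<lambda>k. e * ?m + e powr (1 - p) * (\<integral>x. norm (f k x) powr p \<partial>M) < r) sequentially"
    by (rule order_tendstoD(2)) (use em r in simp)
  moreover have "(\<integral>x. norm (f k x) \<partial>M) \<le> e * ?m + e powr (1 - p) * (\<integral>x. norm (f k x) powr p \<partial>M)" for k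
  proof -
    have i: "integrable M (\<lambda>x. norm (f k x) powr p)" using f[of k] by (simp add: Lp_def)
    have "(\<integral>x. norm (f k x) \<partial>M) \<le> (\<integral>x. e + e powr (1 - p) * norm (f k x) powr p \<partial>M)"
      using Lp_integrable[OF f p] i le_powr_eps[OF norm_ge_zero e p] by (intro integral_mono) auto
    also have "\<dots> = e * ?m + e powr (1 - p) * (\<integral>x. norm (f k x) powr p \<partial>M)"
      using i by (simp add: mult.commute)
    finally show ?thesis .
  qed
  ultimately have "eventually (\<lambda>k. norm ((\<integral>x. norm (f k x) \<partial>M) - 0) < r) sequentially"
    by (auto elim!: eventually_mono intro: le_less_trans)
  then show "\<exists>no. \<forall>k\<ge>no. norm ((\<integral>x. norm (f k x) \<partial>M) - 0) < r"
    by (simp add: eventually_sequentially)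
qed

lemma W1pD:
  assumes "v \<in> W1p \<Omega> p" "open \<Omega>"
  shows "v \<in> Lp (lebesgue_on \<Omega>) p" "is_weak_gradient \<Omega> v (weak_gradient \<Omega> v)"
  using assms weak_gradient_AE_eq(2) by (auto simp: W1p_def)

context ball_domain
begin

text \<open>The definition grants integrability only on compact subsets; an exhaustion by the closed
  balls of radius \<open>rad n\<close> gives measurability on the whole ball.\<close>

lemma weak_gradient_measurable:
  assumes G: "is_weak_gradient \<Omega> v G"
  shows "G \<in> borel_measurable (lebesgue_on \<Omega>)"
proof -
  have "(\<lambda>x. indicator \<Omega> x *\<^sub>R G x) \<in> borel_measurable lebesgue"
  proof (rule borel_measurable_LIMSEQ_metric)
    show "(\<lambda>x. indicator (cball x0 (rad n)) x *\<^sub>R G x) \<in> borel_measurable lebesgue" for n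
    proof -
      have "cball x0 (rad n) \<subseteq> \<Omega>" using rad_bounds(2)[of n] by auto
      then have "integrable (lebesgue_on (cball x0 (rad n))) G" using G by (auto simp: is_weak_gradient_def)
      then show ?thesis by (simp add: integrable_restrict_space)
    qed
    fix x
    show "(\<lambda>n. indicator (cball x0 (rad n)) x *\<^sub>R G x) \<longlonglongrightarrow> indicator \<Omega> x *\<^sub>R G x"
    proof (cases "x \<in> \<Omega>")
      case True
      then have "eventually (\<lambda>n. dist x0 x < rad n) sequentially"
        by (intro order_tendstoD[OF rad_tendsto]) simp
      then have "eventually (\<lambda>n. indicator (cball x0 (rad n)) x *\<^sub>R G x = indicator \<Omega> x *\<^sub>R G x) sequentially"
        by eventually_elim (use True in \<open>auto simp: indicator_def\<close>)
      then show ?thesis by (rule tendsto_eventually)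
    next
      case False
      then have "x \<notin> cball x0 (rad n)" for n using rad_bounds(2)[of n] by auto
      then show ?thesis using False by simp
    qed
  qed
  then show ?thesis by (simp add: borel_measurable_restrict_space_iff)
qed

lemma weak_gradient_Lp:
  assumes v: "v \<in> W1p \<Omega> p"
  shows "weak_gradient \<Omega> v \<in> Lp (lebesgue_on \<Omega>) p"
proof -
  obtain G where G: "is_weak_gradient \<Omega> v G" "G \<in> Lp (lebesgue_on \<Omega>) p" using v by (auto simp: W1p_def)
  have m: "weak_gradient \<Omega> v \<in> borel_measurable (lebesgue_on \<Omega>)"
    by (rule weak_gradient_measurable[OF W1pD(2)[OF v open_ball]])
  have "integrable (lebesgue_on \<Omega>) (\<lambda>x. norm (weak_gradient \<Omega> v x) powr p)"
  proof (rule integrable_cong_AE_imp)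
    show "integrable (lebesgue_on \<Omega>) (\<lambda>x. norm (G x) powr p)" using G by (simp add: Lp_def)
    show "(\<lambda>x. norm (weak_gradient \<Omega> v x) powr p) \<in> borel_measurable (lebesgue_on \<Omega>)" using m by measurable
    show "AE x in lebesgue_on \<Omega>. norm (G x) powr p = norm (weak_gradient \<Omega> v x) powr p"
      using weak_gradient_AE_eq(1)[OF G(1) open_ball] by eventually_elim simp
  qed
  then show ?thesis using m by (simp add: Lp_def)
qed

lemma bdry_Lp_continuous: "continuous_on S f \<Longrightarrow> (f :: 'a \<Rightarrow> real) \<in> Lp \<mu> p" if "0 < p"
proof -
  assume f: "continuous_on S f"
  have "continuous_on S (\<lambda>x. norm (f x) powr p)"
    by (rule continuous_on_powr'[OF continuous_on_norm[OF f] continuous_on_const]) (use that in auto)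
  then show ?thesis
    using f by (simp add: Lp_def measurable_bdry_continuous bdry_integrable_continuous)
qed

text \<open>The approximating sequence may be taken constant. This makes the choice in
  \<open>bdry_trace\<close> meaningful for continuous functions.\<close>

lemma continuous_is_trace:
  assumes p: "1 < p" and u: "u \<in> W1p \<Omega> p" "continuous_on (cball x0 R) u"
  shows "is_trace \<Omega> p u u"
  unfolding is_trace_def
proof (intro conjI exI[of _ "\<lambda>_. u"])
  show "u \<in> Lp \<mu> p"
    using p by (intro bdry_Lp_continuous continuous_on_subset[OF u(2)]) auto
qed (use p u in auto)

text \<open>The trace in \<open>J\<close> is picked by a choice operator, so any admissible
  \<open>t\<close> has to be compared with \<open>u\<close>. For the approximating functions
  \<open>w k\<close> the divergence theorem bounds the boundary integrals of
  \<open>(w k - u) * \<psi>\<close> by volume norms that tend to 0, while \<open>w k\<close> tends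
  to \<open>t\<close> on the boundary. Thus \<open>t - u\<close> is orthogonal to all smooth
  \<open>\<psi>\<close>, in particular to the box bumps.\<close>

proposition trace_unique:
  assumes p: "1 < p" and u: "u \<in> W1p \<Omega> p" "continuous_on (cball x0 R) u" and t: "is_trace \<Omega> p u t"
  shows "AE s in \<mu>. t s = u s"
proof -
  have p1: "1 \<le> p" using p by simp
  obtain w where w: "\<And>k. w k \<in> W1p \<Omega> p" "\<And>k. continuous_on (cball x0 R) (w k)"
    and l1: "(\<lambda>k. LINT x|lebesgue_on \<Omega>. \<bar>w k x - u x\<bar> powr p) \<longlonglongrightarrow> 0"
    and l2: "(\<lambda>k. LINT x|lebesgue_on \<Omega>. norm (weak_gradient \<Omega> (w k) x - weak_gradient \<Omega> u x) powr p) \<longlonglongrightarrow> 0"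
    and l3: "(\<lambda>k. LINT \<sigma>|\<mu>. \<bar>w k \<sigma> - t \<sigma>\<bar> powr p) \<longlonglongrightarrow> 0" and tL: "t \<in> Lp \<mu> p"
    using t unfolding is_trace_def by auto
  interpret F: finite_measure "lebesgue_on \<Omega>" by (rule finite_measure_Omega)
  have cu: "continuous_on S u" by (rule continuous_on_subset[OF u(2)]) auto
  have cwS: "continuous_on S (w k)" for k by (rule continuous_on_subset[OF w(2)]) auto
  define z where "z k x = w k x + (-1) *\<^sub>R u x" for k x
  define G where "G k x = weak_gradient \<Omega> (w k) x + (-1) *\<^sub>R weak_gradient \<Omega> u x" for k x
  have zL: "z k \<in> Lp (lebesgue_on \<Omega>) p" for k
    unfolding z_def by (intro Lp_add_scaled W1pD(1)[OF _ open_ball] w u p1)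
  have GL: "G k \<in> Lp (lebesgue_on \<Omega>) p" for k
    unfolding G_def by (intro Lp_add_scaled weak_gradient_Lp w u p1)
  have zG: "is_weak_gradient \<Omega> (z k) (G k)" for k
    using is_weak_gradient_add_scaled[OF W1pD(2)[OF w(1)[of k] open_ball] W1pD(2)[OF u(1) open_ball], of "-1"]
    by (simp add: z_def[abs_def] G_def[abs_def])
  have cz: "continuous_on (cball x0 R) (z k)" for k unfolding z_def by (intro continuous_intros w u)
  have z1: "(\<lambda>k. LINT x|lebesgue_on \<Omega>. norm (z k x)) \<longlonglongrightarrow> 0"
    using l1 by (intro F.Lp_tendsto_imp_L1_tendsto[OF zL p1]) (simp add: z_def)
  have G1: "(\<lambda>k. LINT x|lebesgue_on \<Omega>. norm (G k x)) \<longlonglongrightarrow> 0"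
    using l2 by (intro F.Lp_tendsto_imp_L1_tendsto[OF GL p1]) (simp add: G_def)
  have wt: "(\<lambda>x. w k x + (-1) *\<^sub>R t x) \<in> Lp \<mu> p" for k
    using p by (intro Lp_add_scaled bdry_Lp_continuous cwS tL) auto
  have t1: "(\<lambda>k. LINT x|\<mu>. norm (w k x + (-1) *\<^sub>R t x)) \<longlonglongrightarrow> 0"
    using l3 by (intro bdry.Lp_tendsto_imp_L1_tendsto[OF wt p1]) simp
  have ti: "integrable \<mu> t" by (rule bdry.Lp_integrable[OF tL p1])
  have tui: "integrable \<mu> (\<lambda>x. t x - u x)" using ti bdry_integrable_continuous[OF cu] by simp
  have N: "0 < real DIM('a) * vol / P" using vol_pos emeasure_bdry_sphere(2) by simp
  have zero: "(LINT x|\<mu>. (t x - u x) * \<psi> x) = 0" if \<psi>: "\<And>k. Ck k \<psi>" for \<psi>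
  proof -
    have c\<psi>: "continuous_on A \<psi>" for A by (rule continuous_on_subset[OF Ck_continuous[OF \<psi>[of 0]]]) simp
    let ?D = "\<lambda>x. frechet_derivative \<psi> (at x) (x - x0)"
    have cD: "continuous_on A ?D" for A by (rule continuous_on_subset[OF radial_derivative(2)[OF \<psi>]]) simp
    have bd: "\<exists>B\<ge>0. \<forall>x\<in>cball x0 R. norm (f x) \<le> B" if "continuous_on (cball x0 R) f" for f :: "'a \<Rightarrow> 'c::euclidean_space"
    proof -
      have "bounded (f ` cball x0 R)" by (intro compact_imp_bounded compact_continuous_image that) simp
      then obtain B where "\<forall>x\<in>cball x0 R. norm (f x) \<le> B" by (auto simp: bounded_iff)
      then show ?thesis by (intro exI[of _ "\<bar>B\<bar>"]) force
    qed
    obtain B1 where B1: "B1 \<ge> 0" "\<forall>x\<in>cball x0 R. norm (real DIM('a) * \<psi> x + ?D x) \<le> B1"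
    proof -
      have "continuous_on (cball x0 R) (\<lambda>x. real DIM('a) * \<psi> x + ?D x)" by (intro continuous_intros c\<psi> cD)
      from bd[OF this] show ?thesis using that by blast
    qed
    obtain B2 where B2: "B2 \<ge> 0" "\<forall>x\<in>cball x0 R. norm (\<psi> x *\<^sub>R (x - x0)) \<le> B2"
    proof -
      have "continuous_on (cball x0 R) (\<lambda>x. \<psi> x *\<^sub>R (x - x0))" by (intro continuous_intros c\<psi>)
      from bd[OF this] show ?thesis using that by blast
    qed
    obtain B3 where B3: "B3 \<ge> 0" "\<forall>x\<in>cball x0 R. norm (\<psi> x) \<le> B3"
      using bd[OF c\<psi>] by blast
    have bnd1: "\<bar>real DIM('a) * vol / P * (LINT x|\<mu>. z k x * \<psi> x)\<bar>
        \<le> B1 * (LINT x|lebesgue_on \<Omega>. norm (z k x)) + B2 * (LINT x|lebesgue_on \<Omega>. norm (G k x))" for k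
    proof -
      have iz: "integrable (lebesgue_on \<Omega>) (z k)" and iG: "integrable (lebesgue_on \<Omega>) (G k)"
        by (rule F.Lp_integrable[OF zL p1], rule F.Lp_integrable[OF GL p1])
      let ?A = "\<lambda>x. z k x * (real DIM('a) * \<psi> x + ?D x) + (G k x \<bullet> (x - x0)) * \<psi> x"
      have iA: "integrable (lebesgue_on \<Omega>) ?A"
      proof (rule Bochner_Integration.integrable_add)
        show "integrable (lebesgue_on \<Omega>) (\<lambda>x. z k x * (real DIM('a) * \<psi> x + ?D x))"
          by (intro Omega_integrable_continuous continuous_intros cz c\<psi> cD)
        have "integrable (lebesgue_on \<Omega>) (\<lambda>x. G k x \<bullet> (\<psi> x *\<^sub>R (x - x0)))"
          by (intro Omega_integrable_inner iG continuous_intros c\<psi>)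
        then show "integrable (lebesgue_on \<Omega>) (\<lambda>x. (G k x \<bullet> (x - x0)) * \<psi> x)" by (simp add: mult.commute)
      qed
      have "\<bar>LINT x|lebesgue_on \<Omega>. ?A x\<bar> \<le> (LINT x|lebesgue_on \<Omega>. B1 * norm (z k x) + B2 * norm (G k x))"
      proof (rule integral_abs_bound[THEN order_trans], rule integral_mono)
        show "integrable (lebesgue_on \<Omega>) (\<lambda>x. \<bar>?A x\<bar>)" using iA by (rule integrable_abs)
        show "integrable (lebesgue_on \<Omega>) (\<lambda>x. B1 * norm (z k x) + B2 * norm (G k x))" using iz iG by simp
        fix x assume "x \<in> space (lebesgue_on \<Omega>)"
        then have x: "x \<in> cball x0 R" by (simp add: space_restrict_space)
        have "\<bar>z k x * (real DIM('a) * \<psi> x + ?D x)\<bar> \<le> norm (z k x) * B1"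
          using B1 x by (auto simp: abs_mult intro!: mult_left_mono)
        moreover have "\<bar>(G k x \<bullet> (x - x0)) * \<psi> x\<bar> \<le> norm (G k x) * B2"
        proof -
          have "\<bar>(G k x \<bullet> (x - x0)) * \<psi> x\<bar> = \<bar>G k x \<bullet> (\<psi> x *\<^sub>R (x - x0))\<bar>" by (simp add: mult.commute)
          also have "\<dots> \<le> norm (G k x) * norm (\<psi> x *\<^sub>R (x - x0))" by (rule Cauchy_Schwarz_ineq2)
          also have "\<dots> \<le> norm (G k x) * B2" using B2 x by (intro mult_left_mono) auto
          finally show ?thesis .
        qed
        ultimately show "\<bar>?A x\<bar> \<le> B1 * norm (z k x) + B2 * norm (G k x)"
          by (simp add: mult.commute)
      qed
      also have "\<dots> = B1 * (LINT x|lebesgue_on \<Omega>. norm (z k x)) + B2 * (LINT x|lebesgue_on \<Omega>. norm (G k x))"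
        using iz iG by simp
      finally show ?thesis unfolding divergence_theorem[OF zG cz iG \<psi>] .
    qed
    have "(\<lambda>k. B1 * (LINT x|lebesgue_on \<Omega>. norm (z k x)) + B2 * (LINT x|lebesgue_on \<Omega>. norm (G k x))) \<longlonglongrightarrow> B1 * 0 + B2 * 0"
      by (intro tendsto_intros z1 G1)
    then have lim1: "(\<lambda>k. B1 * (LINT x|lebesgue_on \<Omega>. norm (z k x)) + B2 * (LINT x|lebesgue_on \<Omega>. norm (G k x))) \<longlonglongrightarrow> 0"
      by (simp only: mult_zero_right add_0_right)
    have "(\<lambda>k. real DIM('a) * vol / P * (LINT x|\<mu>. z k x * \<psi> x)) \<longlonglongrightarrow> real DIM('a) * vol / P * 0"
      unfolding mult_zero_right
      by (rule Lim_null_comparison[OF _ lim1], rule always_eventually, rule allI, rule ord_eq_le_trans[OF real_norm_def bnd1])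
    then have zl: "(\<lambda>k. LINT x|\<mu>. z k x * \<psi> x) \<longlonglongrightarrow> 0"
      using N by (subst (asm) tendsto_mult_left_iff) auto
    have B3S: "\<bar>\<psi> x\<bar> \<le> B3" if "x \<in> S" for x using B3(2) that by auto
    have izS: "integrable \<mu> (\<lambda>x. z k x * \<psi> x)" for k
      unfolding z_def by (intro bdry_integrable_continuous continuous_intros cwS cu c\<psi>)
    have itu: "integrable \<mu> (\<lambda>x. (t x - u x) * \<psi> x)"
    proof (rule Bochner_Integration.integrable_bound)
      show "integrable \<mu> (\<lambda>x. B3 * (t x - u x))" using tui by simp
      show "(\<lambda>x. (t x - u x) * \<psi> x) \<in> borel_measurable \<mu>"
        by (rule borel_measurable_times[OF borel_measurable_integrable[OF tui] measurable_bdry_continuous[OF c\<psi>]])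
      show "AE x in \<mu>. norm ((t x - u x) * \<psi> x) \<le> norm (B3 * (t x - u x))"
      proof (rule AE_I2)
        fix x assume "x \<in> space \<mu>"
        then have "\<bar>\<psi> x\<bar> * \<bar>t x - u x\<bar> \<le> B3 * \<bar>t x - u x\<bar>" using B3S by (intro mult_right_mono) auto
        then show "norm ((t x - u x) * \<psi> x) \<le> norm (B3 * (t x - u x))" using B3(1) by (simp add: abs_mult mult.commute)
      qed
    qed
    have bnd2: "\<bar>(LINT x|\<mu>. z k x * \<psi> x) - (LINT x|\<mu>. (t x - u x) * \<psi> x)\<bar> \<le> B3 * (LINT x|\<mu>. norm (w k x + (-1) *\<^sub>R t x))" for k
    proof -
      have iw: "integrable \<mu> (\<lambda>x. w k x + (-1) *\<^sub>R t x)" by (rule bdry.Lp_integrable[OF wt p1])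
      have "(LINT x|\<mu>. z k x * \<psi> x) - (LINT x|\<mu>. (t x - u x) * \<psi> x) = (LINT x|\<mu>. z k x * \<psi> x - (t x - u x) * \<psi> x)"
        using izS itu by simp
      also have "\<bar>\<dots>\<bar> \<le> (LINT x|\<mu>. B3 * norm (w k x + (-1) *\<^sub>R t x))"
      proof (rule integral_abs_bound[THEN order_trans], rule integral_mono)
        show "integrable \<mu> (\<lambda>x. \<bar>z k x * \<psi> x - (t x - u x) * \<psi> x\<bar>)"
          using izS itu by (intro integrable_abs Bochner_Integration.integrable_diff)
        show "integrable \<mu> (\<lambda>x. B3 * norm (w k x + (-1) *\<^sub>R t x))" using iw by simp
        fix x assume x: "x \<in> space \<mu>"
        have "z k x * \<psi> x - (t x - u x) * \<psi> x = (w k x - t x) * \<psi> x" by (simp add: z_def algebra_simps)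
        moreover have "\<bar>\<psi> x\<bar> * \<bar>w k x - t x\<bar> \<le> B3 * \<bar>w k x - t x\<bar>" using B3S x by (intro mult_right_mono) auto
        ultimately show "\<bar>z k x * \<psi> x - (t x - u x) * \<psi> x\<bar> \<le> B3 * norm (w k x + (-1) *\<^sub>R t x)"
          by (simp only: abs_mult mult.commute[of _ "\<bar>\<psi> x\<bar>"]) simp
      qed
      finally show ?thesis by simp
    qed
    have "(\<lambda>k. B3 * (LINT x|\<mu>. norm (w k x + (-1) *\<^sub>R t x))) \<longlonglongrightarrow> B3 * 0"
      by (intro tendsto_intros t1)
    then have lim2: "(\<lambda>k. B3 * (LINT x|\<mu>. norm (w k x + (-1) *\<^sub>R t x))) \<longlonglongrightarrow> 0"
      by (simp only: mult_zero_right)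
    have "(\<lambda>k. (LINT x|\<mu>. z k x * \<psi> x) - (LINT x|\<mu>. (t x - u x) * \<psi> x)) \<longlonglongrightarrow> 0"
      by (rule Lim_null_comparison[OF _ lim2], rule always_eventually, rule allI, rule ord_eq_le_trans[OF real_norm_def bnd2])
    from tendsto_diff[OF zl this] show ?thesis by (simp add: LIMSEQ_const_iff)
  qed
  \<comment> \<open>Extended by zero to the whole space, where boxes generate the Borel sets;
    integrability of \<open>f\<close> is enough there.\<close>
  define f where "f x = indicator S x *\<^sub>R (t x - u x)" for x
  have SH: "S \<inter> space H \<in> sets H" by simp
  have fi: "integrable H f"
    using tui unfolding f_def bdry_measure_eq by (subst (asm) integrable_restrict_space[OF SH])
  have "AE x in H. f x = 0"
  proof (rule AE_zero_of_box_integrals[OF sets_hausdorff_measure fi])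
    fix a b :: 'a
    have "(\<lambda>n. LINT x|\<mu>. (t x - u x) * box_bump a b n x) \<longlonglongrightarrow> (LINT x|\<mu>. (t x - u x) * indicator (box a b) x)"
    proof (rule integral_dominated_convergence)
      show "integrable \<mu> (\<lambda>x. norm (t x - u x))" using tui by (rule integrable_norm)
      have "indicator (box a b) \<in> borel_measurable \<mu>"
        using measurable_compose[OF id_measurable borel_measurable_indicator[of "box a b" borel]] by simp
      then show "(\<lambda>x. (t x - u x) * indicator (box a b) x) \<in> borel_measurable \<mu>"
        using tui by (intro borel_measurable_times) auto
      show "(\<lambda>x. (t x - u x) * box_bump a b n x) \<in> borel_measurable \<mu>" for n
        by (rule borel_measurable_times[OF borel_measurable_integrable[OF tui] measurable_bdry_continuous])
          (rule continuous_on_subset[OF Ck_continuous[OF Ck_box_bump[of 0]]], simp)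
      show "AE x in \<mu>. (\<lambda>n. (t x - u x) * box_bump a b n x) \<longlonglongrightarrow> (t x - u x) * indicator (box a b) x"
        by (intro AE_I2 tendsto_mult box_bump_tendsto tendsto_const)
      show "AE x in \<mu>. norm ((t x - u x) * box_bump a b n x) \<le> norm (t x - u x)" for n
        using box_bump_bounds[of a b n] by (intro AE_I2) (simp add: abs_mult mult_right_le_one_le)
    qed
    then have "(LINT x|\<mu>. (t x - u x) * indicator (box a b) x) = 0"
      unfolding zero[OF Ck_box_bump] by (simp add: LIMSEQ_const_iff)
    then show "(LINT x|H. indicator (box a b) x * f x) = 0"
      unfolding bdry_measure_eq f_def by (subst (asm) integral_restrict_space[OF SH]) (simp add: mult_ac)
  qed
  then show ?thesis
    unfolding bdry_measure_eq by (subst AE_restrict_space_iff[OF SH]) (auto elim!: eventually_mono simp: f_def indicator_def)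
qed

lemma bdry_trace_AE:
  assumes p: "1 < p" and u: "u \<in> W1p \<Omega> p" "continuous_on (cball x0 R) u"
  shows "AE s in \<mu>. bdry_trace \<Omega> p u s = u s" "bdry_trace \<Omega> p u \<in> borel_measurable \<mu>"
proof -
  have t: "is_trace \<Omega> p u (bdry_trace \<Omega> p u)"
    unfolding bdry_trace_def by (rule someI[of "is_trace \<Omega> p u", OF continuous_is_trace[OF p u]])
  show "AE s in \<mu>. bdry_trace \<Omega> p u s = u s" by (rule trace_unique[OF p u t])
  show "bdry_trace \<Omega> p u \<in> borel_measurable \<mu>" using t by (simp add: is_trace_def Lp_def)
qed

end

section \<open>Young's inequality with its equality case\<close>

lemma exp_eq_one_add: "exp x = 1 + x \<Longrightarrow> x = 0" for x :: real
proof -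
  assume a: "exp x = 1 + x"
  then have "ln (1 + x) = x" by (metis ln_exp)
  then have "ln (exp x) = exp x - 1" using a by simp
  then have "exp x = 1" by (intro ln_eq_minus_one) simp_all
  then show "x = 0" by simp
qed

text \<open>The tangent of a strictly convex power lies below it. The equality case is obtained by
  elementary means from exp x >= 1 + x.\<close>

lemma powr_tangent:
  fixes p c y :: real
  assumes p: "1 < p" and c: "0 \<le> c" and y: "0 \<le> y"
  shows "p * c powr (p - 1) * y - (p - 1) * c powr p \<le> y powr p"
    "y powr p = p * c powr (p - 1) * y - (p - 1) * c powr p \<Longrightarrow> y = c"
proof -
  have "p * c powr (p - 1) * y - (p - 1) * c powr p \<le> y powr p \<and>
    (y powr p = p * c powr (p - 1) * y - (p - 1) * c powr p \<longrightarrow> y = c)"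
  proof (cases "c = 0 \<or> y = 0")
    case True
    then show ?thesis using p c y by (cases "c = 0") auto
  next
    case False
    then have cy: "0 < c" "0 < y" using c y by auto
    \<comment> \<open>With y = c e^z the difference of the two sides is a positive factor times a
      combination, with positive coefficients, of two terms of the form e^x - (1 + x). If it
      vanishes, both terms vanish and z = 0.\<close>
    define z where "z = ln (y / c)"
    have yz: "y = c * exp z" using cy by (simp add: z_def)
    have 1: "y powr p = c powr p * (exp z * exp ((p - 1) * z))"
      using cy by (simp add: yz powr_mult powr_def[of "exp z"] algebra_simps flip: exp_add)
    have 2: "c powr (p - 1) * y = c powr p * exp z"
      using cy by (simp add: yz powr_diff)
    have 3: "y powr p - (p * c powr (p - 1) * y - (p - 1) * c powr p)
        = c powr p * exp z * ((exp ((p - 1) * z) - (1 + (p - 1) * z)) + (p - 1) * (exp (- z) - (1 + (- z))))"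
    proof -
      have "y powr p - (p * (c powr (p - 1) * y) - (p - 1) * c powr p)
          = c powr p * (exp z * exp ((p - 1) * z)) - p * (c powr p * exp z) + (p - 1) * (c powr p * (exp z * exp (- z)))"
        unfolding 1 2 by (simp add: exp_minus)
      then show ?thesis by (simp add: algebra_simps)
    qed
    have e1: "0 \<le> exp ((p - 1) * z) - (1 + (p - 1) * z)" using exp_ge_add_one_self[of "(p - 1) * z"] by simp
    have e2: "0 \<le> exp (- z) - (1 + (- z))" using exp_ge_add_one_self[of "- z"] by linarith
    have ce: "0 < c powr p * exp z" using cy by simp
    have "0 \<le> (exp ((p - 1) * z) - (1 + (p - 1) * z)) + (p - 1) * (exp (- z) - (1 + (- z)))"
      using e1 e2 p by (intro add_nonneg_nonneg mult_nonneg_nonneg) auto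
    then have "0 \<le> y powr p - (p * c powr (p - 1) * y - (p - 1) * c powr p)"
      unfolding 3 using ce by (intro mult_nonneg_nonneg) auto
    moreover have "y = c" if eq: "y powr p = p * c powr (p - 1) * y - (p - 1) * c powr p"
    proof -
      have "(exp ((p - 1) * z) - (1 + (p - 1) * z)) + (p - 1) * (exp (- z) - (1 + (- z))) = 0"
      proof -
        have "c powr p * exp z * ((exp ((p - 1) * z) - (1 + (p - 1) * z)) + (p - 1) * (exp (- z) - (1 + (- z)))) = 0"
          unfolding 3[symmetric] using eq by simp
        then show ?thesis using ce by (metis less_irrefl mult_eq_0_iff)
      qed
      then have "exp ((p - 1) * z) - (1 + (p - 1) * z) = 0"
        using e1 e2 p by (metis add_nonneg_eq_0_iff diff_ge_0_iff_ge less_imp_le mult_nonneg_nonneg)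
      then have "(p - 1) * z = 0" by (intro exp_eq_one_add) simp
      then show "y = c" using p yz by simp
    qed
    ultimately show ?thesis by simp
  qed
  then show "p * c powr (p - 1) * y - (p - 1) * c powr p \<le> y powr p"
    "y powr p = p * c powr (p - 1) * y - (p - 1) * c powr p \<Longrightarrow> y = c" by auto
qed

lemma powr_times_self:
  fixes x a :: real
  assumes "0 \<le> x"
  shows "x powr (a - 1) = x powr (a - 2) * x" "x powr a = x powr (a - 1) * x"
  using powr_mult_base[OF assms, of "a - 2"] powr_mult_base[OF assms, of "a - 1"]
  by (simp_all add: mult.commute)

text \<open>Cauchy-Schwarz followed by \<open>powr_tangent\<close> with tangent point |\<xi>|^(q-1).
  Equality forces this value for the norm of \<open>a\<close> and makes \<open>a\<close> a
  nonnegative multiple of \<open>\<xi>\<close>, which determines \<open>a\<close>.\<close>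

lemma young_vector:
  fixes a \<xi> :: "'a::euclidean_space"
  assumes p: "1 < p"
  defines "q \<equiv> p / (p - 1)"
  shows "a \<bullet> \<xi> \<le> norm a powr p / p + norm \<xi> powr q / q"
    "a \<bullet> \<xi> = norm a powr p / p + norm \<xi> powr q / q \<Longrightarrow> a = norm \<xi> powr (q - 2) *\<^sub>R \<xi>"
proof -
  define s where "s = norm \<xi> powr (q - 1)"
  have q1: "q - 1 = 1 / (p - 1)" using p by (simp add: q_def field_simps)
  have s0: "0 \<le> s" by (simp add: s_def)
  have sp1: "s powr (p - 1) = norm \<xi>" using p by (simp add: s_def powr_powr q1)
  have qp: "(q - 1) * p = q" using p by (simp add: q_def field_simps)
  have sp: "s powr p = norm \<xi> powr q" by (simp add: s_def powr_powr qp)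
  have iq: "(p - 1) / p = 1 / q" using p by (simp add: q_def)
  note T = powr_tangent[OF p s0 norm_ge_zero[of a], unfolded sp1 sp]
  have le: "norm \<xi> * norm a \<le> norm a powr p / p + norm \<xi> powr q / q"
  proof -
    have "p * (norm \<xi> * norm a) \<le> norm a powr p + (p - 1) * norm \<xi> powr q" using T(1) by simp
    then have "norm \<xi> * norm a \<le> (norm a powr p + (p - 1) * norm \<xi> powr q) / p" using p by (simp add: field_simps)
    also have "\<dots> = norm a powr p / p + (p - 1) / p * norm \<xi> powr q" by (simp add: add_divide_distrib)
    finally show ?thesis by (simp add: iq)
  qed
  have cs: "a \<bullet> \<xi> \<le> norm a * norm \<xi>" by (rule norm_cauchy_schwarz)
  then show "a \<bullet> \<xi> \<le> norm a powr p / p + norm \<xi> powr q / q" using le by (simp add: mult.commute)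
  assume eq: "a \<bullet> \<xi> = norm a powr p / p + norm \<xi> powr q / q"
  then have e1: "a \<bullet> \<xi> = norm a * norm \<xi>" using le cs by (simp add: mult.commute)
  have "p * (norm \<xi> * norm a) = p * (norm a powr p / p + (p - 1) / p * norm \<xi> powr q)"
    using e1 eq by (simp add: iq mult.commute)
  then have "norm a powr p = p * norm \<xi> * norm a - (p - 1) * norm \<xi> powr q"
  proof -
    have "p * (norm a powr p / p + (p - 1) / p * norm \<xi> powr q) = norm a powr p + (p - 1) * norm \<xi> powr q"
      using p by (simp add: distrib_left)
    then show ?thesis using \<open>p * (norm \<xi> * norm a) = _\<close> by simp
  qed
  then have na: "norm a = s" by (rule T(2))
  have "norm a *\<^sub>R \<xi> = norm \<xi> *\<^sub>R a" using e1 norm_cauchy_schwarz_eq by blast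
  then show "a = norm \<xi> powr (q - 2) *\<^sub>R \<xi>"
  proof (cases "\<xi> = 0")
    case True
    then have "s = 0" by (simp add: s_def)
    then show ?thesis using na True by simp
  next
    case False
    then have "a = (s / norm \<xi>) *\<^sub>R \<xi>"
      using \<open>norm a *\<^sub>R \<xi> = norm \<xi> *\<^sub>R a\<close> na by (metis divide_inverse_commute inverse_eq_divide norm_eq_zero scaleR_scaleR scaleR_one left_inverse)
    also have "s / norm \<xi> = norm \<xi> powr (q - 2)"
      using False powr_times_self(1)[of "norm \<xi>" q] by (simp add: s_def)
    finally show ?thesis .
  qed
qed

text \<open>The converse: the vector found in the equality case attains the bound, so the radial
  function will attain the minimum.\<close>

lemma young_vector_equality:
  fixes \<xi> :: "'a::euclidean_space"
  assumes p: "1 < p"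
  defines "q \<equiv> p / (p - 1)"
  shows "norm (norm \<xi> powr (q - 2) *\<^sub>R \<xi>) powr p / p - (norm \<xi> powr (q - 2) *\<^sub>R \<xi>) \<bullet> \<xi> = - (norm \<xi> powr q / q)"
proof (cases "\<xi> = 0")
  case False
  define s where "s = norm \<xi>"
  have s: "0 < s" using False by (simp add: s_def)
  have a: "norm (norm \<xi> powr (q - 2) *\<^sub>R \<xi>) = s powr (q - 1)"
    using powr_times_self(1)[of s q] s by (simp add: s_def)
  have b: "(norm \<xi> powr (q - 2) *\<^sub>R \<xi>) \<bullet> \<xi> = s powr q"
  proof -
    have "(norm \<xi> powr (q - 2) *\<^sub>R \<xi>) \<bullet> \<xi> = s powr (q - 2) * s * s"
      by (simp add: s_def mult.assoc flip: power2_norm_eq_inner power2_eq_square)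
    then show ?thesis using powr_times_self[of s q] s by simp
  qed
  have "(q - 1) * p = q" using p by (simp add: q_def field_simps)
  then have c: "(s powr (q - 1)) powr p = s powr q" by (simp add: powr_powr)
  have iq: "1 / p + 1 / q = 1" using p by (simp add: q_def field_simps)
  have "s powr q / p - s powr q = - (s powr q / q)"
  proof -
    have "s powr q * (1 / p + 1 / q) = s powr q" using iq by simp
    then show ?thesis by (simp add: algebra_simps)
  qed
  then show ?thesis unfolding a b c by (simp add: s_def)
qed (use p in simp)

section \<open>The radial torsion function\<close>

lemma norm_powr_has_derivative:
  fixes x a :: "'a::euclidean_space"
  assumes q: "1 < q"
  shows "((\<lambda>x. norm (x - a) powr q) has_derivative (\<lambda>h. q * norm (x - a) powr (q - 2) * ((x - a) \<bullet> h))) (at x)"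
proof (cases "x = a")
  case False
  then have n: "0 < norm (x - a)" by simp
  have d: "((\<lambda>x. norm (x - a)) has_derivative (\<lambda>h. ((x - a) \<bullet> h) / norm (x - a))) (at x)"
  proof -
    have "((\<lambda>x. x - a) has_derivative (\<lambda>h. h)) (at x)" by (auto intro!: derivative_eq_intros)
    from has_derivative_compose[OF this has_derivative_norm[of "x - a"]] False
    show ?thesis by (simp add: sgn_div_norm inner_commute divide_inverse mult.commute)
  qed
  have "((\<lambda>t. t powr q) has_real_derivative q * norm (x - a) powr (q - 1)) (at (norm (x - a)))"
    using n by (rule has_real_derivative_powr)
  from diff_chain_at[OF d this[unfolded has_field_derivative_def]]
  have "((\<lambda>x. norm (x - a) powr q) has_derivative (\<lambda>h. q * norm (x - a) powr (q - 1) * (((x - a) \<bullet> h) / norm (x - a)))) (at x)"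
    by (simp add: o_def)
  moreover have "norm (x - a) powr (q - 1) / norm (x - a) = norm (x - a) powr (q - 2)"
    using n powr_times_self(1)[of "norm (x - a)" q] by simp
  ultimately show ?thesis by (simp add: algebra_simps divide_inverse)
next
  case True
  \<comment> \<open>At the centre the difference quotient is \<open>norm h powr (q - 1)\<close>,
    which tends to 0 because \<open>q > 1\<close>.\<close>
  have "((\<lambda>x. norm (x - a) powr q) has_derivative (\<lambda>h. 0)) (at a)"
    unfolding has_derivative_at
  proof (intro conjI bounded_linear_zero)
    have "((\<lambda>h::'a. norm h powr (q - 1)) \<longlongrightarrow> 0 powr (q - 1)) (at 0)"
      using q by (intro tendsto_powr' tendsto_norm_zero tendsto_const tendsto_ident_at) auto
    then have "((\<lambda>h::'a. norm h powr (q - 1)) \<longlongrightarrow> 0) (at 0)" by simp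
    moreover have "\<forall>\<^sub>F h in at 0. norm h powr (q - 1) = norm (norm (a + h - a) powr q - norm (a - a) powr q - 0) / norm h"
      unfolding eventually_at_filter
    proof (rule always_eventually, intro allI impI)
      fix h :: 'a assume "h \<noteq> 0"
      moreover have "norm h powr q = norm h powr (q - 1) * norm h" by (rule powr_times_self(2)) simp
      ultimately show "norm h powr (q - 1) = norm (norm (a + h - a) powr q - norm (a - a) powr q - 0) / norm h"
        by simp
    qed
    ultimately show "((\<lambda>h. norm (norm (a + h - a) powr q - norm (a - a) powr q - 0) / norm h) \<longlongrightarrow> 0) (at 0)"
      by (rule Lim_transform_eventually)
  qed
  then show ?thesis using True by simp
qed

text \<open>The exponent \<open>q - 2\<close> may be negative, but the norm of the field is |x -
  a|^(q-1), which tends to 0 at the centre.\<close>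

lemma norm_powr_gradient_continuous:
  fixes a :: "'a::euclidean_space"
  assumes q: "1 < q"
  shows "continuous_on UNIV (\<lambda>x. norm (x - a) powr (q - 2) *\<^sub>R (x - a))"
proof -
  have "isCont (\<lambda>x. norm (x - a) powr (q - 2) *\<^sub>R (x - a)) x" for x
  proof (cases "x = a")
    case False
    then show ?thesis by (auto intro!: continuous_intros)
  next
    case True
    have "((\<lambda>x. norm (x - a) powr (q - 1)) \<longlongrightarrow> 0 powr (q - 1)) (at a)"
      using q by (intro tendsto_powr' tendsto_eq_intros) auto
    then have "((\<lambda>x. norm (x - a) powr (q - 1)) \<longlongrightarrow> 0) (at a)" by simp
    moreover have "norm (norm (x - a) powr (q - 2) *\<^sub>R (x - a)) = norm (x - a) powr (q - 1)" for x
      using powr_times_self(1)[of "norm (x - a)" q] by simp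
    ultimately have "((\<lambda>x. norm (norm (x - a) powr (q - 2) *\<^sub>R (x - a))) \<longlongrightarrow> 0) (at a)" by simp
    then have "((\<lambda>x. norm (x - a) powr (q - 2) *\<^sub>R (x - a)) \<longlongrightarrow> 0) (at a)" by (rule tendsto_norm_zero_cancel)
    then show ?thesis using True by (simp add: isCont_def)
  qed
  then show ?thesis by (simp add: continuous_at_imp_continuous_on)
qed

section \<open>Structure of the minimizers\<close>

locale robin_ball = ball_domain x0 R for x0 :: "'a::euclidean_space" and R :: real +
  fixes p \<beta> :: real and g :: "'a \<Rightarrow> real"
  assumes p: "1 < p" and \<beta>: "0 < \<beta>" and g_cont: "continuous_on S g"
    and g_nonconst: "\<not> g constant_on S"
begin

definition "q = p / (p - 1)"
definition "b = \<beta> powr (1 / (p - 1))"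
text \<open>The value of \<open>c\<close> for which the coefficient \<beta> c^(p-1) of the
  linearized boundary term balances the volume term under the addition of constants.\<close>

definition "c0 = (vol / (\<beta> * P)) powr (1 / (p - 1))"
text \<open>A radial field with divergence -1; it turns the linear volume term into an integral
  against the gradient.\<close>

definition "\<xi> x = - (1 / real DIM('a)) *\<^sub>R (x - x0)"
definition "Gw x = norm (\<xi> x) powr (q - 2) *\<^sub>R \<xi> x"
text \<open>A solution of -div(|\<nabla>w|^(p-2) \<nabla>w) = 1, normalised to vanish at the centre
  instead of on the sphere; only its gradient matters, since constants are added later.\<close>

definition "w0 x = - ((1 / real DIM('a)) powr (q - 1) / q) * norm (x - x0) powr q"
text \<open>Minus the minimum of \<open>T\<close> over functions continuous up to the
  boundary.\<close>

definition "Q = (LINT x|lebesgue_on \<Omega>. norm (\<xi> x) powr q / q)"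

lemma q_gt_1: "1 < q"
  using p by (simp add: q_def field_simps)

lemma b_pos: "0 < b"
  using \<beta> by (simp add: b_def)

lemma P_pos: "0 < P"
  by (rule emeasure_bdry_sphere)

lemma c0_pos: "0 < c0"
  using vol_pos \<beta> P_pos by (simp add: c0_def)

lemma c0_powr: "\<beta> * c0 powr (p - 1) = vol / P"
  using vol_pos \<beta> P_pos p by (simp add: c0_def powr_powr)

lemma xi_cont: "continuous_on A \<xi>"
  unfolding \<xi>_def by (intro continuous_intros)

lemma Gw_eq: "Gw x = - ((1 / real DIM('a)) powr (q - 1)) *\<^sub>R (norm (x - x0) powr (q - 2) *\<^sub>R (x - x0))"
proof -
  have "norm (\<xi> x) powr (q - 2) * (1 / real DIM('a)) = (1 / real DIM('a)) powr (q - 1) * norm (x - x0) powr (q - 2)"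
    using powr_times_self(1)[of "1 / real DIM('a)" q] by (simp add: \<xi>_def powr_mult powr_divide)
  then show ?thesis by (simp add: Gw_def \<xi>_def)
qed

lemma Gw_cont: "continuous_on A Gw"
proof (rule continuous_on_subset)
  show "continuous_on UNIV Gw"
    unfolding Gw_eq[abs_def] by (intro continuous_intros norm_powr_gradient_continuous q_gt_1)
qed simp

lemma w0_deriv: "(w0 has_derivative (\<lambda>h. Gw x \<bullet> h)) (at x)"
proof -
  let ?A = "(1 / real DIM('a)) powr (q - 1)"
  have "(w0 has_derivative (\<lambda>h. - (?A / q) * (q * norm (x - x0) powr (q - 2) * ((x - x0) \<bullet> h)))) (at x)"
    unfolding w0_def[abs_def] by (intro has_derivative_mult_right norm_powr_has_derivative q_gt_1)
  also have "(\<lambda>h. - (?A / q) * (q * norm (x - x0) powr (q - 2) * ((x - x0) \<bullet> h))) = (\<lambda>h. Gw x \<bullet> h)"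
    using q_gt_1 by (simp add: Gw_eq fun_eq_iff)
  finally show ?thesis .
qed

lemma w0_cont: "continuous_on A w0"
  using w0_deriv by (intro continuous_at_imp_continuous_on) (auto intro: has_derivative_continuous)

lemma W1p_C1:
  assumes w: "\<And>x. (w has_derivative (\<lambda>h. G x \<bullet> h)) (at x)" and G: "continuous_on UNIV G"
  shows "is_weak_gradient \<Omega> w G" "w \<in> W1p \<Omega> p"
proof -
  show wg: "is_weak_gradient \<Omega> w G" by (rule is_weak_gradient_C1[OF w G open_ball])
  have cw: "continuous_on (cball x0 R) w"
    using w by (intro continuous_at_imp_continuous_on) (auto intro: has_derivative_continuous)
  have cG: "continuous_on (cball x0 R) G" by (rule continuous_on_subset[OF G]) simp
  have Lp: "f \<in> Lp (lebesgue_on \<Omega>) p" if f: "continuous_on (cball x0 R) f" for f :: "'a \<Rightarrow> 'b::euclidean_space"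
  proof -
    have "continuous_on (cball x0 R) (\<lambda>x. norm (f x) powr p)"
      by (rule continuous_on_powr'[OF continuous_on_norm[OF f] continuous_on_const]) (use p in auto)
    then show ?thesis
      using Omega_measurable_continuous[OF f] Omega_integrable_continuous by (simp add: Lp_def)
  qed
  show "w \<in> W1p \<Omega> p" using wg Lp[OF cw] Lp[OF cG] by (auto simp: W1p_def)
qed

lemma w0_W1p: "is_weak_gradient \<Omega> w0 Gw" "w0 \<in> W1p \<Omega> p"
  using W1p_C1[OF w0_deriv Gw_cont] by auto

lemma const_W1p: "is_weak_gradient \<Omega> (\<lambda>x. k) (\<lambda>x. 0)" "(\<lambda>x. k) \<in> W1p \<Omega> p"
  using W1p_C1[of "\<lambda>x. k" "\<lambda>x. 0"] by simp_all

lemma W1p_add_scaled: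
  assumes "v \<in> W1p \<Omega> p" "w \<in> W1p \<Omega> p"
  shows "(\<lambda>x. v x + c * w x) \<in> W1p \<Omega> p"
proof -
  have p1: "1 \<le> p" using p by simp
  have "(\<lambda>x. v x + c *\<^sub>R w x) \<in> Lp (lebesgue_on \<Omega>) p"
    by (intro Lp_add_scaled W1pD(1)[OF assms(1) open_ball] W1pD(1)[OF assms(2) open_ball] p1)
  moreover have "(\<lambda>x. weak_gradient \<Omega> v x + c *\<^sub>R weak_gradient \<Omega> w x) \<in> Lp (lebesgue_on \<Omega>) p"
    by (intro Lp_add_scaled weak_gradient_Lp[OF assms(1)] weak_gradient_Lp[OF assms(2)] p1)
  moreover have "is_weak_gradient \<Omega> (\<lambda>x. v x + c * w x) (\<lambda>x. weak_gradient \<Omega> v x + c *\<^sub>R weak_gradient \<Omega> w x)"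
    by (intro is_weak_gradient_add_scaled W1pD(2)[OF assms(1) open_ball] W1pD(2)[OF assms(2) open_ball] Omega_sets)
  ultimately show ?thesis by (auto simp: W1p_def)
qed

text \<open>\<open>weak_gradient\<close> is a choice, unique only up to null sets; the energy may be
  computed with whichever weak gradient is at hand.\<close>

lemma gradient_powr_integrable:
  assumes "v \<in> W1p \<Omega> p" "is_weak_gradient \<Omega> v G"
  shows "integrable (lebesgue_on \<Omega>) (\<lambda>x. norm (G x) powr p)" "integrable (lebesgue_on \<Omega>) G"
    "(LINT x|lebesgue_on \<Omega>. norm (weak_gradient \<Omega> v x) powr p) = (LINT x|lebesgue_on \<Omega>. norm (G x) powr p)"
proof -
  interpret F: finite_measure "lebesgue_on \<Omega>" by (rule finite_measure_Omega)
  let ?W = "weak_gradient \<Omega> v"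
  have m[measurable]: "G \<in> borel_measurable (lebesgue_on \<Omega>)" by (rule weak_gradient_measurable[OF assms(2)])
  have m'[measurable]: "?W \<in> borel_measurable (lebesgue_on \<Omega>)"
    by (rule weak_gradient_measurable[OF W1pD(2)[OF assms(1) open_ball]])
  have ae: "AE x in lebesgue_on \<Omega>. ?W x = G x" by (rule weak_gradient_AE_eq(1)[OF assms(2) open_ball])
  have W: "?W \<in> Lp (lebesgue_on \<Omega>) p" by (rule weak_gradient_Lp[OF assms(1)])
  show i: "integrable (lebesgue_on \<Omega>) (\<lambda>x. norm (G x) powr p)"
  proof (rule integrable_cong_AE_imp)
    show "integrable (lebesgue_on \<Omega>) (\<lambda>x. norm (?W x) powr p)" using W by (simp add: Lp_def)
    show "AE x in lebesgue_on \<Omega>. norm (?W x) powr p = norm (G x) powr p"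
      using ae by eventually_elim simp
  qed measurable
  show "integrable (lebesgue_on \<Omega>) G"
    by (rule F.Lp_integrable[of _ p]) (use i m p in \<open>auto simp: Lp_def\<close>)
  show "(LINT x|lebesgue_on \<Omega>. norm (?W x) powr p) = (LINT x|lebesgue_on \<Omega>. norm (G x) powr p)"
    by (rule integral_cong_AE) (use ae in \<open>auto elim: eventually_mono\<close>)
qed

text \<open>What remains of the functional after the boundary term is linearized and the parts in
  \<open>g\<close> and \<open>m\<close> are removed. Adding a constant to \<open>v\<close> does not
  change it, since both linear terms then grow by the same amount.\<close>

definition T :: "('a \<Rightarrow> real) \<Rightarrow> real" where
  "T v = (LINT x|lebesgue_on \<Omega>. norm (weak_gradient \<Omega> v x) powr p) / p + vol / P * (LINT s|\<mu>. v s) - (LINT x|lebesgue_on \<Omega>. v x)"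

text \<open>By the divergence theorem \<open>T v\<close> is the integral of \<open>\<bar>\<nabla>v\<bar>^p/p - \<nabla>v \<bullet> \<xi>\<close>, so Young's inequality applies pointwise.\<close>

lemma T_eq:
  assumes v: "v \<in> W1p \<Omega> p" "continuous_on (cball x0 R) v" and G: "is_weak_gradient \<Omega> v G"
  shows "T v = (LINT x|lebesgue_on \<Omega>. norm (G x) powr p / p - G x \<bullet> \<xi> x)"
    "integrable (lebesgue_on \<Omega>) (\<lambda>x. norm (G x) powr p / p - G x \<bullet> \<xi> x)"
proof -
  note g = gradient_powr_integrable[OF v(1) G]
  have N: "real DIM('a) \<noteq> 0" by simp
  have iv: "integrable (lebesgue_on \<Omega>) v" by (rule Omega_integrable_continuous[OF v(2)])
  have ix: "integrable (lebesgue_on \<Omega>) (\<lambda>x. G x \<bullet> (x - x0))"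
    by (intro Omega_integrable_inner g continuous_intros)
  have i\<xi>: "integrable (lebesgue_on \<Omega>) (\<lambda>x. G x \<bullet> \<xi> x)"
    by (intro Omega_integrable_inner g xi_cont)
  have "frechet_derivative (\<lambda>x::'a. 1 :: real) (at x) h = 0" for x h
    using frechet_derivative_at[OF has_derivative_const[of "1::real" "at x"], symmetric] by simp
  then have "(LINT x|lebesgue_on \<Omega>. v x * real DIM('a) + G x \<bullet> (x - x0)) = real DIM('a) * vol / P * (LINT s|\<mu>. v s)"
    using divergence_theorem[OF G v(2) g(2) Ck_const[of _ 1]] by simp
  then have "(LINT x|lebesgue_on \<Omega>. v x) * real DIM('a) + (LINT x|lebesgue_on \<Omega>. G x \<bullet> (x - x0)) = real DIM('a) * vol / P * (LINT s|\<mu>. v s)"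
    using iv ix by simp
  then have "vol / P * (LINT s|\<mu>. v s) - (LINT x|lebesgue_on \<Omega>. v x) = (LINT x|lebesgue_on \<Omega>. G x \<bullet> (x - x0)) / real DIM('a)"
    using N by (simp add: field_simps)
  also have "\<dots> = - (LINT x|lebesgue_on \<Omega>. G x \<bullet> \<xi> x)"
    by (simp add: \<xi>_def)
  finally show "T v = (LINT x|lebesgue_on \<Omega>. norm (G x) powr p / p - G x \<bullet> \<xi> x)"
    unfolding T_def g(3) using g(1) i\<xi> by simp
  show "integrable (lebesgue_on \<Omega>) (\<lambda>x. norm (G x) powr p / p - G x \<bullet> \<xi> x)"
    using g(1) i\<xi> by simp
qed

lemma Q_integrable: "integrable (lebesgue_on \<Omega>) (\<lambda>x. norm (\<xi> x) powr q / q)"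
proof -
  have "continuous_on (cball x0 R) (\<lambda>x. norm (\<xi> x) powr q)"
    by (rule continuous_on_powr'[OF continuous_on_norm[OF xi_cont] continuous_on_const]) (use q_gt_1 in auto)
  then have "integrable (lebesgue_on \<Omega>) (\<lambda>x. norm (\<xi> x) powr q)" by (rule Omega_integrable_continuous)
  then show ?thesis by simp
qed

lemma T_lower:
  assumes v: "v \<in> W1p \<Omega> p" "continuous_on (cball x0 R) v"
  shows "- Q \<le> T v"
proof -
  note G = W1pD(2)[OF v(1) open_ball]
  have "- Q = (LINT x|lebesgue_on \<Omega>. - (norm (\<xi> x) powr q / q))" by (simp add: Q_def)
  also have "\<dots> \<le> T v"
    unfolding T_eq(1)[OF v G] using Q_integrable T_eq(2)[OF v G]
  proof (intro integral_mono)
    fix x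
    show "- (norm (\<xi> x) powr q / q) \<le> norm (weak_gradient \<Omega> v x) powr p / p - weak_gradient \<Omega> v x \<bullet> \<xi> x"
      using young_vector(1)[OF p, of "weak_gradient \<Omega> v x" "\<xi> x"] by (simp add: q_def)
  qed auto
  finally show ?thesis .
qed

lemma T_w0: "T (\<lambda>x. w0 x + k) = - Q"
proof -
  have v: "(\<lambda>x. w0 x + 1 * k) \<in> W1p \<Omega> p" by (intro W1p_add_scaled w0_W1p const_W1p)
  have c: "continuous_on (cball x0 R) (\<lambda>x. w0 x + k)" by (intro continuous_intros w0_cont)
  have "is_weak_gradient \<Omega> (\<lambda>x. w0 x + 1 * k) (\<lambda>x. Gw x + 1 *\<^sub>R 0)"
    by (intro is_weak_gradient_add_scaled w0_W1p const_W1p Omega_sets)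
  then have "T (\<lambda>x. w0 x + k) = (LINT x|lebesgue_on \<Omega>. norm (Gw x) powr p / p - Gw x \<bullet> \<xi> x)"
    using T_eq(1)[of "\<lambda>x. w0 x + k" Gw] v c by simp
  also have "\<dots> = (LINT x|lebesgue_on \<Omega>. - (norm (\<xi> x) powr q / q))"
    unfolding Gw_def by (simp only: young_vector_equality[OF p, folded q_def])
  finally show ?thesis by (simp add: Q_def)
qed

text \<open>Equality in the integrated Young inequality gives equality almost everywhere, hence the
  gradient of \<open>u\<close> is that of \<open>w0\<close>. The difference then has weak gradient
  0, is constant in the open ball, and by continuity also on the closed ball.\<close>

lemma T_minimal_imp:
  assumes u: "u \<in> W1p \<Omega> p" "continuous_on (cball x0 R) u" and T: "T u \<le> - Q"
  obtains k where "\<And>x. x \<in> cball x0 R \<Longrightarrow> u x = w0 x + k"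
proof -
  let ?G = "weak_gradient \<Omega> u"
  note G = W1pD(2)[OF u(1) open_ball]
  let ?d = "\<lambda>x. (norm (?G x) powr p / p - ?G x \<bullet> \<xi> x) + norm (\<xi> x) powr q / q"
  have d0: "0 \<le> ?d x" for x
    using young_vector(1)[OF p, of "?G x" "\<xi> x"] by (simp add: q_def)
  have di: "integrable (lebesgue_on \<Omega>) ?d"
    by (rule Bochner_Integration.integrable_add[OF T_eq(2)[OF u G] Q_integrable])
  have "(LINT x|lebesgue_on \<Omega>. ?d x) = T u + Q"
    unfolding T_eq(1)[OF u G] Q_def by (rule Bochner_Integration.integral_add[OF T_eq(2)[OF u G] Q_integrable])
  then have "(LINT x|lebesgue_on \<Omega>. ?d x) = 0"
    using T Bochner_Integration.integral_nonneg[of "lebesgue_on \<Omega>" ?d] d0 by fastforce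
  then have "AE x in lebesgue_on \<Omega>. ?d x = 0"
    using integral_nonneg_eq_0_iff_AE[OF di] d0 by simp
  then have ae: "AE x in lebesgue_on \<Omega>. ?G x = Gw x"
  proof eventually_elim
    case (elim x)
    then show ?case
      unfolding Gw_def q_def by (intro young_vector(2)[OF p]) (simp add: q_def)
  qed
  let ?v = "\<lambda>x. u x + (-1) * w0 x"
  have wg: "is_weak_gradient \<Omega> ?v (\<lambda>x. ?G x + (-1) *\<^sub>R Gw x)"
    by (intro is_weak_gradient_add_scaled G w0_W1p Omega_sets)
  have "is_weak_gradient \<Omega> ?v (\<lambda>x. 0)"
    unfolding is_weak_gradient_def
  proof (intro conjI allI impI ballI)
    show "integrable (lebesgue_on K) ?v" if "compact K \<and> K \<subseteq> \<Omega>" for K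
      using wg that by (auto simp: is_weak_gradient_def)
    show "integrable (lebesgue_on K) (\<lambda>x. 0::'a)" for K by simp
    fix \<phi> and i :: 'a assume \<phi>: "\<phi> \<in> test_functions \<Omega>" and i: "i \<in> Basis"
    have "(LINT x|lebesgue_on \<Omega>. ?v x * frechet_derivative \<phi> (at x) i)
        = - (LINT x|lebesgue_on \<Omega>. ((?G x + (-1) *\<^sub>R Gw x) \<bullet> i) * \<phi> x)"
      using wg \<phi> i by (simp add: is_weak_gradient_def)
    also have "(LINT x|lebesgue_on \<Omega>. ((?G x + (-1) *\<^sub>R Gw x) \<bullet> i) * \<phi> x) = 0"
      by (rule integral_eq_zero_AE) (use ae in eventually_elim, simp)
    finally show "(LINT x|lebesgue_on \<Omega>. ?v x * frechet_derivative \<phi> (at x) i) = - (LINT x|lebesgue_on \<Omega>. (0 \<bullet> i) * \<phi> x)"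
      by simp
  qed
  moreover have cv: "continuous_on (cball x0 R) ?v" by (intro continuous_intros u w0_cont)
  ultimately have const: "?v y = ?v x0" if "y \<in> \<Omega>" for y
    using weak_gradient_zero_constant[of x0 R ?v y x0] that R_pos by simp
  have "?v y = ?v x0" if "y \<in> cball x0 R" for y
  proof (rule continuous_constant_on_closure[of \<Omega> ?v "?v x0" y])
    show "continuous_on (closure \<Omega>) ?v" unfolding closure_Omega by (rule cv)
    show "y \<in> closure \<Omega>" unfolding closure_Omega by (rule that)
  qed (rule const)
  then show ?thesis by (intro that[of "u x0 - w0 x0"]) force
qed

lemma w0_sphere: "s \<in> S \<Longrightarrow> w0 s = - ((1 / real DIM('a)) powr (q - 1) / q) * R powr q"
  by (simp add: w0_def dist_norm norm_minus_commute)

definition Bd :: "('a \<Rightarrow> real) \<Rightarrow> ('a \<Rightarrow> real) \<Rightarrow> real" where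
  "Bd v h = (LINT s|\<mu>. \<bar>v s - g s\<bar> powr p / (1 + b * h s) powr (p - 1))"

text \<open>For functions continuous up to the boundary the chosen trace may be replaced by the
  boundary values, so that the choice operator disappears from the energy.\<close>

lemma J_eq:
  assumes v: "v \<in> W1p \<Omega> p" "continuous_on (cball x0 R) v" and h: "h \<in> borel_measurable \<mu>"
  shows "J \<Omega> p \<beta> (\<lambda>x. 1) g v h
    = (LINT x|lebesgue_on \<Omega>. norm (weak_gradient \<Omega> v x) powr p) / p + \<beta> / p * Bd v h - (LINT x|lebesgue_on \<Omega>. v x)"
proof -
  have cv: "continuous_on S v" by (rule continuous_on_subset[OF v(2)]) auto
  note [measurable] = bdry_trace_AE(2)[OF p v] measurable_bdry_continuous[OF g_cont] measurable_bdry_continuous[OF cv] h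
  have "(LINT s|\<mu>. \<bar>bdry_trace \<Omega> p v s - g s\<bar> powr p / (1 + b * h s) powr (p - 1)) = Bd v h"
    unfolding Bd_def
    by (rule integral_cong_AE) (use bdry_trace_AE(1)[OF p v] in \<open>auto elim: eventually_mono\<close>)
  then show ?thesis by (simp add: J_def b_def)
qed

text \<open>With s = 1 + b h and y = |x|/s the integrand is s y^p. It is compared with s times the
  tangent of y^p at \<open>c\<close>, and contact happens only for y = c.\<close>

lemma Bd_integrand:
  assumes "0 \<le> h" "0 < c"
  shows "p * c powr (p - 1) * \<bar>x\<bar> - (p - 1) * c powr p * (1 + b * h) \<le> \<bar>x\<bar> powr p / (1 + b * h) powr (p - 1)"
    "\<bar>x\<bar> powr p / (1 + b * h) powr (p - 1) = p * c powr (p - 1) * \<bar>x\<bar> - (p - 1) * c powr p * (1 + b * h) \<Longrightarrow> \<bar>x\<bar> = c * (1 + b * h)"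
    "\<bar>x\<bar> = c * (1 + b * h) \<Longrightarrow> \<bar>x\<bar> powr p / (1 + b * h) powr (p - 1) = p * c powr (p - 1) * \<bar>x\<bar> - (p - 1) * c powr p * (1 + b * h)"
proof -
  define s where "s = 1 + b * h"
  have s: "0 < s" using assms b_pos by (simp add: s_def add_pos_nonneg)
  define y where "y = \<bar>x\<bar> / s"
  have y: "0 \<le> y" "\<bar>x\<bar> = s * y" using s by (simp_all add: y_def)
  have sp: "s powr p = s powr (p - 1) * s" using s by (intro powr_times_self) simp
  have e: "\<bar>x\<bar> powr p / s powr (p - 1) = s * y powr p"
    using s y by (simp add: powr_mult sp)
  have f: "p * c powr (p - 1) * \<bar>x\<bar> - (p - 1) * c powr p * s = s * (p * c powr (p - 1) * y - (p - 1) * c powr p)"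
    unfolding y(2) by (simp add: algebra_simps)
  have c: "0 \<le> c" using assms by simp
  show "p * c powr (p - 1) * \<bar>x\<bar> - (p - 1) * c powr p * (1 + b * h) \<le> \<bar>x\<bar> powr p / (1 + b * h) powr (p - 1)"
    unfolding s_def[symmetric] e f using powr_tangent(1)[OF p c y(1)] s by (intro mult_left_mono) auto
  show "\<bar>x\<bar> = c * (1 + b * h)"
    if "\<bar>x\<bar> powr p / (1 + b * h) powr (p - 1) = p * c powr (p - 1) * \<bar>x\<bar> - (p - 1) * c powr p * (1 + b * h)"
  proof -
    have "y powr p = p * c powr (p - 1) * y - (p - 1) * c powr p"
      using that s unfolding s_def[symmetric] e f by (metis mult_cancel_left less_irrefl)
    then have "y = c" by (rule powr_tangent(2)[OF p c y(1)])
    then show ?thesis using y(2) by (simp add: s_def mult.commute)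
  qed
  show "\<bar>x\<bar> powr p / (1 + b * h) powr (p - 1) = p * c powr (p - 1) * \<bar>x\<bar> - (p - 1) * c powr p * (1 + b * h)"
    if "\<bar>x\<bar> = c * (1 + b * h)"
  proof -
    have "y = c" using that s by (simp add: y_def s_def)
    moreover have "c powr p = c powr (p - 1) * c" by (rule powr_times_self(2)[OF c])
    ultimately show ?thesis unfolding s_def[symmetric] e f by (simp add: algebra_simps)
  qed
qed

lemma HmD:
  assumes "h \<in> Hm \<Omega> m"
  shows "integrable \<mu> h" "AE s in \<mu>. 0 \<le> h s" "(LINT s|\<mu>. h s) = m" "h \<in> borel_measurable \<mu>"
  using assms by (auto simp: Hm_def)

lemma Bd_integrable:
  assumes v: "continuous_on S v" and h: "h \<in> Hm \<Omega> m"
  shows "integrable \<mu> (\<lambda>s. \<bar>v s - g s\<bar> powr p / (1 + b * h s) powr (p - 1))"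
proof (rule Bochner_Integration.integrable_bound)
  note [measurable] = measurable_bdry_continuous[OF g_cont] measurable_bdry_continuous[OF v] HmD(4)[OF h]
  have c: "continuous_on S (\<lambda>s. \<bar>v s - g s\<bar>)" by (intro continuous_intros v g_cont)
  have "continuous_on S (\<lambda>s. \<bar>v s - g s\<bar> powr p)"
    by (rule continuous_on_powr'[OF c continuous_on_const]) (use p in auto)
  then show "integrable \<mu> (\<lambda>s. \<bar>v s - g s\<bar> powr p)" by (rule bdry_integrable_continuous)
  show "(\<lambda>s. \<bar>v s - g s\<bar> powr p / (1 + b * h s) powr (p - 1)) \<in> borel_measurable \<mu>" by measurable
  show "AE s in \<mu>. norm (\<bar>v s - g s\<bar> powr p / (1 + b * h s) powr (p - 1)) \<le> norm (\<bar>v s - g s\<bar> powr p)"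
    using HmD(2)[OF h]
  proof eventually_elim
    case (elim s)
    then have "1 \<le> 1 + b * h s" using b_pos by simp
    then have "1 \<le> (1 + b * h s) powr (p - 1)" using p by (intro ge_one_powr_ge_zero) auto
    then show ?case by (simp add: divide_le_eq mult_le_cancel_left1)
  qed
qed

text \<open>The tangent bound is affine in \<open>h\<close>, so after integration the density enters
  only through its prescribed mass; this makes the bound uniform over \<open>Hm\<close>.\<close>

lemma Bd_lower:
  assumes v: "continuous_on S v" and h: "h \<in> Hm \<Omega> m" and c: "0 < c"
  defines "L \<equiv> p * c powr (p - 1) * (LINT s|\<mu>. \<bar>v s - g s\<bar>) - (p - 1) * c powr p * (P + b * m)"
  shows "L \<le> Bd v h" "Bd v h \<le> L \<Longrightarrow> AE s in \<mu>. \<bar>v s - g s\<bar> = c * (1 + b * h s)"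
    "(AE s in \<mu>. \<bar>v s - g s\<bar> = c * (1 + b * h s)) \<Longrightarrow> Bd v h = L"
proof -
  let ?l = "\<lambda>s. p * c powr (p - 1) * \<bar>v s - g s\<bar> - (p - 1) * c powr p * (1 + b * h s)"
  let ?i = "\<lambda>s. \<bar>v s - g s\<bar> powr p / (1 + b * h s) powr (p - 1)"
  have iv: "integrable \<mu> (\<lambda>s. \<bar>v s - g s\<bar>)" by (intro bdry_integrable_continuous continuous_intros v g_cont)
  have ih: "integrable \<mu> (\<lambda>s. 1 + b * h s)" using HmD(1)[OF h] by simp
  have il: "integrable \<mu> ?l" using iv ih by simp
  have ii: "integrable \<mu> ?i" by (rule Bd_integrable[OF v h])
  have "(LINT s|\<mu>. 1 + b * h s) = P + b * m"
    using HmD(1,3)[OF h] by (simp add: measure_bdry_space)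
  then have L: "(LINT s|\<mu>. ?l s) = L"
    unfolding L_def using iv ih by simp
  have le: "AE s in \<mu>. ?l s \<le> ?i s"
    using HmD(2)[OF h] by eventually_elim (rule Bd_integrand(1)[OF _ c])
  show "L \<le> Bd v h"
    unfolding L[symmetric] Bd_def by (rule integral_mono_AE[OF il ii le])
  show "AE s in \<mu>. \<bar>v s - g s\<bar> = c * (1 + b * h s)" if "Bd v h \<le> L"
  proof -
    have "(LINT s|\<mu>. ?i s - ?l s) = Bd v h - L"
      unfolding L[symmetric] Bd_def by (rule Bochner_Integration.integral_diff[OF ii il])
    moreover have "0 \<le> (LINT s|\<mu>. ?i s - ?l s)"
      using le by (intro integral_nonneg_AE) (auto elim: eventually_mono)
    ultimately have "(LINT s|\<mu>. ?i s - ?l s) = 0" using that by linarith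
    moreover have "AE s in \<mu>. 0 \<le> ?i s - ?l s" using le by eventually_elim simp
    ultimately have "AE s in \<mu>. ?i s - ?l s = 0"
      using integral_nonneg_eq_0_iff_AE[OF Bochner_Integration.integrable_diff[OF ii il]] by blast
    with HmD(2)[OF h] show ?thesis
      by eventually_elim (rule Bd_integrand(2)[OF _ c], auto)
  qed
  show "Bd v h = L" if "AE s in \<mu>. \<bar>v s - g s\<bar> = c * (1 + b * h s)"
  proof -
    have "AE s in \<mu>. ?i s = ?l s"
      using that HmD(2)[OF h] by eventually_elim (rule Bd_integrand(3)[OF _ c])
    then have "Bd v h = (LINT s|\<mu>. ?l s)"
      unfolding Bd_def using ii il by (intro integral_cong_AE) auto
    then show ?thesis by (simp add: L)
  qed
qed

text \<open>The part of the lower bound that depends neither on \<open>v\<close> nor on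
  \<open>h\<close>; \<open>- Q + Km m\<close> bounds \<open>J\<close> from below for
  \<open>v\<close> continuous up to the boundary.\<close>

definition Km :: "real \<Rightarrow> real" where
  "Km m = - (vol / P * (LINT s|\<mu>. g s)) - \<beta> * (p - 1) / p * c0 powr p * (P + b * m)"

lemma Bd_c0:
  fixes I :: real
  shows "\<beta> / p * (p * c0 powr (p - 1) * I - (p - 1) * c0 powr p * (P + b * m))
      = vol / P * I - \<beta> * (p - 1) / p * c0 powr p * (P + b * m)"
proof -
  have "\<beta> / p * (p * c0 powr (p - 1) * I - (p - 1) * c0 powr p * (P + b * m))
      = (\<beta> * c0 powr (p - 1)) * I - \<beta> * (p - 1) / p * c0 powr p * (P + b * m)"
    using p by (simp add: right_diff_distrib)
  then show ?thesis by (simp only: c0_powr)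
qed

text \<open>The lower bound is a sum of three estimates: \<open>T v \<ge> - Q\<close>, the tangent
  bound with \<open>c0\<close>, and |v - g| >= v - g. If \<open>J\<close> does not exceed their
  total, each of them must be an equality.\<close>

lemma J_lower:
  assumes v: "v \<in> W1p \<Omega> p" "continuous_on (cball x0 R) v" and h: "h \<in> Hm \<Omega> m"
    and J: "J \<Omega> p \<beta> (\<lambda>x. 1) g v h \<le> - Q + Km m"
  shows "T v \<le> - Q" "(LINT s|\<mu>. v s - g s) = c0 * (P + b * m)"
proof -
  have cv: "continuous_on S v" by (rule continuous_on_subset[OF v(2)]) auto
  have iv: "integrable \<mu> v" "integrable \<mu> g" by (intro bdry_integrable_continuous cv g_cont)+
  let ?I = "LINT s|\<mu>. \<bar>v s - g s\<bar>" and ?I' = "LINT s|\<mu>. v s - g s"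
  let ?L = "p * c0 powr (p - 1) * ?I - (p - 1) * c0 powr p * (P + b * m)"
  have i1: "integrable \<mu> (\<lambda>s. \<bar>v s - g s\<bar>)" and i2: "integrable \<mu> (\<lambda>s. v s - g s)" using iv by auto
  have II: "?I' \<le> ?I" by (rule integral_mono[OF i2 i1]) simp
  have vP: "0 < vol / P" using vol_pos P_pos by simp
  have bp: "0 < \<beta> / p" using \<beta> p by simp
  have Jv: "J \<Omega> p \<beta> (\<lambda>x. 1) g v h = T v - vol / P * (LINT s|\<mu>. v s) + \<beta> / p * Bd v h"
    unfolding J_eq[OF v HmD(4)[OF h]] T_def by simp
  have I'eq: "vol / P * ?I' = vol / P * (LINT s|\<mu>. v s) - vol / P * (LINT s|\<mu>. g s)"
    using iv by (simp add: right_diff_distrib)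
  have Lb: "\<beta> / p * ?L \<le> \<beta> / p * Bd v h"
    using Bd_lower(1)[OF cv h c0_pos] bp by (intro mult_left_mono) auto
  have Lc: "\<beta> / p * ?L = vol / P * ?I - \<beta> * (p - 1) / p * c0 powr p * (P + b * m)" by (rule Bd_c0)
  have I3: "vol / P * ?I' \<le> vol / P * ?I" using II vP by (intro mult_left_mono) auto
  show T: "T v \<le> - Q" using J Jv I'eq Lb Lc I3 unfolding Km_def by linarith
  have TQ: "- Q \<le> T v" by (rule T_lower[OF v])
  have "\<beta> / p * Bd v h \<le> \<beta> / p * ?L" using J Jv I'eq Lb Lc I3 TQ unfolding Km_def by linarith
  then have "Bd v h \<le> ?L" by (rule mult_left_le_imp_le[OF _ bp])
  then have ae: "AE s in \<mu>. \<bar>v s - g s\<bar> = c0 * (1 + b * h s)" by (rule Bd_lower(2)[OF cv h c0_pos])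
  have "vol / P * ?I \<le> vol / P * ?I'" using J Jv I'eq Lb Lc TQ unfolding Km_def by linarith
  then have "?I \<le> ?I'" by (rule mult_left_le_imp_le[OF _ vP])
  then have "?I = ?I'" using II by simp
  also have "?I = (LINT s|\<mu>. c0 * (1 + b * h s))"
    using ae i1 HmD(4)[OF h] by (intro integral_cong_AE) auto
  also have "\<dots> = c0 * (P + b * m)" using HmD(1,3)[OF h] by (simp add: measure_bdry_space)
  finally show "?I' = c0 * (P + b * m)" by simp
qed

section \<open>The critical mass\<close>

definition gmax :: real where "gmax = (SUP s\<in>S. g s)"

lemma gmax: "s \<in> S \<Longrightarrow> g s \<le> gmax" "\<exists>s\<in>S. g s = gmax"
proof -
  have "S \<noteq> {}" using R_pos by simp
  then obtain t where t: "t \<in> S" "\<And>s. s \<in> S \<Longrightarrow> g s \<le> g t"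
    using continuous_attains_sup[OF compact_sphere _ g_cont] by blast
  then have "gmax = g t" unfolding gmax_def by (intro cSup_eq_maximum) auto
  then show "s \<in> S \<Longrightarrow> g s \<le> gmax" "\<exists>s\<in>S. g s = gmax" using t by auto
qed

text \<open>If \<open>K\<close> is the constant boundary value with
  \<open>K * P - (LINT s|\<mu>. g s) = c0 * (P + b * m)\<close>, then \<open>m = mbar\<close> is the
  mass at which \<open>K - gmax = c0\<close>, so that the density reaches 0 exactly where
  \<open>g\<close> is maximal.\<close>

definition mbar :: real where "mbar = (P * gmax - (LINT s|\<mu>. g s)) / (c0 * b)"

text \<open>A zero value would make \<open>g\<close> equal to its maximum almost everywhere on the
  sphere, hence everywhere by continuity, against non-constancy.\<close>

lemma mbar_pos: "0 < mbar"
proof -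
  have ig: "integrable \<mu> g" by (rule bdry_integrable_continuous[OF g_cont])
  have e: "(LINT s|\<mu>. gmax - g s) = P * gmax - (LINT s|\<mu>. g s)"
    using ig by (simp add: measure_bdry_space)
  have nn: "AE s in \<mu>. 0 \<le> gmax - g s" by (rule AE_I2) (simp add: gmax)
  have "(LINT s|\<mu>. gmax - g s) \<noteq> 0"
  proof
    assume "(LINT s|\<mu>. gmax - g s) = 0"
    then have "AE s in \<mu>. gmax - g s = 0"
      using integral_nonneg_eq_0_iff_AE[OF _ nn] ig by simp
    then have "AE s in \<mu>. gmax = g s" by eventually_elim simp
    then have "gmax = g s" if "s \<in> S" for s
      using bdry_AE_eq_imp_all[OF continuous_on_const g_cont _ that] by blast
    then have "g constant_on S" unfolding constant_on_def by (intro exI[of _ gmax]) auto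
    then show False using g_nonconst by simp
  qed
  moreover have "0 \<le> (LINT s|\<mu>. gmax - g s)" by (rule integral_nonneg_AE[OF nn])
  ultimately have "0 < P * gmax - (LINT s|\<mu>. g s)" using e by linarith
  then show ?thesis using c0_pos b_pos by (simp add: mbar_def)
qed

lemma mbar_mult: "c0 * b * mbar = P * gmax - (LINT s|\<mu>. g s)"
  using c0_pos b_pos by (simp add: mbar_def)


section \<open>Threshold constant and comparison of minimizers\<close>

text \<open>Multiplied out, the defining equation says that the excess of |u - g| over
  \<open>c\<close> has integral \<open>c * (m * b)\<close>. In this form the left side does not
  increase with \<open>c\<close> while the right side strictly increases, which settles uniqueness
  and prepares existence.\<close>

lemma threshold_equation:
  assumes u: "continuous_on S u" and m: "0 < m" and c: "0 < c"
  shows "c = 1 / (measure \<mu> (threshold_set \<Omega> g u c) + m * b) * (LINT \<sigma>:threshold_set \<Omega> g u c|\<mu>. \<bar>u \<sigma> - g \<sigma>\<bar>)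
    \<longleftrightarrow> (LINT s|\<mu>. max (\<bar>u s - g s\<bar> - c) 0) = c * (m * b)"
proof -
  let ?w = "\<lambda>s. \<bar>u s - g s\<bar>"
  let ?T = "threshold_set \<Omega> g u c"
  have cw: "continuous_on S ?w" by (intro continuous_intros u g_cont)
  note [measurable] = measurable_bdry_continuous[OF cw]
  have T: "?T = {s \<in> space \<mu>. c < ?w s}" by (simp add: threshold_set_def)
  have Tm: "?T \<in> sets \<mu>" unfolding T by measurable
  have iw: "integrable \<mu> ?w" by (rule bdry_integrable_continuous[OF cw])
  have i1: "integrable \<mu> (\<lambda>s. indicator ?T s *\<^sub>R ?w s)" by (rule integrable_mult_indicator[OF Tm iw])
  have i2: "integrable \<mu> (\<lambda>s. c * indicator ?T s :: real)"
    using Tm by (intro integrable_mult_right integrable_real_indicator) (auto simp: bdry.emeasure_eq_measure)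
  have "(LINT s|\<mu>. max (?w s - c) 0) = (LINT s|\<mu>. indicator ?T s *\<^sub>R ?w s - c * indicator ?T s)"
    by (intro Bochner_Integration.integral_cong refl) (auto simp: T indicator_def)
  also have "\<dots> = (LINT \<sigma>:?T|\<mu>. ?w \<sigma>) - c * measure \<mu> ?T"
  proof -
    have "?T \<inter> S = ?T" unfolding T by auto
    then show ?thesis
      using Bochner_Integration.integral_diff[OF i1 i2] by (simp add: set_lebesgue_integral_def)
  qed
  finally have F: "(LINT s|\<mu>. max (?w s - c) 0) = (LINT \<sigma>:?T|\<mu>. ?w \<sigma>) - c * measure \<mu> ?T" .
  have pos: "0 < measure \<mu> ?T + m * b" using m b_pos by (intro add_nonneg_pos mult_pos_pos) auto
  have "c = 1 / (measure \<mu> ?T + m * b) * (LINT \<sigma>:?T|\<mu>. ?w \<sigma>) \<longleftrightarrow> c * (measure \<mu> ?T + m * b) = (LINT \<sigma>:?T|\<mu>. ?w \<sigma>)"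
    using pos by (simp add: eq_divide_eq)
  then show ?thesis unfolding F by (auto simp: algebra_simps)
qed

lemma threshold_unique:
  assumes u: "continuous_on S u" and m: "0 < m" and c: "0 < c" "(LINT s|\<mu>. max (\<bar>u s - g s\<bar> - c) 0) = c * (m * b)"
  shows "threshold_const \<Omega> p \<beta> g m u = c"
  unfolding threshold_const_def b_def[symmetric]
proof (rule the_equality)
  let ?F = "\<lambda>c. LINT s|\<mu>. max (\<bar>u s - g s\<bar> - c) 0"
  have i: "integrable \<mu> (\<lambda>s. max (\<bar>u s - g s\<bar> - c) 0)" for c
    by (intro bdry_integrable_continuous continuous_intros u g_cont)
  have mono: "?F d \<le> ?F c" if "c \<le> d" for c d
    using that by (intro integral_mono i) auto
  have mb: "0 < m * b" using m b_pos by simp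
  show "0 < c \<and> c = 1 / (measure \<mu> (threshold_set \<Omega> g u c) + m * b) * (LINT \<sigma>:threshold_set \<Omega> g u c|\<mu>. \<bar>u \<sigma> - g \<sigma>\<bar>)"
    using threshold_equation[OF u m c(1)] c by blast
  fix d assume d: "0 < d \<and> d = 1 / (measure \<mu> (threshold_set \<Omega> g u d) + m * b) * (LINT \<sigma>:threshold_set \<Omega> g u d|\<mu>. \<bar>u \<sigma> - g \<sigma>\<bar>)"
  then have "?F d = d * (m * b)" using threshold_equation[OF u m, of d] by blast
  moreover have "\<not> c < d"
  proof
    assume "c < d"
    then have "c * (m * b) < d * (m * b)" using mb by (rule mult_strict_right_mono)
    then show False using mono[of c d] \<open>c < d\<close> c(2) \<open>?F d = _\<close> by simp
  qed
  moreover have "\<not> d < c"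
  proof
    assume "d < c"
    then have "d * (m * b) < c * (m * b)" using mb by (rule mult_strict_right_mono)
    then show False using mono[of d c] \<open>d < c\<close> c(2) \<open>?F d = _\<close> by simp
  qed
  ultimately show "d = c" by simp
qed

text \<open>Intermediate values between 0 and a bound for |u - g|: the excess integral is Lipschitz
  in \<open>c\<close> and vanishes at the upper end. The root is not 0 because |u - g| has positive
  integral.\<close>

lemma threshold_exists:
  assumes u: "continuous_on S u" and m: "0 < m" and pos: "0 < (LINT s|\<mu>. \<bar>u s - g s\<bar>)"
  obtains c where "0 < c" "(LINT s|\<mu>. max (\<bar>u s - g s\<bar> - c) 0) = c * (m * b)"
proof -
  let ?w = "\<lambda>s. \<bar>u s - g s\<bar>"
  let ?F = "\<lambda>c. LINT s|\<mu>. max (?w s - c) 0"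
  have cw: "continuous_on S ?w" by (intro continuous_intros u g_cont)
  have i: "integrable \<mu> (\<lambda>s. max (?w s - c) 0)" for c
    by (intro bdry_integrable_continuous continuous_intros cw)
  have mb: "0 < m * b" using m b_pos by simp
  have "bounded (?w ` S)" by (intro compact_imp_bounded compact_continuous_image cw) simp
  then obtain C where "\<forall>s\<in>S. \<bar>?w s\<bar> \<le> C" by (auto simp: bounded_iff)
  then have C: "?w s \<le> \<bar>C\<bar> + 1" if "s \<in> S" for s using that by force
  have lip: "\<bar>?F c - ?F d\<bar> \<le> P * \<bar>c - d\<bar>" for c d
  proof -
    have "\<bar>?F c - ?F d\<bar> = \<bar>LINT s|\<mu>. max (?w s - c) 0 - max (?w s - d) 0\<bar>" using i by simp
    also have "\<dots> \<le> (LINT s|\<mu>. \<bar>c - d\<bar>)"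
    proof (rule integral_abs_bound[THEN order_trans], rule integral_mono)
      show "integrable \<mu> (\<lambda>s. \<bar>max (?w s - c) 0 - max (?w s - d) 0\<bar>)"
        using i by (intro integrable_abs Bochner_Integration.integrable_diff)
      show "\<bar>max (?w s - c) 0 - max (?w s - d) 0\<bar> \<le> \<bar>c - d\<bar>" for s by (auto simp: max_def)
    qed simp
    also have "\<dots> = P * \<bar>c - d\<bar>" by (simp add: measure_bdry_space)
    finally show ?thesis .
  qed
  have cF: "isCont ?F c" for c
  proof -
    have "((\<lambda>d. P * \<bar>d - c\<bar>) \<longlongrightarrow> P * \<bar>c - c\<bar>) (at c)" by (intro tendsto_intros)
    then have "((\<lambda>d. P * \<bar>d - c\<bar>) \<longlongrightarrow> 0) (at c)" by simp
    then have "((\<lambda>d. ?F d - ?F c) \<longlongrightarrow> 0) (at c)"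
      by (rule Lim_null_comparison[rotated]) (use lip in simp)
    then show ?thesis unfolding isCont_def by (rule Lim_null[THEN iffD2])
  qed
  have "\<exists>c\<ge>0. c \<le> \<bar>C\<bar> + 1 \<and> ?F c - c * (m * b) = 0"
  proof (rule IVT2)
    have "?F (\<bar>C\<bar> + 1) = (LINT s|\<mu>. 0)"
      using C by (intro Bochner_Integration.integral_cong refl) (auto simp: max_def)
    then show "?F (\<bar>C\<bar> + 1) - (\<bar>C\<bar> + 1) * (m * b) \<le> 0"
      using mb by simp
    have "?F 0 = (LINT s|\<mu>. ?w s)" by (intro Bochner_Integration.integral_cong) auto
    then show "0 \<le> ?F 0 - 0 * (m * b)" using pos by simp
    show "\<forall>c. 0 \<le> c \<and> c \<le> \<bar>C\<bar> + 1 \<longrightarrow> isCont (\<lambda>c. ?F c - c * (m * b)) c"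
      by (intro allI impI continuous_intros cF)
  qed simp
  then obtain c where c: "0 \<le> c" "?F c = c * (m * b)" by auto
  have "c \<noteq> 0"
  proof
    assume "c = 0"
    have "?F 0 = (LINT s|\<mu>. ?w s)" by (intro Bochner_Integration.integral_cong) auto
    then show False using c(2) \<open>c = 0\<close> pos by simp
  qed
  then show ?thesis using that[of c] c by simp
qed

text \<open>The competitor is the radial function with boundary value \<open>K\<close> together with
  the density for which the tangent inequality is an equality. This density is nonnegative because
  \<open>mbar \<le> m\<close>, so the lower bound for \<open>J\<close> is attained.\<close>

lemma minimizer_bound:
  assumes m: "0 < m" "mbar \<le> m" and min: "is_minimizer \<Omega> p \<beta> (\<lambda>x. 1) g m u h"
  shows "J \<Omega> p \<beta> (\<lambda>x. 1) g u h \<le> - Q + Km m"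
proof -
  define W where "W = - ((1 / real DIM('a)) powr (q - 1) / q) * R powr q"
  \<comment> \<open>The boundary value for which the density \<open>h'\<close> has total mass
    \<open>m\<close>.\<close>
  define K where "K = c0 + (c0 * b * m + (LINT s|\<mu>. g s)) / P"
  define v where "v x = w0 x + (K - W)" for x
  \<comment> \<open>Solves \<open>K - g s = c0 * (1 + b * h' s)\<close>, the condition for equality
    in the tangent bound.\<close>
  define h' where "h' s = ((K - g s) / c0 - 1) / b" for s
  have vS: "v s = K" if "s \<in> S" for s using w0_sphere[OF that] by (simp add: v_def W_def)
  have "K - c0 = (c0 * b * m + (LINT s|\<mu>. g s)) / P" by (simp add: K_def)
  then have "(K - c0) * P = c0 * b * m + (LINT s|\<mu>. g s)" using P_pos by (simp add: eq_divide_eq)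
  then have KP: "K * P = c0 * P + c0 * b * m + (LINT s|\<mu>. g s)" by (simp add: algebra_simps)
  have "c0 * b * mbar \<le> c0 * b * m" using m c0_pos b_pos by (intro mult_left_mono) auto
  then have "P * (c0 + gmax) \<le> P * K" using KP mbar_mult by (simp add: algebra_simps)
  then have Kc: "c0 + gmax \<le> K" using P_pos by simp
  have ig: "integrable \<mu> g" by (rule bdry_integrable_continuous[OF g_cont])
  have v: "v \<in> W1p \<Omega> p"
    using W1p_add_scaled[OF w0_W1p(2) const_W1p(2)[of "K - W"], of 1] by (simp add: v_def[abs_def])
  have cv: "continuous_on (cball x0 R) v" unfolding v_def by (intro continuous_intros w0_cont)
  have cvS: "continuous_on S v" by (rule continuous_on_subset[OF cv]) auto
  have hc: "continuous_on S h'" unfolding h'_def using b_pos c0_pos by (intro continuous_intros g_cont) auto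
  have h'0: "0 \<le> h' s" if "s \<in> S" for s
    using gmax(1)[OF that] Kc c0_pos b_pos by (simp add: h'_def divide_simps)
  have "(LINT s|\<mu>. h' s) = ((K * P - (LINT s|\<mu>. g s)) / c0 - P) / b"
    unfolding h'_def using ig by (simp add: measure_bdry_space mult.commute)
  also have "\<dots> = m" using KP c0_pos b_pos by (simp add: field_simps)
  finally have hm: "h' \<in> Hm \<Omega> m"
    using h'0 bdry_integrable_continuous[OF hc] by (auto simp: Hm_def intro!: AE_I2)
  have abs: "\<bar>v s - g s\<bar> = c0 * (1 + b * h' s)" "\<bar>v s - g s\<bar> = K - g s" if "s \<in> S" for s
    using vS[OF that] gmax(1)[OF that] Kc c0_pos b_pos by (simp_all add: h'_def)
  have I: "(LINT s|\<mu>. \<bar>v s - g s\<bar>) = K * P - (LINT s|\<mu>. g s)"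
  proof -
    have "(LINT s|\<mu>. \<bar>v s - g s\<bar>) = (LINT s|\<mu>. K - g s)"
      by (intro Bochner_Integration.integral_cong) (auto simp: abs(2) simp del: mem_sphere)
    then show ?thesis using ig by (simp add: measure_bdry_space mult.commute)
  qed
  have V: "(LINT s|\<mu>. v s) = K * P"
  proof -
    have "(LINT s|\<mu>. v s) = (LINT s|\<mu>. K)"
      by (intro Bochner_Integration.integral_cong) (auto simp: vS simp del: mem_sphere)
    then show ?thesis by (simp add: measure_bdry_space mult.commute)
  qed
  have "AE s in \<mu>. \<bar>v s - g s\<bar> = c0 * (1 + b * h' s)"
    by (rule AE_I2) (simp add: abs(1) del: mem_sphere)
  from Bd_lower(3)[OF cvS hm c0_pos this]
  have "\<beta> / p * Bd v h' = vol / P * (K * P - (LINT s|\<mu>. g s)) - \<beta> * (p - 1) / p * c0 powr p * (P + b * m)"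
    by (simp only: I Bd_c0)
  moreover have "T v = - Q" unfolding v_def by (rule T_w0)
  ultimately have "J \<Omega> p \<beta> (\<lambda>x. 1) g v h' = - Q + Km m"
    using J_eq[OF v cv HmD(4)[OF hm]] unfolding T_def V Km_def right_diff_distrib by linarith
  moreover have "J \<Omega> p \<beta> (\<lambda>x. 1) g u h \<le> J \<Omega> p \<beta> (\<lambda>x. 1) g v h'"
    using min v hm by (auto simp: is_minimizer_def)
  ultimately show ?thesis by simp
qed

text \<open>Such a minimizer is radial, hence equal to a constant \<open>K\<close> on the sphere,
  and \<open>mbar < m\<close> yields \<open>K - gmax > c0\<close>. Nothing is then cut off in the
  threshold equation, which is solved by \<open>c0\<close>, and |u - g| exceeds \<open>c0\<close> at
  every boundary point.\<close>

lemma opt_h_pos_of_large_mass: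
  assumes m: "0 < m" "mbar < m" and min: "is_minimizer \<Omega> p \<beta> (\<lambda>x. 1) g m u h"
    and cu: "continuous_on (cball x0 R) u" and s: "s \<in> S"
  shows "0 < opt_h \<Omega> p \<beta> g m u s"
proof -
  have u: "u \<in> W1p \<Omega> p" and h: "h \<in> Hm \<Omega> m" using min by (auto simp: is_minimizer_def)
  have "J \<Omega> p \<beta> (\<lambda>x. 1) g u h \<le> - Q + Km m" using m by (intro minimizer_bound[OF _ _ min]) auto
  note J = J_lower[OF u cu h this]
  obtain k where k: "\<And>x. x \<in> cball x0 R \<Longrightarrow> u x = w0 x + k" using T_minimal_imp[OF u cu J(1)] by blast
  define K where "K = - ((1 / real DIM('a)) powr (q - 1) / q) * R powr q + k"
  have uS: "u t = K" if "t \<in> S" for t using k[of t] that by (simp add: K_def w0_sphere)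
  have cuS: "continuous_on S u" by (rule continuous_on_subset[OF cu]) auto
  have ig: "integrable \<mu> g" by (rule bdry_integrable_continuous[OF g_cont])
  have "(LINT t|\<mu>. u t - g t) = (LINT t|\<mu>. K - g t)"
    by (intro Bochner_Integration.integral_cong) (auto simp: uS simp del: mem_sphere)
  then have I: "K * P - (LINT t|\<mu>. g t) = c0 * (P + b * m)"
    using J(2) ig by (simp add: measure_bdry_space mult.commute)
  have "c0 * b * mbar < c0 * b * m" using m c0_pos b_pos by simp
  then have "P * (c0 + gmax) < P * K" using I mbar_mult by (simp add: algebra_simps)
  then have Kc: "c0 + gmax < K" using P_pos by simp
  have w: "\<bar>u t - g t\<bar> = K - g t" "c0 < K - g t" if "t \<in> S" for t
    using uS[OF that] gmax(1)[OF that] Kc c0_pos by simp_all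
  have "(LINT t|\<mu>. max (\<bar>u t - g t\<bar> - c0) 0) = (LINT t|\<mu>. K - g t - c0)"
  proof (intro Bochner_Integration.integral_cong refl)
    fix t assume "t \<in> space \<mu>"
    then have "t \<in> S" by simp
    from w(2)[OF this] show "max (\<bar>u t - g t\<bar> - c0) 0 = K - g t - c0"
      unfolding w(1)[OF \<open>t \<in> S\<close>] by simp
  qed
  also have "\<dots> = K * P - (LINT t|\<mu>. g t) - c0 * P" using ig by (simp add: measure_bdry_space mult.commute)
  also have "\<dots> = c0 * (m * b)" using I by (simp add: algebra_simps)
  finally have "threshold_const \<Omega> p \<beta> g m u = c0" by (rule threshold_unique[OF cuS m(1) c0_pos])
  moreover have "(K - g s) / (c0 * b) - 1 / b = (K - g s - c0) / (c0 * b)"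
    using c0_pos b_pos by (simp add: diff_divide_distrib)
  moreover have "0 < (K - g s - c0) / (c0 * b)"
    using w(2)[OF s] c0_pos b_pos by (intro divide_pos_pos mult_pos_pos) auto
  ultimately show ?thesis
    using w[OF s] by (simp add: opt_h_def Let_def b_def[symmetric])
qed

text \<open>If u = g almost everywhere on the boundary, adding a small constant \<open>t\<close>
  gains \<open>t * vol\<close> in the linear term and costs only of order t^p at the boundary,
  against minimality. This guarantees a positive threshold constant.\<close>

lemma minimizer_bdry_gap_pos:
  assumes min: "is_minimizer \<Omega> p \<beta> (\<lambda>x. 1) g m u h" and cu: "continuous_on (cball x0 R) u"
  shows "0 < (LINT s|\<mu>. \<bar>u s - g s\<bar>)"
proof (rule ccontr)
  assume n: "\<not> ?thesis"
  have u: "u \<in> W1p \<Omega> p" and h: "h \<in> Hm \<Omega> m" using min by (auto simp: is_minimizer_def)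
  have cuS: "continuous_on S u" by (rule continuous_on_subset[OF cu]) auto
  have iw: "integrable \<mu> (\<lambda>s. \<bar>u s - g s\<bar>)" by (intro bdry_integrable_continuous continuous_intros cuS g_cont)
  have "0 \<le> (LINT s|\<mu>. \<bar>u s - g s\<bar>)" by simp
  then have "(LINT s|\<mu>. \<bar>u s - g s\<bar>) = 0" using n by linarith
  then have ae: "AE s in \<mu>. u s = g s"
    using integral_nonneg_eq_0_iff_AE[OF iw] by simp
  \<comment> \<open>Chosen so that the boundary cost is at most half of the gain:
    \<open>\<beta> / p * (t powr p * P) = t * (vol / 2)\<close>.\<close>
  define t where "t = (vol * p / (2 * \<beta> * P)) powr (1 / (p - 1))"
  have t: "0 < t" using vol_pos p \<beta> P_pos by (simp add: t_def)
  have tp: "\<beta> / p * (t powr p * P) = t * (vol / 2)"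
  proof -
    have "t powr (p - 1) = vol * p / (2 * \<beta> * P)" using vol_pos p \<beta> P_pos by (simp add: t_def powr_powr)
    then have "t powr p = vol * p / (2 * \<beta> * P) * t" using powr_times_self(2)[of t p] t by simp
    then show ?thesis using p \<beta> P_pos by (simp add: field_simps)
  qed
  let ?v = "\<lambda>x. u x + t * 1"
  have v: "?v \<in> W1p \<Omega> p" by (intro W1p_add_scaled u const_W1p)
  have cv: "continuous_on (cball x0 R) ?v" by (intro continuous_intros cu)
  have cvS: "continuous_on S ?v" by (rule continuous_on_subset[OF cv]) auto
  have "is_weak_gradient \<Omega> ?v (\<lambda>x. weak_gradient \<Omega> u x + t *\<^sub>R 0)"
    by (intro is_weak_gradient_add_scaled W1pD(2)[OF u open_ball] const_W1p Omega_sets)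
  from gradient_powr_integrable(3)[OF v this]
  have G: "(LINT x|lebesgue_on \<Omega>. norm (weak_gradient \<Omega> ?v x) powr p) = (LINT x|lebesgue_on \<Omega>. norm (weak_gradient \<Omega> u x) powr p)"
    by simp
  have "Bd u h = (LINT s|\<mu>. 0)"
    unfolding Bd_def using ae Bd_integrable[OF cuS h] p by (intro integral_cong_AE) (auto elim: eventually_mono)
  then have B0: "Bd u h = 0" by simp
  have "Bd ?v h \<le> (LINT s|\<mu>. t powr p)"
    unfolding Bd_def
  proof (rule integral_mono_AE[OF Bd_integrable[OF cvS h]])
    show "AE s in \<mu>. \<bar>?v s - g s\<bar> powr p / (1 + b * h s) powr (p - 1) \<le> t powr p"
      using ae HmD(2)[OF h]
    proof eventually_elim
      case (elim s)
      then have "1 \<le> 1 + b * h s" using b_pos by simp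
      then have "1 \<le> (1 + b * h s) powr (p - 1)" using p by (intro ge_one_powr_ge_zero) auto
      then show ?case using elim t by (simp add: divide_le_eq mult_le_cancel_left1)
    qed
  qed simp
  then have "\<beta> / p * Bd ?v h \<le> \<beta> / p * (t powr p * P)"
    using \<beta> p by (intro mult_left_mono) (auto simp: measure_bdry_space mult.commute)
  then have Bt: "\<beta> / p * Bd ?v h \<le> t * (vol / 2)" unfolding tp .
  have iu: "integrable (lebesgue_on \<Omega>) u" by (rule Omega_integrable_continuous[OF cu])
  interpret F: finite_measure "lebesgue_on \<Omega>" by (rule finite_measure_Omega)
  have U: "(LINT x|lebesgue_on \<Omega>. ?v x) = (LINT x|lebesgue_on \<Omega>. u x) + t * vol"
    using iu measure_Omega by (simp add: mult.commute)
  have "J \<Omega> p \<beta> (\<lambda>x. 1) g u h \<le> J \<Omega> p \<beta> (\<lambda>x. 1) g ?v h"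
    using min v h unfolding is_minimizer_def by blast
  then have "t * vol \<le> \<beta> / p * Bd ?v h"
    unfolding J_eq[OF u cu HmD(4)[OF h]] J_eq[OF v cv HmD(4)[OF h]] G U B0 by simp
  also note Bt
  finally show False using t vol_pos by simp
qed

text \<open>First variation at a minimizer whose density satisfies \<open>1 + b h = w/c\<close> with \<open>w = \<bar>u - g\<bar> \<ge> c\<close>;
  only an upper bound for the gradient term is needed, so convexity replaces differentiation there.\<close>

lemma first_variation:
  assumes u: "u \<in> W1p \<Omega> p" "continuous_on (cball x0 R) u"
    and \<phi>: "\<phi> \<in> W1p \<Omega> p" "continuous_on (cball x0 R) \<phi>"
    and h: "h \<in> Hm \<Omega> m" and c: "0 < c"
    and hw: "\<And>s. s \<in> S \<Longrightarrow> 1 + b * h s = \<bar>u s - g s\<bar> / c" and w: "\<And>s. s \<in> S \<Longrightarrow> c \<le> \<bar>u s - g s\<bar>"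
    and sgn: "\<And>s. s \<in> S \<Longrightarrow> u s - g s = \<epsilon> * \<bar>u s - g s\<bar>" "\<bar>\<epsilon>\<bar> = 1"
    and min: "\<And>t. 0 < t \<Longrightarrow> J \<Omega> p \<beta> (\<lambda>x. 1) g u h \<le> J \<Omega> p \<beta> (\<lambda>x. 1) g (\<lambda>x. u x + t * \<phi> x) h"
    and A: "\<And>t. 0 < t \<Longrightarrow> t \<le> 1 \<Longrightarrow> (LINT x|lebesgue_on \<Omega>. norm (weak_gradient \<Omega> (\<lambda>x. u x + t * \<phi> x) x) powr p)
      \<le> (LINT x|lebesgue_on \<Omega>. norm (weak_gradient \<Omega> u x) powr p) + t * A"
  shows "0 \<le> A / p + \<beta> * c powr (p - 1) * \<epsilon> * (LINT s|\<mu>. \<phi> s) - (LINT x|lebesgue_on \<Omega>. \<phi> x)"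
proof -
  have cuS: "continuous_on S u" by (rule continuous_on_subset[OF u(2)]) auto
  have c\<phi>S: "continuous_on S \<phi>" by (rule continuous_on_subset[OF \<phi>(2)]) auto
  define w where "w s = \<bar>u s - g s\<bar>" for s
  have w0: "c \<le> w s" "0 < w s" if "s \<in> S" for s using w[OF that] c by (simp_all add: w_def)
  have cw: "continuous_on S w" unfolding w_def by (intro continuous_intros cuS g_cont)
  have "bounded (\<phi> ` S)" by (intro compact_imp_bounded compact_continuous_image c\<phi>S) simp
  then obtain B' where "\<forall>s\<in>S. \<bar>\<phi> s\<bar> \<le> B'" by (auto simp: bounded_iff)
  then have B: "\<bar>\<phi> s\<bar> \<le> \<bar>B'\<bar> + 1" if "s \<in> S" for s using that by force
  define B where "B = \<bar>B'\<bar> + 1"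
  have B: "0 < B" "\<And>s. s \<in> S \<Longrightarrow> \<bar>\<phi> s\<bar> \<le> B" using B by (auto simp: B_def)
  \<comment> \<open>Step sizes tending to 0 with \<open>t n * B \<le> c / 2\<close>: the
    perturbation is at most half of |u - g|, so the sign of u - g is preserved.\<close>
  define t where "t n = min 1 (c / (2 * B)) / real (Suc n)" for n
  have t0: "0 < t n" "t n \<le> 1" "t n * B \<le> c / 2" for n
  proof -
    have m0: "0 < min 1 (c / (2 * B))" using c B by simp
    then show "0 < t n" by (simp add: t_def)
    have "min 1 (c / (2 * B)) / real (Suc n) \<le> min 1 (c / (2 * B)) / 1"
      using m0 by (intro divide_left_mono) auto
    then have le: "t n \<le> min 1 (c / (2 * B))" by (simp add: t_def)
    then show "t n \<le> 1" by simp
    have "t n \<le> c / (2 * B)" using le by simp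
    then show "t n * B \<le> c / 2" using B(1) by (simp add: field_simps)
  qed
  have tl: "t \<longlonglongrightarrow> 0"
    unfolding t_def by (rule LIMSEQ_Suc[OF lim_const_over_n])
  \<comment> \<open>The factor by which the perturbation multiplies |u - g| at \<open>s\<close>; it
    tends to 1.\<close>
  define r where "r n s = 1 + t n * \<epsilon> * \<phi> s / w s" for n s
  have r: "1 / 2 \<le> r n s" "r n s \<le> 2" if s: "s \<in> S" for n s
  proof -
    have "\<bar>t n * \<epsilon> * \<phi> s\<bar> = t n * \<bar>\<phi> s\<bar>" using t0(1)[of n] sgn(2) by (simp add: abs_mult)
    also have "\<dots> \<le> t n * B" using B(2)[OF s] t0(1)[of n] by (intro mult_left_mono) auto
    also have "\<dots> \<le> w s / 2" using t0(3)[of n] w0(1)[OF s] by linarith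
    finally have "\<bar>t n * \<epsilon> * \<phi> s / w s\<bar> \<le> 1 / 2" using w0(2)[OF s] by (simp add: divide_le_eq)
    then have "\<bar>r n s - 1\<bar> \<le> 1 / 2" by (simp add: r_def)
    then show "1 / 2 \<le> r n s" "r n s \<le> 2" by linarith+
  qed
  let ?v = "\<lambda>n x. u x + t n * \<phi> x"
  have v: "?v n \<in> W1p \<Omega> p" for n by (intro W1p_add_scaled u \<phi>)
  have cv: "continuous_on (cball x0 R) (?v n)" for n by (intro continuous_intros u \<phi>)
  have cvS: "continuous_on S (?v n)" for n by (rule continuous_on_subset[OF cv]) auto
  have pw: "\<bar>?v n s - g s\<bar> powr p / (1 + b * h s) powr (p - 1) - \<bar>u s - g s\<bar> powr p / (1 + b * h s) powr (p - 1)
      \<le> p * t n * c powr (p - 1) * (\<epsilon> * \<phi> s * r n s powr (p - 1))" if s: "s \<in> S" for n s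
  proof -
    have ws: "0 < w s" by (rule w0(2)[OF s])
    have rs: "0 < r n s" using r(1)[OF s, of n] by linarith
    have wr: "w s * r n s = w s + t n * \<epsilon> * \<phi> s" using ws by (simp add: r_def distrib_left)
    have "\<epsilon> * \<epsilon> = 1" using sgn(2) by (metis abs_mult_self_eq mult.left_neutral)
    moreover have "\<epsilon> * (w s * r n s) = \<epsilon> * w s + (\<epsilon> * \<epsilon>) * (t n * \<phi> s)"
      unfolding wr by (simp add: algebra_simps)
    ultimately have "?v n s - g s = \<epsilon> * (w s * r n s)"
      using sgn(1)[OF s] by (simp add: w_def[symmetric])
    then have av: "\<bar>?v n s - g s\<bar> = w s * r n s" using sgn(2) ws rs by (simp add: abs_mult)
    have hs: "1 + b * h s = w s / c" using hw[OF s] by (simp add: w_def)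
    define k where "k = (w s / c) powr (p - 1)"
    have k: "0 < k" using ws c by (simp add: k_def)
    have wk: "w s powr (p - 1) / k = c powr (p - 1)" using ws c by (simp add: k_def powr_divide)
    \<comment> \<open>The tangent is taken at the perturbed value and evaluated at the old one,
      which bounds the increment from above. Because the weight is a power of
      \<open>w s / c\<close>, the powers of \<open>w s\<close> cancel and only a power of
      \<open>c\<close> remains.\<close>
    have "p * (w s * r n s) powr (p - 1) * w s - (p - 1) * (w s * r n s) powr p \<le> w s powr p"
      using ws rs by (intro powr_tangent p) auto
    moreover have "(w s * r n s) powr p = (w s * r n s) powr (p - 1) * (w s * r n s)"
      using ws rs by (intro powr_times_self) auto
    ultimately have "(w s * r n s) powr p - w s powr p \<le> p * (w s * r n s) powr (p - 1) * (w s * r n s - w s)"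
      by (simp add: algebra_simps)
    also have "w s * r n s - w s = t n * \<epsilon> * \<phi> s" by (simp add: wr)
    also have "(w s * r n s) powr (p - 1) = w s powr (p - 1) * r n s powr (p - 1)"
      by (rule powr_mult)
    finally have "((w s * r n s) powr p - w s powr p) / k \<le> p * (w s powr (p - 1) * r n s powr (p - 1)) * (t n * \<epsilon> * \<phi> s) / k"
      using k by (intro divide_right_mono) auto
    also have "\<dots> = p * t n * (w s powr (p - 1) / k) * (\<epsilon> * \<phi> s * r n s powr (p - 1))" by simp
    finally show ?thesis
      unfolding av hs k_def[symmetric] wk by (simp add: w_def[symmetric] diff_divide_distrib)
  qed
  have c\<psi>: "continuous_on S (\<lambda>s. \<epsilon> * \<phi> s * r n s powr (p - 1))" for n
  proof -
    have cr: "continuous_on S (\<lambda>s. r n s)" unfolding r_def using w0(2) by (intro continuous_intros c\<phi>S cw) (metis less_irrefl)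
    have "continuous_on S (\<lambda>s. r n s powr (p - 1))"
      by (rule continuous_on_powr[OF cr continuous_on_const]) (use r(1)[of _ n] in fastforce)
    then show ?thesis by (intro continuous_on_mult continuous_on_const c\<phi>S)
  qed
  let ?I = "\<lambda>n. LINT s|\<mu>. \<epsilon> * \<phi> s * r n s powr (p - 1)"
  have step: "0 \<le> A / p + \<beta> * c powr (p - 1) * ?I n - (LINT x|lebesgue_on \<Omega>. \<phi> x)" for n
  proof -
    note i1 = Bd_integrable[OF cvS h, of n] and i2 = Bd_integrable[OF cuS h]
    have i3: "integrable \<mu> (\<lambda>s. p * t n * c powr (p - 1) * (\<epsilon> * \<phi> s * r n s powr (p - 1)))"
      using bdry_integrable_continuous[OF c\<psi>] by (rule integrable_mult_right)
    have "Bd (?v n) h - Bd u h \<le> (LINT s|\<mu>. p * t n * c powr (p - 1) * (\<epsilon> * \<phi> s * r n s powr (p - 1)))"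
      unfolding Bd_def Bochner_Integration.integral_diff[OF i1 i2, symmetric]
      using Bochner_Integration.integrable_diff[OF i1 i2] i3
      by (rule integral_mono) (rule pw, simp)
    also have "\<dots> = t n * (p * c powr (p - 1) * ?I n)" by simp
    finally have "\<beta> / p * (Bd (?v n) h - Bd u h) \<le> \<beta> / p * (t n * (p * c powr (p - 1) * ?I n))"
      using \<beta> p by (intro mult_left_mono) auto
    also have "\<dots> = t n * (\<beta> * c powr (p - 1) * ?I n)" using p by simp
    finally have 1: "\<beta> / p * Bd (?v n) h - \<beta> / p * Bd u h \<le> t n * (\<beta> * c powr (p - 1) * ?I n)"
      by (simp only: right_diff_distrib)
    have "(LINT x|lebesgue_on \<Omega>. norm (weak_gradient \<Omega> (?v n) x) powr p) / p
        \<le> ((LINT x|lebesgue_on \<Omega>. norm (weak_gradient \<Omega> u x) powr p) + t n * A) / p"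
      using A[OF t0(1,2)] p by (intro divide_right_mono) auto
    then have 2: "(LINT x|lebesgue_on \<Omega>. norm (weak_gradient \<Omega> (?v n) x) powr p) / p
        \<le> (LINT x|lebesgue_on \<Omega>. norm (weak_gradient \<Omega> u x) powr p) / p + t n * (A / p)"
      by (simp add: add_divide_distrib)
    have 3: "(LINT x|lebesgue_on \<Omega>. ?v n x) = (LINT x|lebesgue_on \<Omega>. u x) + t n * (LINT x|lebesgue_on \<Omega>. \<phi> x)"
      using Omega_integrable_continuous[OF u(2)] Omega_integrable_continuous[OF \<phi>(2)] by simp
    have "0 \<le> t n * (A / p) + t n * (\<beta> * c powr (p - 1) * ?I n) - t n * (LINT x|lebesgue_on \<Omega>. \<phi> x)"
      using min[OF t0(1)[of n]] 1 2 unfolding J_eq[OF u HmD(4)[OF h]] J_eq[OF v cv HmD(4)[OF h]] 3 by linarith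
    also have "\<dots> = t n * (A / p + \<beta> * c powr (p - 1) * ?I n - (LINT x|lebesgue_on \<Omega>. \<phi> x))"
      by (simp add: distrib_left right_diff_distrib)
    finally show ?thesis using t0(1)[of n] by (simp add: zero_le_mult_iff)
  qed
  have "?I \<longlonglongrightarrow> (LINT s|\<mu>. \<epsilon> * \<phi> s)"
  proof (rule integral_dominated_convergence)
    show "integrable \<mu> (\<lambda>s. B * 2 powr (p - 1))" by simp
    show "(\<lambda>s. \<epsilon> * \<phi> s) \<in> borel_measurable \<mu>" by (intro measurable_bdry_continuous continuous_intros c\<phi>S)
    show "(\<lambda>s. \<epsilon> * \<phi> s * r n s powr (p - 1)) \<in> borel_measurable \<mu>" for n by (rule measurable_bdry_continuous[OF c\<psi>])
    show "AE s in \<mu>. (\<lambda>n. \<epsilon> * \<phi> s * r n s powr (p - 1)) \<longlonglongrightarrow> \<epsilon> * \<phi> s"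
    proof (rule AE_I2)
      fix s
      have "(\<lambda>n. 1 + t n * (\<epsilon> * \<phi> s / w s)) \<longlonglongrightarrow> 1 + 0 * (\<epsilon> * \<phi> s / w s)" by (intro tendsto_intros tl)
      then have "(\<lambda>n. r n s) \<longlonglongrightarrow> 1" by (simp add: r_def mult.assoc)
      then have "(\<lambda>n. r n s powr (p - 1)) \<longlonglongrightarrow> 1 powr (p - 1)" by (intro tendsto_powr tendsto_const) auto
      from tendsto_mult[OF tendsto_const[of "\<epsilon> * \<phi> s"] this]
      show "(\<lambda>n. \<epsilon> * \<phi> s * r n s powr (p - 1)) \<longlonglongrightarrow> \<epsilon> * \<phi> s" by simp
    qed
    show "AE s in \<mu>. norm (\<epsilon> * \<phi> s * r n s powr (p - 1)) \<le> B * 2 powr (p - 1)" for n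
    proof (rule AE_I2)
      fix s assume "s \<in> space \<mu>"
      then have s: "s \<in> S" by simp
      have "r n s powr (p - 1) \<le> 2 powr (p - 1)" using r[OF s, of n] p by (intro powr_mono2) auto
      then have "\<bar>\<phi> s\<bar> * r n s powr (p - 1) \<le> B * 2 powr (p - 1)" using B(1) B(2)[OF s] by (intro mult_mono) auto
      then show "norm (\<epsilon> * \<phi> s * r n s powr (p - 1)) \<le> B * 2 powr (p - 1)" using sgn(2) by (simp add: abs_mult)
    qed
  qed
  then have "(\<lambda>n. A / p + \<beta> * c powr (p - 1) * ?I n - (LINT x|lebesgue_on \<Omega>. \<phi> x))
      \<longlonglongrightarrow> A / p + \<beta> * c powr (p - 1) * (LINT s|\<mu>. \<epsilon> * \<phi> s) - (LINT x|lebesgue_on \<Omega>. \<phi> x)"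
    by (intro tendsto_intros)
  then have "0 \<le> A / p + \<beta> * c powr (p - 1) * (LINT s|\<mu>. \<epsilon> * \<phi> s) - (LINT x|lebesgue_on \<Omega>. \<phi> x)"
    by (rule LIMSEQ_le_const) (use step in blast)
  then show ?thesis by simp
qed

text \<open>Supplies the gradient hypothesis of the first variation in the direction
  \<open>v - u\<close>, with the energy difference as slope. Pointwise convexity comes from two
  tangent inequalities at the convex combination of the norms.\<close>

lemma gradient_segment_convex:
  assumes u: "u \<in> W1p \<Omega> p" and v: "v \<in> W1p \<Omega> p" and t: "0 \<le> t" "t \<le> 1"
  shows "(LINT x|lebesgue_on \<Omega>. norm (weak_gradient \<Omega> (\<lambda>x. u x + t * (v x - u x)) x) powr p)
    \<le> (LINT x|lebesgue_on \<Omega>. norm (weak_gradient \<Omega> u x) powr p)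
      + t * ((LINT x|lebesgue_on \<Omega>. norm (weak_gradient \<Omega> v x) powr p) - (LINT x|lebesgue_on \<Omega>. norm (weak_gradient \<Omega> u x) powr p))"
proof -
  let ?G = "weak_gradient \<Omega> u" and ?H = "weak_gradient \<Omega> v"
  note Gu = W1pD(2)[OF u open_ball] and Gv = W1pD(2)[OF v open_ball]
  have vu: "(\<lambda>x. v x + (-1) * u x) \<in> W1p \<Omega> p" by (intro W1p_add_scaled u v)
  have w: "(\<lambda>x. u x + t * (v x + (-1) * u x)) \<in> W1p \<Omega> p" by (intro W1p_add_scaled u vu)
  have wg: "is_weak_gradient \<Omega> (\<lambda>x. u x + t * (v x + (-1) * u x)) (\<lambda>x. ?G x + t *\<^sub>R (?H x + (-1) *\<^sub>R ?G x))"
    by (intro is_weak_gradient_add_scaled Gu Gv Omega_sets)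
  note i = gradient_powr_integrable(1)[OF u Gu] gradient_powr_integrable(1)[OF v Gv]
  have pw: "norm (?G x + t *\<^sub>R (?H x + (-1) *\<^sub>R ?G x)) powr p \<le> (1 - t) * norm (?G x) powr p + t * norm (?H x) powr p" for x
  proof -
    define y where "y = (1 - t) * norm (?G x) + t * norm (?H x)"
    have y: "0 \<le> y" using t by (simp add: y_def)
    have "?G x + t *\<^sub>R (?H x + (-1) *\<^sub>R ?G x) = (1 - t) *\<^sub>R ?G x + t *\<^sub>R ?H x" by (simp add: algebra_simps)
    then have "norm (?G x + t *\<^sub>R (?H x + (-1) *\<^sub>R ?G x)) \<le> y"
      unfolding y_def using t by (metis abs_of_nonneg diff_ge_0_iff_ge norm_scaleR norm_triangle_ineq)
    then have "norm (?G x + t *\<^sub>R (?H x + (-1) *\<^sub>R ?G x)) powr p \<le> y powr p" using p by (intro powr_mono2) auto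
    also have "\<dots> = (1 - t) * (p * y powr (p - 1) * norm (?G x) - (p - 1) * y powr p)
        + t * (p * y powr (p - 1) * norm (?H x) - (p - 1) * y powr p)"
    proof -
      have "(1 - t) * (p * y powr (p - 1) * norm (?G x) - (p - 1) * y powr p)
        + t * (p * y powr (p - 1) * norm (?H x) - (p - 1) * y powr p) = p * (y powr (p - 1) * y) - (p - 1) * y powr p"
        unfolding y_def by (simp add: algebra_simps)
      also have "y powr (p - 1) * y = y powr p" by (rule powr_times_self(2)[OF y, symmetric])
      finally show ?thesis by (simp add: algebra_simps)
    qed
    also have "\<dots> \<le> (1 - t) * norm (?G x) powr p + t * norm (?H x) powr p"
      using t y by (intro add_mono mult_left_mono powr_tangent(1)[OF p]) auto
    finally show ?thesis .
  qed
  have "(LINT x|lebesgue_on \<Omega>. norm (weak_gradient \<Omega> (\<lambda>x. u x + t * (v x + (-1) * u x)) x) powr p)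
      \<le> (LINT x|lebesgue_on \<Omega>. (1 - t) * norm (?G x) powr p + t * norm (?H x) powr p)"
    unfolding gradient_powr_integrable(3)[OF w wg]
    by (rule integral_mono[OF gradient_powr_integrable(1)[OF w wg]]) (use i pw in auto)
  also have "\<dots> = (1 - t) * (LINT x|lebesgue_on \<Omega>. norm (?G x) powr p) + t * (LINT x|lebesgue_on \<Omega>. norm (?H x) powr p)"
    using i by simp
  finally show ?thesis by (simp add: algebra_simps)
qed

text \<open>In dimension at least 2 the sphere is connected, so a continuous function without zeros
  keeps one sign there.\<close>

lemma connected_sphere_sign:
  assumes f: "continuous_on S f" and nz: "\<And>s. s \<in> S \<Longrightarrow> f s \<noteq> (0::real)"
  obtains \<epsilon> where "\<bar>\<epsilon>\<bar> = 1" "\<And>s. s \<in> S \<Longrightarrow> f s = \<epsilon> * \<bar>f s\<bar>"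
proof -
  have "connected (f ` S)" using DIM_ge_2 by (intro connected_continuous_image f connected_sphere)
  then have c: "a \<in> f ` S \<Longrightarrow> d \<in> f ` S \<Longrightarrow> a \<le> 0 \<Longrightarrow> 0 \<le> d \<Longrightarrow> 0 \<in> f ` S" for a d
    unfolding connected_iff_interval by blast
  then consider "\<And>s. s \<in> S \<Longrightarrow> 0 < f s" | "\<And>s. s \<in> S \<Longrightarrow> f s < 0"
    using nz by (metis (no_types, lifting) image_eqI imageE linorder_neqE_linordered_idom less_imp_le)
  then show ?thesis
  proof cases
    case 1
    then show ?thesis by (intro that[of 1]) (auto simp: abs_of_pos simp del: mem_sphere)
  next
    case 2
    then show ?thesis by (intro that[of "-1"]) (auto simp: abs_of_neg simp del: mem_sphere)
  qed
qed

text \<open>The contrapositive form of the small-mass case. Positivity of the density almost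
  everywhere leaves no active obstacle, so first variations in both constant directions and towards
  \<open>w0\<close> are available; they force the constant \<open>c0\<close> and the radial shape.
  The bound |u - g| >= c0 at a maximum of \<open>g\<close> then bounds the mass from below.\<close>

lemma mass_ge_mbar:
  assumes m: "0 < m" and min: "is_minimizer \<Omega> p \<beta> (\<lambda>x. 1) g m u h"
    and cu: "continuous_on (cball x0 R) u"
    and c: "0 < c" "(LINT s|\<mu>. max (\<bar>u s - g s\<bar> - c) 0) = c * (m * b)"
    and ae: "AE s in \<mu>. c < \<bar>u s - g s\<bar>"
  shows "mbar \<le> m"
proof -
  have u: "u \<in> W1p \<Omega> p" and h: "h \<in> Hm \<Omega> m" using min by (auto simp: is_minimizer_def)
  have cuS: "continuous_on S u" by (rule continuous_on_subset[OF cu]) auto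
  have cw: "continuous_on S (\<lambda>s. \<bar>u s - g s\<bar>)" by (intro continuous_intros cuS g_cont)
  have iw: "integrable \<mu> (\<lambda>s. \<bar>u s - g s\<bar>)" by (rule bdry_integrable_continuous[OF cw])
  have ig: "integrable \<mu> g" by (rule bdry_integrable_continuous[OF g_cont])
  have wc: "c \<le> \<bar>u s - g s\<bar>" if "s \<in> S" for s
    using ae by (intro bdry_AE_imp_all[OF continuous_on_const cw _ that]) (auto elim: eventually_mono)
  have "(LINT s|\<mu>. max (\<bar>u s - g s\<bar> - c) 0) = (LINT s|\<mu>. \<bar>u s - g s\<bar> - c)"
  proof (intro Bochner_Integration.integral_cong refl)
    fix s assume "s \<in> space \<mu>"
    then have "c \<le> \<bar>u s - g s\<bar>" using wc by simp
    then show "max (\<bar>u s - g s\<bar> - c) 0 = \<bar>u s - g s\<bar> - c" by simp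
  qed
  also have "\<dots> = (LINT s|\<mu>. \<bar>u s - g s\<bar>) - c * P" using iw by (simp add: measure_bdry_space mult.commute)
  finally have Iw: "(LINT s|\<mu>. \<bar>u s - g s\<bar>) = c * (P + b * m)" using c(2) by (simp add: algebra_simps)
  \<comment> \<open>The given \<open>h\<close> is only an element of \<open>Hm\<close>; this density
    makes the tangent inequality an equality for \<open>u\<close> and has the same mass, so it is
    optimal for \<open>u\<close> too and has an explicit formula.\<close>
  define h' where "h' s = (\<bar>u s - g s\<bar> / c - 1) / b" for s
  have hw: "1 + b * h' s = \<bar>u s - g s\<bar> / c" for s using b_pos by (simp add: h'_def)
  have hc: "continuous_on S h'" unfolding h'_def using b_pos c by (intro continuous_intros cw) auto
  have h'0: "0 \<le> h' s" if "s \<in> S" for s using wc[OF that] c b_pos by (simp add: h'_def divide_simps)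
  have "(LINT s|\<mu>. h' s) = ((LINT s|\<mu>. \<bar>u s - g s\<bar>) / c - P) / b"
    unfolding h'_def using iw by (simp add: measure_bdry_space)
  also have "\<dots> = m" unfolding Iw using c b_pos by simp
  finally have hm: "h' \<in> Hm \<Omega> m"
    using h'0 bdry_integrable_continuous[OF hc] by (auto simp: Hm_def intro!: AE_I2)
  have "Bd u h' \<le> Bd u h"
  proof -
    have "AE s in \<mu>. \<bar>u s - g s\<bar> = c * (1 + b * h' s)" using c by (simp add: hw)
    then show ?thesis using Bd_lower(3)[OF cuS hm c(1)] Bd_lower(1)[OF cuS h c(1)] by simp
  qed
  then have "\<beta> / p * Bd u h' \<le> \<beta> / p * Bd u h" using \<beta> p by (intro mult_left_mono) auto
  then have Jh: "J \<Omega> p \<beta> (\<lambda>x. 1) g u h' \<le> J \<Omega> p \<beta> (\<lambda>x. 1) g u h"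
    unfolding J_eq[OF u cu HmD(4)[OF h]] J_eq[OF u cu HmD(4)[OF hm]] by simp
  have min': "J \<Omega> p \<beta> (\<lambda>x. 1) g u h' \<le> J \<Omega> p \<beta> (\<lambda>x. 1) g v h'" if "v \<in> W1p \<Omega> p" for v
    using Jh min that hm unfolding is_minimizer_def by (meson order_trans)
  have nz: "u s - g s \<noteq> 0" if "s \<in> S" for s using wc[OF that] c by auto
  have cd: "continuous_on S (\<lambda>s. u s - g s)" by (intro continuous_intros cuS g_cont)
  obtain \<epsilon> where \<epsilon>: "\<bar>\<epsilon>\<bar> = 1" "\<And>s. s \<in> S \<Longrightarrow> u s - g s = \<epsilon> * \<bar>u s - g s\<bar>"
    using connected_sphere_sign[OF cd nz] by blast
  have var: "0 \<le> A / p + \<beta> * c powr (p - 1) * \<epsilon> * (LINT s|\<mu>. \<phi> s) - (LINT x|lebesgue_on \<Omega>. \<phi> x)"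
    if \<phi>: "\<phi> \<in> W1p \<Omega> p" "continuous_on (cball x0 R) \<phi>"
      and A: "\<And>t. 0 < t \<Longrightarrow> t \<le> 1 \<Longrightarrow> (LINT x|lebesgue_on \<Omega>. norm (weak_gradient \<Omega> (\<lambda>x. u x + t * \<phi> x) x) powr p)
      \<le> (LINT x|lebesgue_on \<Omega>. norm (weak_gradient \<Omega> u x) powr p) + t * A" for \<phi> A
  proof (rule first_variation[OF u cu \<phi> hm c(1) hw wc \<epsilon>(2,1)])
    show "J \<Omega> p \<beta> (\<lambda>x. 1) g u h' \<le> J \<Omega> p \<beta> (\<lambda>x. 1) g (\<lambda>x. u x + t * \<phi> x) h'" for t
      by (intro min' W1p_add_scaled u \<phi>)
  qed (assumption | rule A)+
  \<comment> \<open>Constant directions do not change the gradient; taking \<open>k\<close> of both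
    signs turns the inequality into an equation that fixes
    \<open>\<beta> * c powr (p - 1) * \<epsilon> * P\<close>.\<close>
  have const: "0 \<le> \<beta> * c powr (p - 1) * \<epsilon> * (k * P) - k * vol" for k
  proof -
    have "0 \<le> 0 / p + \<beta> * c powr (p - 1) * \<epsilon> * (LINT s|\<mu>. k) - (LINT x|lebesgue_on \<Omega>. k)"
    proof (rule var[OF const_W1p(2) continuous_on_const])
      fix t :: real
      have "is_weak_gradient \<Omega> (\<lambda>x. u x + t * k) (\<lambda>x. weak_gradient \<Omega> u x + t *\<^sub>R 0)"
        by (intro is_weak_gradient_add_scaled W1pD(2)[OF u open_ball] const_W1p Omega_sets)
      from gradient_powr_integrable(3)[OF W1p_add_scaled[OF u const_W1p(2)] this]
      show "(LINT x|lebesgue_on \<Omega>. norm (weak_gradient \<Omega> (\<lambda>x. u x + t * k) x) powr p)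
        \<le> (LINT x|lebesgue_on \<Omega>. norm (weak_gradient \<Omega> u x) powr p) + t * 0" by simp
    qed
    then show ?thesis using measure_Omega by (simp add: measure_bdry_space mult_ac)
  qed
  have bal: "\<beta> * c powr (p - 1) * \<epsilon> * P = vol" using const[of 1] const[of "-1"] by simp
  \<comment> \<open>The volume is positive, so the balance rules out a boundary value below
    \<open>g\<close>.\<close>
  have "\<epsilon> = 1"
  proof (rule ccontr)
    assume "\<epsilon> \<noteq> 1"
    then have "\<epsilon> = -1" using \<epsilon>(1) by linarith
    moreover have "0 < \<beta> * c powr (p - 1) * P" using \<beta> c P_pos by simp
    ultimately show False using bal vol_pos by simp
  qed
  have bc: "\<beta> * c powr (p - 1) = vol / P" using bal \<open>\<epsilon> = 1\<close> P_pos by (simp add: eq_divide_eq)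
  then have "c powr (p - 1) = c0 powr (p - 1)" using c0_powr \<beta> by (metis mult_left_cancel less_irrefl)
  then have "(c powr (p - 1)) powr (1 / (p - 1)) = (c0 powr (p - 1)) powr (1 / (p - 1))" by simp
  then have cc: "c = c0" using c(1) c0_pos p by (simp add: powr_powr)
  \<comment> \<open>The direction towards the radial function; with the slope from convexity the
    variation inequality becomes \<open>T u \<le> T w0\<close>.\<close>
  let ?\<phi> = "\<lambda>x. w0 x - u x"
  have \<phi>: "?\<phi> \<in> W1p \<Omega> p" using W1p_add_scaled[OF w0_W1p(2) u, of "-1"] by simp
  have c\<phi>: "continuous_on (cball x0 R) ?\<phi>" by (intro continuous_intros w0_cont cu)
  let ?E = "\<lambda>v. LINT x|lebesgue_on \<Omega>. norm (weak_gradient \<Omega> v x) powr p"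
  have "0 \<le> (?E w0 - ?E u) / p + \<beta> * c powr (p - 1) * \<epsilon> * (LINT s|\<mu>. ?\<phi> s) - (LINT x|lebesgue_on \<Omega>. ?\<phi> x)"
    by (rule var[OF \<phi> c\<phi>]) (rule gradient_segment_convex[OF u w0_W1p(2)], auto)
  moreover have "(LINT s|\<mu>. ?\<phi> s) = (LINT s|\<mu>. w0 s) - (LINT s|\<mu>. u s)"
    using bdry_integrable_continuous[OF w0_cont] bdry_integrable_continuous[OF cuS] by simp
  moreover have "(LINT x|lebesgue_on \<Omega>. ?\<phi> x) = (LINT x|lebesgue_on \<Omega>. w0 x) - (LINT x|lebesgue_on \<Omega>. u x)"
    using Omega_integrable_continuous[OF w0_cont] Omega_integrable_continuous[OF cu] by simp
  ultimately have "T u \<le> T w0"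
    unfolding T_def bc \<open>\<epsilon> = 1\<close> by (simp add: right_diff_distrib diff_divide_distrib)
  then have "T u \<le> - Q" using T_w0[of 0] by simp
  then obtain k where k: "\<And>x. x \<in> cball x0 R \<Longrightarrow> u x = w0 x + k" using T_minimal_imp[OF u cu] by blast
  define K where "K = - ((1 / real DIM('a)) powr (q - 1) / q) * R powr q + k"
  have uS: "u t = K" if "t \<in> S" for t using k[of t] that by (simp add: K_def w0_sphere)
  have w: "\<bar>u s - g s\<bar> = K - g s" if "s \<in> S" for s
    using \<epsilon>(2)[OF that] \<open>\<epsilon> = 1\<close> uS[OF that] by simp
  \<comment> \<open>The bound |u - g| >= c is most restrictive where \<open>g\<close> is maximal,
    and there it compares \<open>K\<close> with \<open>c0 + gmax\<close>.\<close>
  obtain s where s: "s \<in> S" "g s = gmax" using gmax(2) by blast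
  have Kc: "c0 \<le> K - gmax" using wc[OF s(1)] w[OF s(1)] s(2) cc by simp
  have "(LINT s|\<mu>. \<bar>u s - g s\<bar>) = (LINT s|\<mu>. K - g s)"
    using w by (intro Bochner_Integration.integral_cong refl) (auto simp del: mem_sphere)
  then have "K * P - (LINT s|\<mu>. g s) = c0 * (P + b * m)"
    using Iw ig cc by (simp add: measure_bdry_space mult.commute)
  moreover have "P * (c0 + gmax) \<le> P * K" using Kc P_pos by (intro mult_left_mono) auto
  ultimately have "c0 * b * mbar \<le> c0 * b * m" unfolding mbar_mult by (simp add: algebra_simps)
  then show ?thesis using c0_pos b_pos by simp
qed

lemma opt_h_vanishes_of_small_mass:
  assumes m: "0 < m" "m < mbar" and min: "is_minimizer \<Omega> p \<beta> (\<lambda>x. 1) g m u h"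
    and cu: "continuous_on (cball x0 R) u"
  shows "\<exists>A \<in> sets \<mu>. A \<subseteq> frontier \<Omega> \<and> emeasure \<mu> A > 0 \<and> (\<forall>\<sigma>\<in>A. opt_h \<Omega> p \<beta> g m u \<sigma> = 0)"
proof -
  have cuS: "continuous_on S u" by (rule continuous_on_subset[OF cu]) auto
  have cw: "continuous_on S (\<lambda>s. \<bar>u s - g s\<bar>)" by (intro continuous_intros cuS g_cont)
  note [measurable] = measurable_bdry_continuous[OF cw]
  obtain c where c: "0 < c" "(LINT s|\<mu>. max (\<bar>u s - g s\<bar> - c) 0) = c * (m * b)"
    using threshold_exists[OF cuS m(1) minimizer_bdry_gap_pos[OF min cu]] by blast
  have tc: "threshold_const \<Omega> p \<beta> g m u = c" by (rule threshold_unique[OF cuS m(1) c])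
  \<comment> \<open>The zero set of the optimal density; if it were null, |u - g| would exceed
    \<open>c\<close> almost everywhere and the mass would be at least \<open>mbar\<close>.\<close>
  define A where "A = {s \<in> space \<mu>. \<bar>u s - g s\<bar> \<le> c}"
  have A: "A \<in> sets \<mu>" unfolding A_def by measurable
  have "emeasure \<mu> A \<noteq> 0"
  proof
    assume "emeasure \<mu> A = 0"
    then have "AE s in \<mu>. s \<notin> A" using A by (intro AE_not_in) auto
    then have "AE s in \<mu>. c < \<bar>u s - g s\<bar>" using AE_space by eventually_elim (auto simp: A_def)
    then show False using mass_ge_mbar[OF m(1) min cu c] m(2) by simp
  qed
  then show ?thesis
    using A by (intro bexI[of _ A]) (auto simp: A_def opt_h_def tc zero_less_iff_neq_zero)
qed

end

theorem corollary4p4: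
  fixes x0 :: "'a::euclidean_space" and R p \<beta> :: real and g :: "'a \<Rightarrow> real"
    and \<Omega> :: "'a set"
  assumes "DIM('a) \<ge> 2" and "p > 1" and "\<beta> > 0"
    and "R > 0" and "\<Omega> = ball x0 R"
    and "continuous_on (frontier \<Omega>) g" and "\<not> g constant_on (frontier \<Omega>)"
  shows "\<exists>mbar>0. \<forall>m>0. \<forall>u h.
    is_minimizer \<Omega> p \<beta> (\<lambda>x. 1) g m u h \<and> continuous_on (closure \<Omega>) u \<longrightarrow>
      (m < mbar \<longrightarrow>
        (\<exists>A \<in> sets (bdry_measure \<Omega>). A \<subseteq> frontier \<Omega> \<and> emeasure (bdry_measure \<Omega>) A > 0 \<and>
          (\<forall>\<sigma>\<in>A. opt_h \<Omega> p \<beta> g m u \<sigma> = 0))) \<and>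
      (m > mbar \<longrightarrow> (\<forall>\<sigma>\<in>frontier \<Omega>. opt_h \<Omega> p \<beta> g m u \<sigma> > 0))"
proof -
  have fr: "frontier \<Omega> = sphere x0 R" and cl: "closure \<Omega> = cball x0 R"
    using assms(4,5) by (simp_all add: frontier_ball)
  interpret robin_ball x0 R p \<beta> g
    using assms fr by unfold_locales auto
  show ?thesis
    unfolding assms(5)
  proof (intro exI[of _ mbar] conjI allI impI ballI mbar_pos)
    fix m u h
    assume m: "0 < m" and u: "is_minimizer (ball x0 R) p \<beta> (\<lambda>x. 1) g m u h \<and> continuous_on (closure (ball x0 R)) u"
    then have min: "is_minimizer (ball x0 R) p \<beta> (\<lambda>x. 1) g m u h" and cu: "continuous_on (cball x0 R) u"
      using R_pos by auto
    show "\<exists>A \<in> sets (bdry_measure (ball x0 R)). A \<subseteq> frontier (ball x0 R) \<and>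
        emeasure (bdry_measure (ball x0 R)) A > 0 \<and> (\<forall>\<sigma>\<in>A. opt_h (ball x0 R) p \<beta> g m u \<sigma> = 0)" if "m < mbar"
      by (rule opt_h_vanishes_of_small_mass[OF m that min cu])
    show "0 < opt_h (ball x0 R) p \<beta> g m u s" if "mbar < m" "s \<in> frontier (ball x0 R)" for s
      using that by (intro opt_h_pos_of_large_mass[OF m _ min cu]) simp_all
  qed
qed

end
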